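(* (i) $s_6\neq 0$ on $\mathrm{Vect}(2)$, i.e. $s_6(X_1,\ldots,X_6)\neq0$ for some $X_1,\ldots,X_6\in \mathrm{Vect}(2)$. (ii) $s_6$ is a $6$-commutator on $\mathrm{Vect}(2)$, i.e. $s_6(X_1,\ldots,X_6)\in \mathrm{Vect}(2)$ for all $X_1,\ldots,X_6\in \mathrm{Vect}(2)$. (iii) $s_7=0$ is an identity on $\mathrm{Vect}(2)$, i.e. $s_7(X_1,\ldots,X_7)=0$ for all $X_1,\ldots,X_7\in \mathrm{Vect}(2)$. (iv) The $6$-commutator $s_6$ on $\mathrm{Vect}(2)$ is primitive. (v) $s_6(X_1,\ldots,X_6)=s_6^{\mathrm{rsym.r}}(X_1,\ldots,X_6)$ for all $X_1,\ldots,X_6\in \mathrm{Vect}(2)$. (vi) For any $X_1,\ldots,X_6\in \mathrm{Vect}(2)$, $$s_6(X_1,\ldots,X_6)=\sum_{i=1}^6(-1)^{i+1}\,\mathrm{Div}\,X_i\; s_5(X_1,\ldots,\widehat{X_i},\ldots,X_6).$$ (vii) $(\mathrm{Vect}(2),s_6)$ is a $5$-left commutative algebra. (viii) $(\mathrm{Vect}(2),\{s_2,s_6\})$ is an $sh$-Lie algebra.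
   Context: Let $U=\mathbb{C}[x_1,x_2]$, $\partial_i=\partial/\partial x_i$, and let $\mathrm{Diff}(2)$ be the space of differential operators $\sum_\alpha u_\alpha\partial^\alpha$ (finite sums, $u_\alpha\in U$). Operators are written as acting on the right: $(f)X$ is the result of applying $X$ to $f$, and the associative product $X\cdot Y$ is composition in the order "first $X$, then $Y$"; thus $u\partial_i\cdot v\partial_j=v\,\partial_j(u)\,\partial_i+uv\,\partial_i\partial_j$. $\mathrm{Vect}(2)=\{u_1\partial_1+u_2\partial_2:u_i\in U\}$, $\mathrm{Div}(u_1\partial_1+u_2\partial_2)=\partial_1(u_1)+\partial_2(u_2)$, $[X,Y]=X\cdot Y-Y\cdot X$. For $w\in U$, the product of $w$ with an operator multiplies coefficients: $w\,(u\partial^\alpha)=(wu)\partial^\alpha$. $s_k(X_1,\ldots,X_k)=\sum_{\sigma\in \mathrm{Sym}_k}\mathrm{sign}(\sigma)\,X_{\sigma(1)}\cdots X_{\sigma(k)}$, computed in $(\mathrm{Diff}(2),\cdot)$ (so $s_5$ of elements of $\mathrm{Vect}(2)$ is in general only an element of $\mathrm{Diff}(2)$). The right-symmetric multiplication is $u\partial_i\circ v\partial_j=v\,\partial_j(u)\,\partial_i$ on $\mathrm{Vect}(2)$ (bilinear), and $s_6^{\mathrm{rsym.r}}(X_1,\ldots,X_6)=\sum_{\sigma\in \mathrm{Sym}_6}\mathrm{sign}(\sigma)\,(\cdots((X_{\sigma(1)}\circ X_{\sigma(2)})\circ X_{\sigma(3)})\cdots)\circ X_{\sigma(6)}$. Primitive: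 $s_6$ is primitive on $\mathrm{Vect}(2)$ if there is no noncommutative polynomial $f(t_1,\ldots,t_6)$ such that $s_6(X_1,\ldots,X_6)=f^{[\,,\,]}(X_1,\ldots,X_6)$ for all $X_1,\ldots,X_6\in\mathrm{Vect}(2)$, where $f^{[\,,\,]}$ is obtained by replacing each monomial $t_{i_1}t_{i_2}\cdots t_{i_l}$ of $f$ by the left-normed commutator $[\cdots[[X_{i_1},X_{i_2}],X_{i_3}],\ldots,X_{i_l}]$. For a skew-symmetric $m$-linear operation $\omega$ on $A$, $(A,\omega)$ is $(m-1)$-left commutative if $\sum_{\sigma\in \mathrm{Sym}_{2m-2}}\mathrm{sign}(\sigma)\,\omega(a_{\sigma(1)},\ldots,a_{\sigma(m-1)},\omega(a_{\sigma(m)},\ldots,a_{\sigma(2m-2)},a_{2m-1}))=0$ for all $a_1,\ldots,a_{2m-1}\in A$, and $m$-homotopical Lie if $\sum_{\sigma\in \mathrm{Sym}_{2m-1}}\mathrm{sign}(\sigma)\,\omega(a_{\sigma(1)},\ldots,a_{\sigma(m-1)},\omega(a_{\sigma(m)},\ldots,a_{\sigma(2m-1)}))=0$ for all $a_i\in A$. For skew-symmetric operations $\omega_2$ (2-linear) and $\omega_m$ ($m$-linear, $m>2$), $(A,\{\omega_2,\omega_m\})$ is $sh$-Lie (strongly homotopical Lie, all other operations being zero) means: $(A,\omega_2)$ is a Lie algebra, $(A,\omega_m)$ is $m$-homotopical Lie, and $\omega_m$ is an $m$-cocycle of the adjoint module of $(A,\omega_2)$, i.e., writing $[\,,\,]=\omega_2$,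 $$\sum_{i<j}(-1)^{i+j}\omega_m([a_i,a_j],a_1,\ldots,\widehat{a_i},\ldots,\widehat{a_j},\ldots,a_{m+1})+\sum_{i=1}^{m+1}(-1)^{i+1}[a_i,\omega_m(a_1,\ldots,\widehat{a_i},\ldots,a_{m+1})]=0.$$ *)

theory Defs
  imports
    "HOL-Computational_Algebra.Polynomial"
    "HOL-Combinatorics.Permutations"
    "HOL-Library.Poly_Mapping"
begin

section \<open>The polynomial algebra in two variables\<close>

text \<open>
  \<open>U = C[x1, x2]\<close> is modelled as \<open>C[x1][x2]\<close>: the outer polynomial variable is \<open>x2\<close>,
  the coefficients are polynomials in \<open>x1\<close>.
\<close>

type_synonym U = "complex poly poly"

definition x1 :: U where "x1 = [:[:0, 1:]:]"
definition x2 :: U where "x2 = [:0, 1:]"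

definition d1 :: "U \<Rightarrow> U" where "d1 u = map_poly pderiv u"
definition d2 :: "U \<Rightarrow> U" where "d2 u = pderiv u"

definition const :: "complex \<Rightarrow> U" where "const c = [:[:c:]:]"

lemma coeff_d1: "coeff (d1 u) n = pderiv (coeff u n)"
  by (simp add: d1_def coeff_map_poly)

lemma d1_0 [simp]: "d1 0 = 0" and d2_0 [simp]: "d2 0 = 0"
  by (simp_all add: d1_def d2_def)

lemma d1_add: "d1 (u + v) = d1 u + d1 v"
  by (rule poly_eqI) (simp add: coeff_d1 pderiv_add)

lemma d2_add: "d2 (u + v) = d2 u + d2 v"
  by (simp add: d2_def pderiv_add)

lemma pderiv_sum': "pderiv (sum f A) = (\<Sum>i\<in>A. pderiv (f i))"
  by (induction A rule: infinite_finite_induct) (simp_all add: pderiv_add)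

lemma d1_mult: "d1 (u * v) = d1 u * v + u * d1 v"
proof (rule poly_eqI)
  fix n
  have "coeff (d1 (u * v)) n =
      (\<Sum>i\<le>n. pderiv (coeff u i) * coeff v (n - i) + coeff u i * pderiv (coeff v (n - i)))"
    by (simp add: coeff_d1 coeff_mult pderiv_sum' pderiv_mult mult.commute add.commute)
  then show "coeff (d1 (u * v)) n = coeff (d1 u * v + u * d1 v) n"
    by (simp add: coeff_mult coeff_d1 sum.distrib)
qed

lemma d2_mult: "d2 (u * v) = d2 u * v + u * d2 v"
  by (simp add: d2_def pderiv_mult algebra_simps)

lemma d1_sum: "d1 (sum f A) = (\<Sum>i\<in>A. d1 (f i))"
  by (induction A rule: infinite_finite_induct) (simp_all add: d1_add)

lemma d2_sum: "d2 (sum f A) = (\<Sum>i\<in>A. d2 (f i))"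
  by (induction A rule: infinite_finite_induct) (simp_all add: d2_add)

lemma d2_d1: "d2 (d1 u) = d1 (d2 u)"
  by (rule poly_eqI)
     (simp add: coeff_d1 d2_def coeff_pderiv pderiv_mult of_nat_poly pderiv_pCons pderiv_smult)

lemma d2_d1_funpow: "d2 ((d1 ^^ i) u) = (d1 ^^ i) (d2 u)"
  by (induction i) (simp_all add: d2_d1)

lemma d_generators [simp]: "d1 x1 = 1" "d1 x2 = 0" "d2 x1 = 0" "d2 x2 = 1"
  by (simp_all add: d1_def d2_def x1_def x2_def map_poly_pCons pderiv_pCons one_pCons)


section \<open>Differential operators\<close>

text \<open>
  A differential operator is a finite sum of \<open>u \<partial>^\<alpha>\<close>, considered as an operator on \<open>U\<close>.
  Since the characteristic is 0, the coefficients \<open>u_\<alpha>\<close> are determined by the operator, so this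
  is the same thing as the formal expression.
\<close>

definition is_diff_op :: "(U \<Rightarrow> U) \<Rightarrow> bool" where
  "is_diff_op D \<longleftrightarrow> (\<exists>(A :: (nat \<times> nat) set) u. finite A \<and>
     D = (\<lambda>f. \<Sum>(i, j)\<in>A. u (i, j) * (d1 ^^ i) ((d2 ^^ j) f)))"

lemma is_diff_op_term: "is_diff_op (\<lambda>f. u * (d1 ^^ i) ((d2 ^^ j) f))"
  unfolding is_diff_op_def
  by (rule exI[of _ "{(i, j)}"], rule exI[of _ "\<lambda>_. u"]) simp

lemma is_diff_op_0: "is_diff_op (\<lambda>f. 0)"
  using is_diff_op_term[of 0] by simp

lemma is_diff_op_add:
  assumes "is_diff_op D" "is_diff_op E"
  shows "is_diff_op (\<lambda>f. D f + E f)"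
proof -
  obtain A u where A: "finite A" "D = (\<lambda>f. \<Sum>(i, j)\<in>A. u (i, j) * (d1 ^^ i) ((d2 ^^ j) f))"
    using assms(1) unfolding is_diff_op_def by blast
  obtain B v where B: "finite B" "E = (\<lambda>f. \<Sum>(i, j)\<in>B. v (i, j) * (d1 ^^ i) ((d2 ^^ j) f))"
    using assms(2) unfolding is_diff_op_def by blast
  define u' where "u' a = (if a \<in> A then u a else 0)" for a
  define v' where "v' a = (if a \<in> B then v a else 0)" for a
  have D: "D f = (\<Sum>(i, j)\<in>A \<union> B. u' (i, j) * (d1 ^^ i) ((d2 ^^ j) f))" for f
    unfolding A(2) u'_def using A(1) B(1)
    by (intro sum.mono_neutral_cong_left) auto
  have E: "E f = (\<Sum>(i, j)\<in>A \<union> B. v' (i, j) * (d1 ^^ i) ((d2 ^^ j) f))" for f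
    unfolding B(2) v'_def using A(1) B(1)
    by (intro sum.mono_neutral_cong_left) auto
  have "(\<lambda>f. D f + E f) =
      (\<lambda>f. \<Sum>(i, j)\<in>A \<union> B. (u' (i, j) + v' (i, j)) * (d1 ^^ i) ((d2 ^^ j) f))"
    by (rule ext) (simp add: D E sum.distrib[symmetric] case_prod_beta distrib_right)
  then show ?thesis
    unfolding is_diff_op_def using A(1) B(1)
    by (intro exI[of _ "A \<union> B"] exI[of _ "\<lambda>a. u' a + v' a"]) simp
qed

lemma is_diff_op_sum:
  "(\<And>a. a \<in> A \<Longrightarrow> is_diff_op (D a)) \<Longrightarrow> is_diff_op (\<lambda>f. \<Sum>a\<in>A. D a f)"
  by (induction A rule: infinite_finite_induct) (auto intro: is_diff_op_0 is_diff_op_add)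

lemma is_diff_op_scale:
  assumes "is_diff_op D"
  shows "is_diff_op (\<lambda>f. w * D f)"
proof -
  obtain A u where A: "finite A" "D = (\<lambda>f. \<Sum>(i, j)\<in>A. u (i, j) * (d1 ^^ i) ((d2 ^^ j) f))"
    using assms unfolding is_diff_op_def by blast
  have "is_diff_op (\<lambda>f. \<Sum>a\<in>A. (w * u a) * (d1 ^^ fst a) ((d2 ^^ snd a) f))"
    by (intro is_diff_op_sum is_diff_op_term)
  also have "(\<lambda>f. \<Sum>a\<in>A. (w * u a) * (d1 ^^ fst a) ((d2 ^^ snd a) f)) = (\<lambda>f. w * D f)"
    by (rule ext) (simp add: A(2) sum_distrib_left case_prod_beta mult.assoc)
  finally show ?thesis .
qed

lemma is_diff_op_d1:
  assumes "is_diff_op D"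
  shows "is_diff_op (\<lambda>f. d1 (D f))"
proof -
  obtain A u where A: "finite A" "D = (\<lambda>f. \<Sum>(i, j)\<in>A. u (i, j) * (d1 ^^ i) ((d2 ^^ j) f))"
    using assms unfolding is_diff_op_def by blast
  have "is_diff_op (\<lambda>f. \<Sum>a\<in>A. d1 (u a) * (d1 ^^ fst a) ((d2 ^^ snd a) f) +
          u a * (d1 ^^ Suc (fst a)) ((d2 ^^ snd a) f))"
    by (intro is_diff_op_sum is_diff_op_add is_diff_op_term)
  also have "(\<lambda>f. \<Sum>a\<in>A. d1 (u a) * (d1 ^^ fst a) ((d2 ^^ snd a) f) +
          u a * (d1 ^^ Suc (fst a)) ((d2 ^^ snd a) f)) = (\<lambda>f. d1 (D f))"
    by (rule ext) (simp add: A(2) d1_sum d1_mult case_prod_beta)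
  finally show ?thesis .
qed

lemma is_diff_op_d2:
  assumes "is_diff_op D"
  shows "is_diff_op (\<lambda>f. d2 (D f))"
proof -
  obtain A u where A: "finite A" "D = (\<lambda>f. \<Sum>(i, j)\<in>A. u (i, j) * (d1 ^^ i) ((d2 ^^ j) f))"
    using assms unfolding is_diff_op_def by blast
  have "is_diff_op (\<lambda>f. \<Sum>a\<in>A. d2 (u a) * (d1 ^^ fst a) ((d2 ^^ snd a) f) +
          u a * (d1 ^^ fst a) ((d2 ^^ Suc (snd a)) f))"
    by (intro is_diff_op_sum is_diff_op_add is_diff_op_term)
  also have "(\<lambda>f. \<Sum>a\<in>A. d2 (u a) * (d1 ^^ fst a) ((d2 ^^ snd a) f) +
          u a * (d1 ^^ fst a) ((d2 ^^ Suc (snd a)) f)) = (\<lambda>f. d2 (D f))"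
    by (rule ext) (simp add: A(2) d2_sum d2_mult case_prod_beta d2_d1_funpow)
  finally show ?thesis .
qed

lemma is_diff_op_comp:
  assumes "is_diff_op D" "is_diff_op E"
  shows "is_diff_op (\<lambda>f. E (D f))"
proof -
  obtain A u where A: "finite A" "E = (\<lambda>f. \<Sum>(i, j)\<in>A. u (i, j) * (d1 ^^ i) ((d2 ^^ j) f))"
    using assms(2) unfolding is_diff_op_def by blast
  have 2: "is_diff_op (\<lambda>f. (d2 ^^ j) (D f))" for j
    by (induction j) (simp_all add: assms(1) is_diff_op_d2)
  have 1: "is_diff_op (\<lambda>f. (d1 ^^ i) ((d2 ^^ j) (D f)))" for i j
    by (induction i) (simp_all add: 2 is_diff_op_d1)
  have "is_diff_op (\<lambda>f. \<Sum>a\<in>A. u a * (d1 ^^ fst a) ((d2 ^^ snd a) (D f)))"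
    by (intro is_diff_op_sum is_diff_op_scale 1)
  then show ?thesis
    by (simp add: A(2) case_prod_beta)
qed

typedef diff_op = "{D. is_diff_op D}"
  morphisms apply_op Abs_diff_op
  using is_diff_op_0 by blast

setup_lifting type_definition_diff_op

lemma diff_op_eqI: "(\<And>f. apply_op X f = apply_op Y f) \<Longrightarrow> X = Y"
  by (simp add: apply_op_inject[symmetric] fun_eq_iff)

lemma apply_op_add_right: "apply_op X (f + g) = apply_op X f + apply_op X g"
proof -
  have 2: "(d2 ^^ j) (f + g) = (d2 ^^ j) f + (d2 ^^ j) g" for j and f g :: U
    by (induction j) (simp_all add: d2_add)
  have 1: "(d1 ^^ i) (f + g) = (d1 ^^ i) f + (d1 ^^ i) g" for i and f g :: U
    by (induction i) (simp_all add: d1_add)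
  show ?thesis
    using apply_op[of X] unfolding is_diff_op_def mem_Collect_eq
    by (auto simp: 1 2 distrib_left sum.distrib case_prod_beta)
qed

text \<open>Operators act on the right: the product \<open>X * Y\<close> applies first \<open>X\<close>, then \<open>Y\<close>.\<close>

instantiation diff_op :: ring_1
begin

lift_definition zero_diff_op :: diff_op is "\<lambda>f. 0" by (rule is_diff_op_0)
lift_definition one_diff_op :: diff_op is "\<lambda>f. f"
  using is_diff_op_term[of 1 0 0] by simp
lift_definition plus_diff_op :: "diff_op \<Rightarrow> diff_op \<Rightarrow> diff_op" is "\<lambda>D E f. D f + E f"
  by (rule is_diff_op_add)
lift_definition uminus_diff_op :: "diff_op \<Rightarrow> diff_op" is "\<lambda>D f. - D f"
  using is_diff_op_scale[where w = "-1"] by simp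
lift_definition minus_diff_op :: "diff_op \<Rightarrow> diff_op \<Rightarrow> diff_op" is "\<lambda>D E f. D f - E f"
  using is_diff_op_add[OF _ is_diff_op_scale[where w = "-1"]] by simp
lift_definition times_diff_op :: "diff_op \<Rightarrow> diff_op \<Rightarrow> diff_op" is "\<lambda>D E f. E (D f)"
  by (rule is_diff_op_comp)

instance
proof
  fix a b c :: diff_op
  show "a * b * c = a * (b * c)" by transfer simp
  show "1 * a = a" by transfer simp
  show "a * 1 = a" by transfer simp
  show "(a + b) * c = a * c + b * c"
    by (rule diff_op_eqI) (simp add: times_diff_op.rep_eq plus_diff_op.rep_eq apply_op_add_right)
  show "a * (b + c) = a * b + a * c" by transfer simp
  show "a + b + c = a + (b + c)" by transfer (simp add: add.assoc)
  show "a + b = b + a" by transfer (simp add: add.commute)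
  show "0 + a = a" by transfer simp
  show "- a + a = 0" by transfer simp
  show "a - b = a + - b" by transfer simp
  show "(0 :: diff_op) \<noteq> 1" by transfer (metis zero_neq_one)
qed

end

text \<open>The product \<open>w (u \<partial>^\<alpha>) = (w u) \<partial>^\<alpha>\<close>.\<close>

definition scale :: "U \<Rightarrow> diff_op \<Rightarrow> diff_op" (infixr "\<cdot>" 75) where
  "w \<cdot> X = Abs_diff_op (\<lambda>f. w * apply_op X f)"

lemma apply_op_scale: "apply_op (w \<cdot> X) f = w * apply_op X f"
  using is_diff_op_scale[of "apply_op X" w] apply_op[of X]
  by (simp add: scale_def Abs_diff_op_inverse)

lift_definition D1 :: diff_op is d1
  using is_diff_op_term[of 1 1 0] by simp

lift_definition D2 :: diff_op is d2
  using is_diff_op_term[of 1 0 1] by simp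

lemmas apply_op_simps = plus_diff_op.rep_eq minus_diff_op.rep_eq uminus_diff_op.rep_eq
  zero_diff_op.rep_eq one_diff_op.rep_eq times_diff_op.rep_eq apply_op_scale D1.rep_eq D2.rep_eq

lemma product_formula:
  "(u \<cdot> D1) * (v \<cdot> D1) = (v * d1 u) \<cdot> D1 + (u * v) \<cdot> (D1 * D1)"
  "(u \<cdot> D1) * (v \<cdot> D2) = (v * d2 u) \<cdot> D1 + (u * v) \<cdot> (D1 * D2)"
  "(u \<cdot> D2) * (v \<cdot> D1) = (v * d1 u) \<cdot> D2 + (u * v) \<cdot> (D2 * D1)"
  "(u \<cdot> D2) * (v \<cdot> D2) = (v * d2 u) \<cdot> D2 + (u * v) \<cdot> (D2 * D2)"
  by (rule diff_op_eqI; simp add: apply_op_simps d1_mult d2_mult algebra_simps)+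


section \<open>Vector fields\<close>

definition Vect2 :: "diff_op set" where
  "Vect2 = {u1 \<cdot> D1 + u2 \<cdot> D2 | u1 u2. True}"

text \<open>
  For \<open>X = u1 \<cdot> D1 + u2 \<cdot> D2\<close> the coefficients are recovered as \<open>u1 = (x1)X\<close> and \<open>u2 = (x2)X\<close>.
  The two definitions below are only meant for arguments in \<open>Vect2\<close>.
\<close>

definition Div :: "diff_op \<Rightarrow> U" where
  "Div X = d1 (apply_op X x1) + d2 (apply_op X x2)"

definition rsym :: "diff_op \<Rightarrow> diff_op \<Rightarrow> diff_op" where
  "rsym X Y = apply_op Y (apply_op X x1) \<cdot> D1 + apply_op Y (apply_op X x2) \<cdot> D2"

lemma Vect2_coefficients:
  "apply_op (u1 \<cdot> D1 + u2 \<cdot> D2) x1 = u1" "apply_op (u1 \<cdot> D1 + u2 \<cdot> D2) x2 = u2"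
  by (simp_all add: apply_op_simps)

lemma Div_Vect2: "Div (u1 \<cdot> D1 + u2 \<cdot> D2) = d1 u1 + d2 u2"
  by (simp add: Div_def Vect2_coefficients)

lemma rsym_Vect2:
  "rsym (u \<cdot> D1) (v \<cdot> D1) = (v * d1 u) \<cdot> D1"
  "rsym (u \<cdot> D1) (v \<cdot> D2) = (v * d2 u) \<cdot> D1"
  "rsym (u \<cdot> D2) (v \<cdot> D1) = (v * d1 u) \<cdot> D2"
  "rsym (u \<cdot> D2) (v \<cdot> D2) = (v * d2 u) \<cdot> D2"
  by (rule diff_op_eqI; simp add: rsym_def apply_op_simps)+

definition cscale :: "complex \<Rightarrow> diff_op \<Rightarrow> diff_op" where
  "cscale c X = const c \<cdot> X"

lemma const_simps: "const (a + b) = const a + const b" "const (a * b) = const a * const b" "const 1 = 1"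
  by (simp_all add: const_def one_pCons)

interpretation diff_op: vector_space cscale
proof
  fix a b :: complex and x y :: diff_op
  show "cscale a (x + y) = cscale a x + cscale a y"
    by (rule diff_op_eqI) (simp add: cscale_def apply_op_simps distrib_left)
  show "cscale (a + b) x = cscale a x + cscale b x"
    by (rule diff_op_eqI) (simp add: cscale_def apply_op_simps const_simps distrib_right)
  show "cscale a (cscale b x) = cscale (a * b) x"
    by (rule diff_op_eqI) (simp add: cscale_def apply_op_simps const_simps mult.assoc)
  show "cscale 1 x = x"
    by (rule diff_op_eqI) (simp add: cscale_def apply_op_simps const_simps)
qed

lemma apply_op_const: "apply_op X (const c * f) = const c * apply_op X f"
proof -
  have d2: "d2 (const c * f) = const c * d2 f" for f
    by (simp add: d2_mult) (simp add: d2_def const_def pderiv_pCons)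
  have d1: "d1 (const c * f) = const c * d1 f" for f
    by (simp add: d1_mult) (simp add: d1_def const_def map_poly_pCons pderiv_pCons)
  have 2: "(d2 ^^ j) (const c * f) = const c * (d2 ^^ j) f" for j f
    by (induction j) (simp_all add: d2)
  have 1: "(d1 ^^ i) (const c * f) = const c * (d1 ^^ i) f" for i f
    by (induction i) (simp_all add: d1)
  show ?thesis
    using apply_op[of X] unfolding is_diff_op_def mem_Collect_eq
    by (auto simp: 1 2 sum_distrib_left case_prod_beta mult.left_commute)
qed

lemma rsym_bilinear:
  "rsym (X + X') Y = rsym X Y + rsym X' Y" "rsym X (Y + Y') = rsym X Y + rsym X Y'"
  "rsym (cscale c X) Y = cscale c (rsym X Y)" "rsym X (cscale c Y) = cscale c (rsym X Y)"
  by (rule diff_op_eqI;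
      simp add: rsym_def cscale_def apply_op_simps apply_op_add_right apply_op_const algebra_simps)+

definition comm :: "diff_op \<Rightarrow> diff_op \<Rightarrow> diff_op" where
  "comm X Y = X * Y - Y * X"


section \<open>Skew-symmetric sums and multilinear operations\<close>

text \<open>
  A \<open>k\<close>-ary operation is a function on lists, of which only the values on lists of length \<open>k\<close>
  matter.  Lists are indexed from 0, hence the permutations of \<open>{..<k}\<close>; the arguments are usually
  given as \<open>map X [1..<k+1]\<close>, that is, \<open>[X 1, \<dots>, X k]\<close>.
\<close>

definition skew_sum :: "nat \<Rightarrow> (diff_op list \<Rightarrow> diff_op) \<Rightarrow> diff_op list \<Rightarrow> diff_op" where
  "skew_sum k g xs = (\<Sum>\<sigma> | \<sigma> permutes {..<k}. of_int (sign \<sigma>) * g (permute_list \<sigma> xs))"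

fun left_normed :: "('a \<Rightarrow> 'a \<Rightarrow> 'a) \<Rightarrow> 'a::zero list \<Rightarrow> 'a" where
  "left_normed op [] = 0"
| "left_normed op (x # xs) = foldl op x xs"

definition s :: "nat \<Rightarrow> diff_op list \<Rightarrow> diff_op" where
  "s k = skew_sum k prod_list"

definition s_rsym_r :: "nat \<Rightarrow> diff_op list \<Rightarrow> diff_op" where
  "s_rsym_r k = skew_sum k (left_normed rsym)"

definition multilinear_operation :: "nat \<Rightarrow> diff_op set \<Rightarrow> (diff_op list \<Rightarrow> diff_op) \<Rightarrow> bool" where
  "multilinear_operation m A \<omega> \<longleftrightarrow>
     diff_op.subspace A \<and>
     (\<forall>xs. length xs = m \<and> set xs \<subseteq> A \<longrightarrow> \<omega> xs \<in> A) \<and>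
     (\<forall>xs ys. length xs + 1 + length ys = m \<and> set xs \<subseteq> A \<and> set ys \<subseteq> A \<longrightarrow>
        (\<forall>x\<in>A. \<forall>y\<in>A. \<omega> (xs @ [x + y] @ ys) = \<omega> (xs @ [x] @ ys) + \<omega> (xs @ [y] @ ys)) \<and>
        (\<forall>c. \<forall>x\<in>A. \<omega> (xs @ [cscale c x] @ ys) = cscale c (\<omega> (xs @ [x] @ ys))))"

definition skew_operation :: "nat \<Rightarrow> diff_op set \<Rightarrow> (diff_op list \<Rightarrow> diff_op) \<Rightarrow> bool" where
  "skew_operation m A \<omega> \<longleftrightarrow>
     multilinear_operation m A \<omega> \<and>
     (\<forall>xs \<sigma>. length xs = m \<and> set xs \<subseteq> A \<and> \<sigma> permutes {..<m} \<longrightarrow>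
        \<omega> (permute_list \<sigma> xs) = of_int (sign \<sigma>) * \<omega> xs)"


section \<open>Primitivity\<close>

text \<open>
  A noncommutative polynomial in \<open>t_1, \<dots>, t_k\<close> is a finitely supported function on words in
  \<open>1, \<dots>, k\<close>.  The constant term has no counterpart as a commutator, so \<open>f\<close> is required to have
  none.
\<close>

definition commutator_value :: "(nat list \<Rightarrow>\<^sub>0 complex) \<Rightarrow> (nat \<Rightarrow> diff_op) \<Rightarrow> diff_op" where
  "commutator_value f X =
     (\<Sum>w\<in>Poly_Mapping.keys f. cscale (Poly_Mapping.lookup f w) (left_normed comm (map X w)))"

definition primitive :: "nat \<Rightarrow> diff_op set \<Rightarrow> (diff_op list \<Rightarrow> diff_op) \<Rightarrow> bool" where
  "primitive k A \<omega> \<longleftrightarrow>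
     \<not> (\<exists>f. Poly_Mapping.keys f \<subseteq> {w. w \<noteq> [] \<and> set w \<subseteq> {1..k}} \<and>
          (\<forall>X. X ` {1..k} \<subseteq> A \<longrightarrow> \<omega> (map X [1..<k+1]) = commutator_value f X))"


section \<open>Left commutative, homotopical Lie and sh-Lie algebras\<close>

definition left_commutative :: "nat \<Rightarrow> diff_op set \<Rightarrow> (diff_op list \<Rightarrow> diff_op) \<Rightarrow> bool" where
  "left_commutative n A \<omega> \<longleftrightarrow>
     skew_operation (n+1) A \<omega> \<and>
     (\<forall>a. a ` {1..2*n+1} \<subseteq> A \<longrightarrow>
        (\<Sum>\<sigma> | \<sigma> permutes {1..2*n}. of_int (sign \<sigma>) *
           \<omega> (map (a \<circ> \<sigma>) [1..<n+1] @
              [\<omega> (map (a \<circ> \<sigma>) [n+1..<2*n+1] @ [a (2*n+1)])])) = 0)"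

definition homotopical_Lie :: "nat \<Rightarrow> diff_op set \<Rightarrow> (diff_op list \<Rightarrow> diff_op) \<Rightarrow> bool" where
  "homotopical_Lie m A \<omega> \<longleftrightarrow>
     skew_operation m A \<omega> \<and>
     (\<forall>a. a ` {1..2*m-1} \<subseteq> A \<longrightarrow>
        (\<Sum>\<sigma> | \<sigma> permutes {1..2*m-1}. of_int (sign \<sigma>) *
           \<omega> (map (a \<circ> \<sigma>) [1..<m] @ [\<omega> (map (a \<circ> \<sigma>) [m..<2*m])])) = 0)"

definition Lie_algebra :: "diff_op set \<Rightarrow> (diff_op list \<Rightarrow> diff_op) \<Rightarrow> bool" where
  "Lie_algebra A \<omega> \<longleftrightarrow>
     skew_operation 2 A \<omega> \<and>
     (\<forall>a\<in>A. \<omega> [a, a] = 0) \<and>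
     (\<forall>a\<in>A. \<forall>b\<in>A. \<forall>c\<in>A. \<omega> [\<omega> [a, b], c] + \<omega> [\<omega> [b, c], a] + \<omega> [\<omega> [c, a], b] = 0)"

definition adjoint_cocycle ::
  "nat \<Rightarrow> diff_op set \<Rightarrow> (diff_op list \<Rightarrow> diff_op) \<Rightarrow> (diff_op list \<Rightarrow> diff_op) \<Rightarrow> bool" where
  "adjoint_cocycle m A \<omega>\<^sub>2 \<omega> \<longleftrightarrow>
     (\<forall>a. a ` {1..m+1} \<subseteq> A \<longrightarrow>
        (\<Sum>(i, j) \<in> {(i, j). 1 \<le> i \<and> i < j \<and> j \<le> m+1}.
           (-1) ^ (i + j) * \<omega> (\<omega>\<^sub>2 [a i, a j] # map a (filter (\<lambda>l. l \<noteq> i \<and> l \<noteq> j) [1..<m+2]))) +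
        (\<Sum>i = 1..m+1.
           (-1) ^ (i + 1) * \<omega>\<^sub>2 [a i, \<omega> (map a (filter (\<lambda>l. l \<noteq> i) [1..<m+2]))]) = 0)"

definition sh_Lie ::
  "nat \<Rightarrow> diff_op set \<Rightarrow> (diff_op list \<Rightarrow> diff_op) \<Rightarrow> (diff_op list \<Rightarrow> diff_op) \<Rightarrow> bool" where
  "sh_Lie m A \<omega>\<^sub>2 \<omega> \<longleftrightarrow>
     m > 2 \<and> Lie_algebra A \<omega>\<^sub>2 \<and> homotopical_Lie m A \<omega> \<and> adjoint_cocycle m A \<omega>\<^sub>2 \<omega>"

end

theory Submission
  imports Defs "HOL-Combinatorics.Multiset_Permutations"
begin

text \<open>
  Let \<open>\<theta>\<^sub>1, \<dots>, \<theta>\<^sub>k\<close> be anticommuting variables and \<open>X = \<Sum>\<^sub>i \<theta>\<^sub>i X\<^sub>i\<close>.  Multiplying out \<open>X ^ k\<close> and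
  sorting the \<open>\<theta>\<close>s in each term produces exactly the signs of \<open>s\<^sub>k\<close>, so \<open>s\<^sub>k(X\<^sub>1, \<dots>, X\<^sub>k)\<close> is the
  coefficient of the product of all the \<open>\<theta>\<close>s.  Identities between skew-symmetric sums of vector
  fields thus become identities between powers of a single vector field
  \<open>X = \<xi>\<^sub>1 \<partial>\<^sub>1 + \<xi>\<^sub>2 \<partial>\<^sub>2\<close> whose coefficients anticommute (\<open>oddop_power_eq_s\<close>,
  \<open>oddop_product_eq_skew_sum\<close>).

  Write \<open>A = (\<partial>\<^sub>i \<xi>\<^sub>j)\<close>, \<open>\<delta> = tr A\<close> for the divergence, and \<open>c = \<xi>\<^sub>1 \<xi>\<^sub>2\<close>.  Two facts carry the proof.
  First, \<open>c\<close> is killed by \<open>\<xi>\<^sub>1\<close> and \<open>\<xi>\<^sub>2\<close>, whence \<open>X c = - \<delta> c\<close> as operators.  Second, modulo the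
  right ideal generated by \<open>c\<close>, multiplication by \<open>X\<close> sends \<open>\<xi>\<^sub>1 P + \<xi>\<^sub>2 Q\<close> to
  \<open>\<xi>\<^sub>1 P' + \<xi>\<^sub>2 Q'\<close> with \<open>(P', Q') = A (P, Q)\<close>; and \<open>A ^ 4 = 0\<close>, as for every \<open>2 \<times> 2\<close> matrix with
  anticommuting entries (this is the Amitsur--Levitzki identity for \<open>2 \<times> 2\<close> matrices).  Hence
  \<open>X ^ 5\<close> is a right multiple of \<open>c\<close>, so \<open>X ^ 6 = - \<delta> X ^ 5\<close>, which is the divergence formula, and
  \<open>X ^ 7 = \<delta> \<delta> X ^ 5 = 0\<close>.  The second order part of \<open>X ^ 6\<close> is \<open>\<delta> c\<close> times entries of \<open>A ^ 3\<close>, and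
  these terms cancel, so \<open>s\<^sub>6\<close> takes values in vector fields; it then agrees with the iterated
  right-symmetric product because both sides act alike on the coordinates.

  The divergence formula also gives a non-zero value cheaply: if only one argument has non-zero
  divergence, a single \<open>s\<^sub>5\<close> remains.  For primitivity, an expression of \<open>s\<^sub>6\<close> by commutators may be
  replaced by its part that is linear in every argument; skew-symmetrizing it multiplies \<open>s\<^sub>6\<close> by
  \<open>6!\<close> but kills every commutator of length at least 3, by the Jacobi identity.

  Left commutativity is a matter of counting derivatives.  Expand both operations into words.  A word
  contains ten skew-symmetrized fields and one more, so its coefficients are products of ten of the
  \<open>\<partial>\<^sup>\<alpha> \<xi>\<^sub>i\<close> of total order at most eleven, one for each field of the word.  There are only two such
  factors of order 0 and four of order 1, and each can occur once; so ten of them need at least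
  \<open>4 + 2 * 4 = 12\<close> derivatives.  In the homotopical Lie identity all eleven fields are
  skew-symmetrized, and \<open>X ^ 11 = 0\<close>.  Finally, the cocycle condition holds for every \<open>s\<^sub>m\<close> with \<open>m\<close>
  even: one sum is \<open>[X, X ^ m] = 0\<close>, and in the other \<open>X ^ 2\<close> is put into \<open>m\<close> places with alternating
  signs.
\<close>

section \<open>Operators on functions with Grassmann variables\<close>

lemma apply_op_zero [simp]: "apply_op A 0 = 0"
  using apply_op_add_right[of A 0 0] by simp

lemma apply_op_minus: "apply_op A (- f) = - apply_op A f"
  using apply_op_add_right[of A f "- f"] by (simp add: eq_neg_iff_add_eq_0 add.commute)

lemma apply_op_sum_right: "apply_op A (\<Sum>i\<in>I. f i) = (\<Sum>i\<in>I. apply_op A (f i))"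
  by (induction I rule: infinite_finite_induct) (simp_all add: apply_op_add_right)

lemma apply_op_power_sign: "apply_op A ((- 1) ^ n * f) = (- 1) ^ n * apply_op A f"
  by (cases "even n") (simp_all add: apply_op_minus)

lemma apply_op_power_sign_left: "apply_op ((- 1) ^ n * A) f = (- 1) ^ n * apply_op A f"
  by (cases "even n") (simp_all add: apply_op_simps)

lemma apply_op_sum_left: "apply_op (\<Sum>i\<in>I. A i) f = (\<Sum>i\<in>I. apply_op (A i) f)"
  by (induction I rule: infinite_finite_induct) (simp_all add: apply_op_simps)

lemma apply_op_of_int: "apply_op (of_int n * A) f = of_int n * apply_op A f"
proof -
  have nat: "apply_op (of_nat k * A) f = of_nat k * apply_op A f" for k
    by (induction k) (simp_all add: distrib_right apply_op_simps apply_op_add_right del: times_diff_op.rep_eq)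
  show ?thesis
    by (cases n rule: int_cases2) (simp_all add: nat apply_op_simps(3))
qed

text \<open>
  Additive maps on the functions that assign an element of \<open>U\<close> to every set of indices; the value at
  \<open>S\<close> is thought of as the coefficient of the monomial \<open>\<Prod>\<^sub>k\<^sub>\<in>\<^sub>S \<theta>\<^sub>k\<close>, in decreasing order of \<open>k\<close>.  Working
  with operators on these functions instead of with the Grassmann algebra makes multiplication
  composition, so that associativity needs no proof, and it accommodates the derivations as well.
\<close>

typedef gop = "{h :: (nat set \<Rightarrow> U) \<Rightarrow> nat set \<Rightarrow> U.
    \<forall>F G. h (\<lambda>S. F S + G S) = (\<lambda>S. h F S + h G S)}"
  morphisms act Abs_gop
  by (rule exI[of _ "\<lambda>F. F"]) simp

setup_lifting type_definition_gop

lemma act_add: "act h (\<lambda>S. F S + G S) = (\<lambda>S. act h F S + act h G S)"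
  using act[of h] by blast

lemma gop_eqI: "(\<And>F S. act g F S = act h F S) \<Longrightarrow> g = h"
  by (simp add: act_inject[symmetric] fun_eq_iff)

instantiation gop :: ring_1
begin

lift_definition zero_gop :: gop is "\<lambda>F S. 0" by simp
lift_definition one_gop :: gop is "\<lambda>F. F" by simp
lift_definition plus_gop :: "gop \<Rightarrow> gop \<Rightarrow> gop" is "\<lambda>g h F S. g F S + h F S"
  by (simp add: algebra_simps)
lift_definition uminus_gop :: "gop \<Rightarrow> gop" is "\<lambda>g F S. - g F S"
  by (simp add: algebra_simps)
lift_definition minus_gop :: "gop \<Rightarrow> gop \<Rightarrow> gop" is "\<lambda>g h F S. g F S - h F S"
  by (simp add: algebra_simps)
lift_definition times_gop :: "gop \<Rightarrow> gop \<Rightarrow> gop" is "\<lambda>g h F. g (h F)"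
  by simp

instance
proof
  fix a b c :: gop
  show "a * b * c = a * (b * c)" by transfer simp
  show "1 * a = a" by transfer simp
  show "a * 1 = a" by transfer simp
  show "(a + b) * c = a * c + b * c" by transfer simp
  show "a * (b + c) = a * b + a * c"
    by (rule gop_eqI) (simp add: times_gop.rep_eq plus_gop.rep_eq act_add)
  show "a + b + c = a + (b + c)" by transfer (simp add: add.assoc)
  show "a + b = b + a" by transfer (simp add: add.commute)
  show "0 + a = a" by transfer simp
  show "- a + a = 0" by transfer simp
  show "a - b = a + - b" by transfer simp
  show "(0 :: gop) \<noteq> 1"
    by transfer (metis zero_neq_one)
qed

end

lemmas act_simps = zero_gop.rep_eq one_gop.rep_eq plus_gop.rep_eq uminus_gop.rep_eq
  minus_gop.rep_eq times_gop.rep_eq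

lemma act_sum: "act (\<Sum>i\<in>I. h i) F S = (\<Sum>i\<in>I. act (h i) F S)"
  by (induction I rule: infinite_finite_induct) (simp_all add: act_simps)

lift_definition evenop :: "diff_op \<Rightarrow> gop" is "\<lambda>A F S. apply_op A (F S)"
  by (simp add: apply_op_add_right)

text \<open>
  The operator \<open>\<Sum>\<^sub>k \<theta>\<^sub>k \<phi>\<^sub>k\<close>: the sign is that of moving \<open>\<theta>\<^sub>k\<close> past the larger variables of the
  monomial to its place.  On infinite sets the sum is \<open>0\<close> by convention.  Allowing \<open>\<phi>\<close> to be an
  arbitrary family of operators covers the single variables, the odd coefficients \<open>\<Sum>\<^sub>k \<theta>\<^sub>k u\<^sub>k\<close> and
  the odd vector fields.
\<close>

lift_definition oddop :: "(nat \<Rightarrow> diff_op) \<Rightarrow> gop" is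
  "\<lambda>\<phi> F S. \<Sum>k\<in>S. (- 1) ^ card {j \<in> S. k < j} * apply_op (\<phi> k) (F (S - {k}))"
  by (simp add: apply_op_add_right distrib_left sum.distrib)

text \<open>
  Operators of \<open>diff_op\<close> act on the right, those of \<open>gop\<close> on the left, so products are reversed.
\<close>

lemma evenop_times: "evenop (A * B) = evenop B * evenop A"
  by (rule gop_eqI) (simp add: act_simps evenop.rep_eq apply_op_simps)

lemma evenop_add: "evenop (A + B) = evenop A + evenop B"
  by (rule gop_eqI) (simp add: act_simps evenop.rep_eq apply_op_simps)

lemma evenop_diff: "evenop (A - B) = evenop A - evenop B"
  by (rule gop_eqI) (simp add: act_simps evenop.rep_eq apply_op_simps)

lemma oddop_add: "oddop (\<lambda>k. \<phi> k + \<psi> k) = oddop \<phi> + oddop \<psi>"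
  by (rule gop_eqI) (simp add: act_simps oddop.rep_eq apply_op_simps distrib_left sum.distrib)

lemma evenop_oddop: "evenop A * oddop \<phi> = oddop (\<lambda>k. \<phi> k * A)"
  by (rule gop_eqI)
     (simp add: act_simps evenop.rep_eq oddop.rep_eq apply_op_simps apply_op_sum_right apply_op_power_sign)

lemma oddop_evenop: "oddop \<phi> * evenop A = oddop (\<lambda>k. A * \<phi> k)"
  by (rule gop_eqI) (simp add: act_simps evenop.rep_eq oddop.rep_eq apply_op_simps)

text \<open>
  The anticommutation \<open>\<theta>\<^sub>k \<theta>\<^sub>l = - \<theta>\<^sub>l \<theta>\<^sub>k\<close>, at the level of the signs in \<open>oddop\<close>.
\<close>

lemma two_step_sign:
  fixes k l :: nat
  assumes "finite S" "k \<in> S" "l \<in> S" "k \<noteq> l"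
  shows "(- 1) ^ card {j \<in> S. k < j} * (- 1) ^ card {j \<in> S - {k}. l < j} =
    - ((- 1) ^ card {j \<in> S. l < j} * (- 1) ^ card {j \<in> S - {l}. k < j} :: 'a :: comm_ring_1)"
proof -
  have *: "(- 1) ^ card {j \<in> S. k < j} * (- 1) ^ card {j \<in> S - {k}. l < j} =
    - ((- 1) ^ card {j \<in> S. l < j} * (- 1) ^ card {j \<in> S - {l}. k < j} :: 'a)"
    if "k < l" "k \<in> S" "l \<in> S" for k l
  proof -
    have "{j \<in> S. k < j} = insert l {j \<in> S - {l}. k < j}" using that by auto
    then have 1: "card {j \<in> S. k < j} = Suc (card {j \<in> S - {l}. k < j})"
      using assms(1) by simp
    have 2: "{j \<in> S - {k}. l < j} = {j \<in> S. l < j}" using that by auto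
    show ?thesis unfolding 1 2 by (simp add: mult.commute)
  qed
  show ?thesis
  proof (cases "k < l")
    case True then show ?thesis using * assms by blast
  next
    case False
    then have "l < k" using assms by simp
    from *[OF this assms(3,2)] show ?thesis by (simp add: algebra_simps)
  qed
qed

lemma oddop_anticommute:
  assumes "\<And>k l. \<phi> k * \<psi> l = \<psi> l * \<phi> k"
  shows "oddop \<phi> * oddop \<psi> = - (oddop \<psi> * oddop \<phi>)"
proof (rule gop_eqI)
  fix F :: "nat set \<Rightarrow> U" and S
  show "act (oddop \<phi> * oddop \<psi>) F S = act (- (oddop \<psi> * oddop \<phi>)) F S"
  proof (cases "finite S")
    case False
    then show ?thesis by (simp add: act_simps oddop.rep_eq)
  next
    case fin: True
    define sg where "sg S k = (- 1 :: U) ^ card {j \<in> S. k < j}" for S and k :: nat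
    have expand: "act (oddop \<phi> * oddop \<psi>) F S =
        (\<Sum>k\<in>S. \<Sum>l\<in>S. if k \<noteq> l then sg S k * sg (S - {k}) l * apply_op (\<psi> l * \<phi> k) (F (S - {k,l})) else 0)"
      for \<phi> \<psi>
    proof -
      have "act (oddop \<phi> * oddop \<psi>) F S =
        (\<Sum>k\<in>S. \<Sum>l\<in>S-{k}. sg S k * sg (S - {k}) l * apply_op (\<psi> l * \<phi> k) (F (S - {k,l})))"
        unfolding sg_def
        by (simp add: act_simps oddop.rep_eq apply_op_sum_right apply_op_power_sign
            sum_distrib_left apply_op_simps mult.assoc Diff_insert2[symmetric] insert_commute)
      also have "\<dots> = (\<Sum>k\<in>S. \<Sum>l\<in>S. if k \<noteq> l then sg S k * sg (S - {k}) l * apply_op (\<psi> l * \<phi> k) (F (S - {k,l})) else 0)"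
        by (intro sum.cong refl sum.mono_neutral_cong_left) (use fin in auto)
      finally show ?thesis .
    qed
    have "act (oddop \<phi> * oddop \<psi>) F S =
        (\<Sum>l\<in>S. \<Sum>k\<in>S. if k \<noteq> l then sg S k * sg (S - {k}) l * apply_op (\<psi> l * \<phi> k) (F (S - {k,l})) else 0)"
      unfolding expand by (rule sum.swap)
    also have "\<dots> = (\<Sum>l\<in>S. \<Sum>k\<in>S. - (if l \<noteq> k then sg S l * sg (S - {l}) k * apply_op (\<phi> k * \<psi> l) (F (S - {l,k})) else 0))"
    proof (rule sum.cong[OF refl], rule sum.cong[OF refl])
      fix l k assume kl: "l \<in> S" "k \<in> S"
      show "(if k \<noteq> l then sg S k * sg (S - {k}) l * apply_op (\<psi> l * \<phi> k) (F (S - {k,l})) else 0) =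
          - (if l \<noteq> k then sg S l * sg (S - {l}) k * apply_op (\<phi> k * \<psi> l) (F (S - {l,k})) else 0)"
      proof (cases "k = l")
        case False
        then have "sg S k * sg (S - {k}) l = - (sg S l * sg (S - {l}) k)"
          unfolding sg_def by (intro two_step_sign fin kl)
        moreover have "{k, l} = {l, k}" by (rule insert_commute)
        ultimately show ?thesis using False assms[of k l] by simp
      qed simp
    qed
    also have "\<dots> = act (- (oddop \<psi> * oddop \<phi>)) F S"
      unfolding uminus_gop.rep_eq expand by (simp add: sum_negf)
    finally show ?thesis .
  qed
qed

lemma gop_double_eq_0: "g + g = 0 \<Longrightarrow> g = (0 :: gop)"
proof (rule gop_eqI)
  fix F S assume "g + g = 0"
  then have "act g F S + act g F S = 0"
    using plus_gop.rep_eq[of g g] by (simp add: zero_gop.rep_eq fun_eq_iff)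
  then have "2 * act g F S = 0" by (metis mult_2)
  then show "act g F S = act 0 F S" by (simp add: zero_gop.rep_eq)
qed

section \<open>Odd coefficients\<close>

definition odd_elt :: "(nat \<Rightarrow> U) \<Rightarrow> gop" where
  "odd_elt u = oddop (\<lambda>k. u k \<cdot> 1)"

lemma scale_simps: "u \<cdot> A = A * (u \<cdot> 1)" "0 \<cdot> A = 0" "(u \<cdot> 1) * (v \<cdot> 1) = (v \<cdot> 1) * (u \<cdot> 1)"
  by (rule diff_op_eqI; simp add: apply_op_simps mult_ac)+

lemma odd_elt_anticommute: "odd_elt u * odd_elt v = - (odd_elt v * odd_elt u)"
  unfolding odd_elt_def by (rule oddop_anticommute) (rule scale_simps)

lemma odd_elt_square: "odd_elt u * odd_elt u = 0"
  by (rule gop_double_eq_0) (metis odd_elt_anticommute eq_neg_iff_add_eq_0)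

lemma odd_elt_mult_op: "odd_elt u * evenop (w \<cdot> 1) = evenop (w \<cdot> 1) * odd_elt u"
  by (simp add: odd_elt_def evenop_oddop oddop_evenop scale_simps(3))

lemma D1_odd_elt: "evenop D1 * odd_elt u = odd_elt u * evenop D1 + odd_elt (\<lambda>k. d1 (u k))"
  unfolding odd_elt_def evenop_oddop oddop_evenop oddop_add[symmetric]
  by (rule arg_cong[of _ _ oddop], rule ext, rule diff_op_eqI) (simp add: apply_op_simps d1_mult)

lemma D2_odd_elt: "evenop D2 * odd_elt u = odd_elt u * evenop D2 + odd_elt (\<lambda>k. d2 (u k))"
  unfolding odd_elt_def evenop_oddop oddop_evenop oddop_add[symmetric]
  by (rule arg_cong[of _ _ oddop], rule ext, rule diff_op_eqI) (simp add: apply_op_simps d2_mult)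

lemma D1_D2_commute: "evenop D2 * evenop D1 = evenop D1 * evenop D2"
  unfolding evenop_times[symmetric]
  by (rule arg_cong[of _ _ evenop], rule diff_op_eqI) (simp add: apply_op_simps d2_d1)

lemma oddop_Vect2:
  "oddop (\<lambda>k. p k \<cdot> D1 + q k \<cdot> D2) = odd_elt p * evenop D1 + odd_elt q * evenop D2"
  unfolding oddop_add odd_elt_def oddop_evenop by (simp flip: scale_simps(1))

text \<open>
  Moving an odd element through a product of odd elements costs one sign per factor.
\<close>

lemma odd_elt_prod_snoc:
  "prod_list (map odd_elt us) * odd_elt u = (- 1) ^ length us * (odd_elt u * prod_list (map odd_elt us))"
proof (induction us)
  case (Cons v us)
  have "prod_list (map odd_elt (v # us)) * odd_elt u =
      odd_elt v * ((- 1) ^ length us * (odd_elt u * prod_list (map odd_elt us)))"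
    by (simp add: mult.assoc Cons)
  also have "\<dots> = (- 1) ^ length us * (odd_elt v * odd_elt u * prod_list (map odd_elt us))"
    by (cases "even (length us)") (simp_all add: mult.assoc)
  also have "\<dots> = (- 1) ^ length (v # us) * (odd_elt u * prod_list (map odd_elt (v # us)))"
    by (subst odd_elt_anticommute) (simp add: mult.assoc)
  finally show ?case .
qed simp

lemma odd_elt_prod_not_distinct:
  assumes "\<not> distinct us"
  shows "prod_list (map odd_elt us) = 0"
proof -
  obtain xs ys zs u where us: "us = xs @ [u] @ ys @ [u] @ zs"
    using not_distinct_decomp[OF assms] by blast
  have "odd_elt u * (prod_list (map odd_elt ys) * odd_elt u) = 0"
    unfolding odd_elt_prod_snoc
    by (cases "even (length ys)") (simp_all add: odd_elt_square flip: mult.assoc)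
  then show ?thesis unfolding us by simp (simp flip: mult.assoc)
qed

lemma odd_elt_prod_swap:
  "prod_list (map odd_elt (xs @ [u] @ ys @ [v] @ zs)) = - prod_list (map odd_elt (xs @ [v] @ ys @ [u] @ zs))"
proof -
  have "odd_elt u * (prod_list (map odd_elt ys) * odd_elt v) =
      - (odd_elt v * (prod_list (map odd_elt ys) * odd_elt u))"
    unfolding odd_elt_prod_snoc using odd_elt_anticommute[of u v]
    by (cases "even (length ys)") (simp_all flip: mult.assoc)
  then have "odd_elt u * (prod_list (map odd_elt ys) * odd_elt v) * z =
      - (odd_elt v * (prod_list (map odd_elt ys) * odd_elt u)) * z" for z
    by simp
  then show ?thesis by (simp add: mult.assoc)
qed

section \<open>Powers of an odd vector field in two variables\<close>

text \<open>
  The relations satisfied by the coefficients \<open>x\<close>, \<open>y\<close> of an odd vector field \<open>x D + y E\<close>, by their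
  derivatives \<open>a = D(x)\<close>, \<open>b = D(y)\<close>, \<open>e = E(x)\<close>, \<open>f = E(y)\<close>, and by the commuting derivations \<open>D\<close>
  and \<open>E\<close>.  The set \<open>W\<close> plays the role of the ordinary functions; it serves to express that an
  element is a coefficient, that is, contains no differentiation.
\<close>

locale odd_vector_field =
  fixes x y a b e f D E :: "'a :: ring_1" and W :: "'a set"
  assumes anticommute: "\<And>u v. u \<in> {x, y, a, b, e, f} \<Longrightarrow> v \<in> {x, y, a, b, e, f} \<Longrightarrow> u * v = - (v * u)"
    and square: "\<And>u. u \<in> {x, y, a, b, e, f} \<Longrightarrow> u * u = 0"
    and derivative: "D * x = x * D + a" "D * y = y * D + b" "E * x = x * E + e" "E * y = y * E + f"
    and D_E: "E * D = D * E"
    and scalars: "\<And>u w. u \<in> {x, y, a, b, e, f} \<Longrightarrow> w \<in> W \<Longrightarrow> u * w = w * u"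
      "\<And>w. w \<in> W \<Longrightarrow> D * w - w * D \<in> W" "\<And>w. w \<in> W \<Longrightarrow> E * w - w * E \<in> W"
begin

lemma anticommute_left:
  "u \<in> {x, y, a, b, e, f} \<Longrightarrow> v \<in> {x, y, a, b, e, f} \<Longrightarrow> u * (v * z) = - (v * (u * z))"
  using anticommute[of u v] by (simp flip: mult.assoc)

lemma square_left: "u \<in> {x, y, a, b, e, f} \<Longrightarrow> u * (u * z) = 0"
  using square[of u] by (simp flip: mult.assoc)

lemma normal_order:
  "y * x = - (x * y)" "a * x = - (x * a)" "b * x = - (x * b)" "e * x = - (x * e)" "f * x = - (x * f)"
  "a * y = - (y * a)" "b * y = - (y * b)" "e * y = - (y * e)" "f * y = - (y * f)"
  "b * a = - (a * b)" "e * a = - (a * e)" "f * a = - (a * f)"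
  "e * b = - (b * e)" "f * b = - (b * f)" "f * e = - (e * f)"
  by (rule anticommute; simp)+

lemma normal_order_left:
  "y * (x * z) = - (x * (y * z))" "a * (x * z) = - (x * (a * z))" "b * (x * z) = - (x * (b * z))"
  "e * (x * z) = - (x * (e * z))" "f * (x * z) = - (x * (f * z))"
  "a * (y * z) = - (y * (a * z))" "b * (y * z) = - (y * (b * z))" "e * (y * z) = - (y * (e * z))"
  "f * (y * z) = - (y * (f * z))"
  "b * (a * z) = - (a * (b * z))" "e * (a * z) = - (a * (e * z))" "f * (a * z) = - (a * (f * z))"
  "e * (b * z) = - (b * (e * z))" "f * (b * z) = - (b * (f * z))" "f * (e * z) = - (e * (f * z))"
  by (rule anticommute_left; simp)+

lemma squares:
  "x * x = 0" "y * y = 0" "a * a = 0" "b * b = 0" "e * e = 0" "f * f = 0"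
  "x * (x * z) = 0" "y * (y * z) = 0" "a * (a * z) = 0" "b * (b * z) = 0" "e * (e * z) = 0" "f * (f * z) = 0"
  by (simp_all add: square square_left)

lemma derivative_left:
  "D * (x * z) = x * (D * z) + a * z" "D * (y * z) = y * (D * z) + b * z"
  "E * (x * z) = x * (E * z) + e * z" "E * (y * z) = y * (E * z) + f * z"
  using derivative by (simp_all flip: mult.assoc add: distrib_right)

lemmas normalize = distrib_left distrib_right left_diff_distrib right_diff_distrib mult.assoc
  normal_order normal_order_left squares

text \<open>
  The fourth power of the matrix with rows \<open>(a, b)\<close> and \<open>(e, f)\<close> applied to a vector \<open>(P, Q)\<close>.
  Each entry is a combination of words of length 4 in the four anticommuting entries; only words with
  four distinct letters survive, and these cancel in pairs.
\<close>

lemma odd_matrix_power_4: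
  assumes "P1 = a * P + b * Q" "Q1 = e * P + f * Q"
    and "P2 = a * P1 + b * Q1" "Q2 = e * P1 + f * Q1"
    and "P3 = a * P2 + b * Q2" "Q3 = e * P2 + f * Q2"
  shows "a * P3 + b * Q3 = 0" "e * P3 + f * Q3 = 0"
  unfolding assms by (simp_all add: normalize)

definition X where "X = x * D + y * E"

definition \<delta> where "\<delta> = a + f"

lemma \<delta>_square: "\<delta> * \<delta> = 0"
  by (simp add: \<delta>_def normalize)

text \<open>
  In \<open>X (x y z)\<close>, the derivations must hit one of the factors \<open>x\<close>, \<open>y\<close>, for otherwise the
  coefficient \<open>x\<close> or \<open>y\<close> of \<open>X\<close> meets its own copy.
\<close>

lemma X_times_xy: "X * (x * (y * z)) = - (\<delta> * (x * (y * z)))"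
  by (simp add: X_def \<delta>_def normalize derivative_left)

lemma X_times:
  "X * (x * P + y * Q + x * (y * R)) =
     x * (a * P + b * Q) + y * (e * P + f * Q) + x * (y * (D * Q - E * P - \<delta> * R))"
  by (simp add: X_def \<delta>_def normalize derivative_left)

text \<open>
  By \<open>X_times\<close>, modulo right multiples of \<open>x y\<close>, each further factor \<open>X\<close> applies the matrix with rows
  \<open>(a, b)\<close>, \<open>(e, f)\<close> once, starting from \<open>(D, E)\<close> for \<open>X\<close> itself.
\<close>

lemma X_power_5: "\<exists>R. X ^ 5 = x * (y * R)"
proof -
  define P1 Q1 P2 Q2 P3 Q3 where defs: "P1 = a * D + b * E" "Q1 = e * D + f * E"
    "P2 = a * P1 + b * Q1" "Q2 = e * P1 + f * Q1"
    "P3 = a * P2 + b * Q2" "Q3 = e * P2 + f * Q2"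
  have step: "\<exists>R'. X * Y = x * (a * P + b * Q) + y * (e * P + f * Q) + x * (y * R')"
    if "Y = x * P + y * Q + x * (y * R)" for Y P Q R
    using X_times[of P Q R] that by blast
  have "X = x * D + y * E + x * (y * 0)" by (simp add: X_def)
  then obtain R1 where "X * X = x * P1 + y * Q1 + x * (y * R1)"
    unfolding defs using step by blast
  then obtain R2 where "X * (X * X) = x * P2 + y * Q2 + x * (y * R2)"
    unfolding defs(3,4) using step by blast
  then obtain R3 where "X * (X * (X * X)) = x * P3 + y * Q3 + x * (y * R3)"
    unfolding defs(5,6) using step by blast
  then obtain R4 where "X * (X * (X * (X * X))) =
      x * (a * P3 + b * Q3) + y * (e * P3 + f * Q3) + x * (y * R4)"
    using step by blast
  then have "X * (X * (X * (X * X))) = x * (y * R4)"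
    by (simp add: odd_matrix_power_4[OF defs])
  then show ?thesis by (auto simp: numeral_eq_Suc)
qed

theorem X_power_6: "X ^ 6 = - (\<delta> * X ^ 5)"
proof -
  obtain R where R: "X ^ 5 = x * (y * R)" using X_power_5 by blast
  have "X ^ 6 = X * X ^ 5" by (simp add: numeral_eq_Suc)
  then show ?thesis by (simp add: R X_times_xy)
qed

theorem X_power_7: "X ^ 7 = 0"
proof -
  have "X ^ 7 = X ^ 6 * X" using power_Suc2[of X 6] by simp
  also have "\<dots> = - (\<delta> * (X ^ 5 * X))" by (simp add: X_power_6 mult.assoc)
  also have "X ^ 5 * X = X ^ 6" using power_Suc2[of X 5] by simp
  also have "\<delta> * X ^ 6 = - ((\<delta> * \<delta>) * X ^ 5)" by (simp add: X_power_6 mult.assoc)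
  finally show ?thesis by (simp add: \<delta>_square)
qed

definition coefficient where "coefficient g \<longleftrightarrow> (\<forall>w\<in>W. g * w = w * g)"

lemma coefficient_odd: "u \<in> {x, y, a, b, e, f} \<Longrightarrow> coefficient u"
  by (simp add: coefficient_def scalars)

lemma coefficient_add: "coefficient g \<Longrightarrow> coefficient h \<Longrightarrow> coefficient (g + h)"
  by (simp add: coefficient_def distrib_left distrib_right)

lemma coefficient_minus: "coefficient g \<Longrightarrow> coefficient (- g)"
  by (simp add: coefficient_def)

lemma coefficient_mult: "coefficient g \<Longrightarrow> coefficient h \<Longrightarrow> coefficient (g * h)"
  unfolding coefficient_def by (metis mult.assoc)

lemma coefficient_derivative:
  assumes "coefficient g"
    and T: "\<And>w. w \<in> W \<Longrightarrow> T * w - w * T \<in> W"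
  shows "coefficient (T * g - g * T)"
  unfolding coefficient_def
proof
  fix w assume w: "w \<in> W"
  define w' where "w' = T * w - w * T"
  have w': "T * w = w * T + w'" by (simp add: w'_def)
  have g: "g * w = w * g" "g * w' = w' * g"
    using assms(1) T[OF w] w by (simp_all add: coefficient_def w'_def)
  have "(T * g - g * T) * w = T * (g * w) - g * (T * w)" by (simp add: left_diff_distrib mult.assoc)
  also have "T * (g * w) = (T * w) * g" by (simp add: g(1) mult.assoc)
  also have "g * (T * w) = (g * w) * T + g * w'" by (simp add: w' distrib_left mult.assoc)
  also have "(T * w) * g - ((g * w) * T + g * w') = w * (T * g - g * T)"
    unfolding w' g by (simp add: algebra_simps)
  finally show "(T * g - g * T) * w = w * (T * g - g * T)" .
qed

text \<open>
  \<open>X ^ 2\<close> is the even vector field \<open>h1 D + h2 E\<close>, so \<open>X ^ 4\<close> has a second order part with coefficients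
  \<open>h\<^sub>i h\<^sub>j\<close>, and a first order part.  The former is a right multiple of \<open>x y\<close> and contributes
  \<open>- \<delta> X M = \<delta> \<delta> M = 0\<close> to \<open>X ^ 6 = - \<delta> X X ^ 4\<close>.  The second order terms that the first order part
  contributes are \<open>\<delta> x y\<close> times entries of the cube of the matrix with rows \<open>(a, b)\<close>, \<open>(e, f)\<close>; the
  cube times \<open>\<delta>\<close> is a scalar matrix, whereas \<open>x y\<close> pairs the entries skew-symmetrically with the
  symmetric second order symbols.
\<close>

theorem X_power_6_first_order:
  "\<exists>G H. X ^ 6 = G * D + H * E \<and> coefficient G \<and> coefficient H"
proof -
  define h1 h2 where h: "h1 = x * a + y * e" "h2 = x * b + y * f"
  define D1h1 D1h2 D2h1 D2h2 where Dh: "D1h1 = D * h1 - h1 * D" "D1h2 = D * h2 - h2 * D"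
    "D2h1 = E * h1 - h1 * E" "D2h2 = E * h2 - h2 * E"
  define t1 t2 where t: "t1 = h1 * D1h1 + h2 * D2h1" "t2 = h1 * D1h2 + h2 * D2h2"
  define G H where GH:
    "G = - (\<delta> * (x * (D * t1 - t1 * D) + y * (E * t1 - t1 * E)))"
    "H = - (\<delta> * (x * (D * t2 - t2 * D) + y * (E * t2 - t2 * E)))"
  have c_odd: "coefficient x" "coefficient y" "coefficient a" "coefficient b" "coefficient e" "coefficient f"
    by (simp_all add: coefficient_odd)
  have ch: "coefficient h1" "coefficient h2"
    unfolding h by (intro coefficient_add coefficient_mult c_odd)+
  have ct: "coefficient t1" "coefficient t2"
    unfolding t Dh
    by (intro coefficient_add coefficient_mult coefficient_derivative ch scalars; assumption)+
  have "coefficient G" "coefficient H"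
    unfolding GH \<delta>_def
    by (intro coefficient_add coefficient_mult coefficient_minus coefficient_derivative ct c_odd scalars; assumption)+
  moreover have "X ^ 6 = G * D + H * E"
  proof -
    have X2: "X * X = h1 * D + h2 * E"
      by (simp add: X_def h normalize derivative_left D_E)
    have Dh': "D * (h1 * z) = h1 * (D * z) + D1h1 * z" "D * (h2 * z) = h2 * (D * z) + D1h2 * z"
      "E * (h1 * z) = h1 * (E * z) + D2h1 * z" "E * (h2 * z) = h2 * (E * z) + D2h2 * z" for z
      unfolding Dh by (simp_all add: algebra_simps)
    define M where "M = h1 * (h1 * (D * D)) + h1 * (h2 * (D * E)) + h2 * (h1 * (D * E)) + h2 * (h2 * (E * E))"
    have "X ^ 4 = (X * X) * (X * X)" by (simp add: numeral_eq_Suc mult.assoc)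
    also have "\<dots> = M + (t1 * D + t2 * E)"
      unfolding X2 M_def t by (simp add: distrib_left distrib_right mult.assoc Dh' D_E)
    finally have X4: "X ^ 4 = M + (t1 * D + t2 * E)" .
    have "\<exists>R. M = x * (y * R)"
    proof -
      have hh: "\<exists>R. (x * u + y * v) * ((x * u' + y * v') * z) = x * (y * R)"
        if "u \<in> {a, b}" "v \<in> {e, f}" "u' \<in> {a, b}" "v' \<in> {e, f}" for u v u' v' z
      proof -
        have "(x * u + y * v) * ((x * u' + y * v') * z) = x * (y * (- u * (v' * z) + v * (u' * z)))"
          using that by (auto simp: normalize)
        then show ?thesis by blast
      qed
      obtain R1 R2 R3 R4 where "h1 * (h1 * (D * D)) = x * (y * R1)" "h1 * (h2 * (D * E)) = x * (y * R2)"
        "h2 * (h1 * (D * E)) = x * (y * R3)" "h2 * (h2 * (E * E)) = x * (y * R4)"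
        unfolding h using hh by (metis insertCI)
      then have "M = x * (y * (R1 + R2 + R3 + R4))" unfolding M_def by (simp add: distrib_left)
      then show ?thesis by blast
    qed
    then have "X * M = - (\<delta> * M)" using X_times_xy by auto
    then have \<delta>XM: "\<delta> * (X * M) = 0" by (simp flip: mult.assoc add: \<delta>_square)
    \<comment> \<open>Next to \<open>x y\<close>, the derivatives of \<open>h1\<close> and \<open>h2\<close> reduce to the square of the matrix, because the terms
      with second derivatives of \<open>x\<close> and \<open>y\<close> still contain \<open>x\<close> or \<open>y\<close>.\<close>
    have xyDh: "x * (y * D1h1) = x * (y * (b * e))" "x * (y * D1h2) = x * (y * (a * b + b * f))"
      "x * (y * D2h1) = x * (y * (e * a + f * e))" "x * (y * D2h2) = x * (y * (e * b))"
      unfolding Dh h by (simp_all add: normalize derivative_left)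
    have \<delta>t: "\<delta> * (x * t1) = 0" "\<delta> * (y * t2) = 0" "\<delta> * (x * t2) = - (\<delta> * (y * t1))"
    proof -
      have xh: "x * (h1 * z) = e * (x * (y * z))" "x * (h2 * z) = f * (x * (y * z))"
        "y * (h1 * z) = - (a * (x * (y * z)))" "y * (h2 * z) = - (b * (x * (y * z)))" for z
        unfolding h by (simp_all add: normalize)
      show "\<delta> * (x * t1) = 0" "\<delta> * (y * t2) = 0" "\<delta> * (x * t2) = - (\<delta> * (y * t1))"
        unfolding t distrib_left xh xyDh by (simp_all add: \<delta>_def normalize)
    qed
    have \<delta>t': "\<delta> * (x * (t1 * z)) = 0" "\<delta> * (y * (t2 * z)) = 0" "\<delta> * (x * (t2 * z)) = - (\<delta> * (y * (t1 * z)))" for z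
      using \<delta>t by (simp_all flip: mult.assoc)
    have "X ^ 6 = - (\<delta> * (X * X ^ 4))"
      using X_power_6 power_Suc[of X 4] by simp
    also have "\<dots> = - (\<delta> * (X * (t1 * D + t2 * E)))"
      by (simp add: X4 distrib_left \<delta>XM)
    also have "\<dots> = G * D + H * E"
      unfolding GH X_def by (simp add: algebra_simps \<delta>t' D_E)
    finally show ?thesis .
  qed
  ultimately show ?thesis by blast
qed

end

section \<open>Skew-symmetric sums as powers of an odd operator\<close>

text \<open>
  The element \<open>f\<close>, containing no \<open>\<theta>\<close>: applying operators to it and reading off a value extracts a
  coefficient of their product.
\<close>

definition vacuum :: "U \<Rightarrow> nat set \<Rightarrow> U" where
  "vacuum f S = (if S = {} then f else 0)"

text \<open>
  The parity of the number of pairs that are not in decreasing order: the sign that sorts a product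
  of \<open>\<theta>\<close>s into the order of the monomials.
\<close>

fun word_sign :: "nat list \<Rightarrow> int" where
  "word_sign [] = 1"
| "word_sign (k # w) = (- 1) ^ card {j \<in> set w. k < j} * word_sign w"

definition \<theta> :: "nat \<Rightarrow> gop" where
  "\<theta> k = odd_elt (\<lambda>j. if j = k then 1 else 0)"

lemma act_\<theta>:
  assumes "finite S"
  shows "act (\<theta> k) F S = (if k \<in> S then (- 1) ^ card {j \<in> S. k < j} * F (S - {k}) else 0)"
proof -
  have "act (\<theta> k) F S = (\<Sum>i\<in>S. if i = k then (- 1) ^ card {j \<in> S. i < j} * F (S - {i}) else 0)"
    unfolding \<theta>_def odd_elt_def oddop.rep_eq
    by (intro sum.cong) (auto simp: apply_op_simps)
  then show ?thesis using assms by (simp add: sum.delta)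
qed

lemma act_\<theta>_word:
  "distinct w \<Longrightarrow> act (prod_list (map \<theta> w)) (vacuum 1) (set w) = of_int (word_sign w)"
proof (induction w)
  case (Cons k w)
  have "{j. (j = k \<or> j \<in> set w) \<and> k < j} = {j \<in> set w. k < j}" by auto
  moreover have "set w - {k} = set w" using Cons.prems by auto
  ultimately show ?case using Cons by (simp add: act_simps act_\<theta>)
qed (simp add: act_simps vacuum_def)

text \<open>
  Counting inversions directly is awkward for letters that are not adjacent; reading the sign off
  from a product of \<open>\<theta>\<close>s reduces the claim to anticommutation.
\<close>

lemma word_sign_swap:
  assumes "distinct (xs @ [a] @ ys @ [b] @ zs)"
  shows "word_sign (xs @ [a] @ ys @ [b] @ zs) = - word_sign (xs @ [b] @ ys @ [a] @ zs)"
proof -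
  let ?v = "xs @ [a] @ ys @ [b] @ zs" and ?w = "xs @ [b] @ ys @ [a] @ zs"
  let ?e = "\<lambda>k j. if j = k then 1 else 0 :: U"
  have \<theta>: "map \<theta> w = map odd_elt (map ?e w)" for w
    by (simp add: \<theta>_def)
  have "distinct ?w" "set ?v = set ?w" using assms by auto
  moreover have "prod_list (map \<theta> ?v) = - prod_list (map \<theta> ?w)"
    unfolding \<theta> using odd_elt_prod_swap[of "map ?e xs" "?e a" "map ?e ys" "?e b" "map ?e zs"]
    by simp
  ultimately have "(of_int (word_sign ?v) :: U) = of_int (- word_sign ?w)"
    using act_\<theta>_word[OF assms] act_\<theta>_word[of ?w] by (simp add: act_simps del: map_append)
  then show ?thesis by (simp only: of_int_eq_iff)
qed

lemma word_sign_transpose: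
  assumes "distinct w" "a \<in> set w" "b \<in> set w" "a \<noteq> b"
  shows "word_sign (map (transpose a b) w) = - word_sign w"
proof -
  have *: "word_sign (map (transpose a b) (xs @ [a] @ ys @ [b] @ zs)) = - word_sign (xs @ [a] @ ys @ [b] @ zs)"
    if "distinct (xs @ [a] @ ys @ [b] @ zs)" for a b xs ys zs
  proof -
    have id: "map (transpose a b) l = l" if "a \<notin> set l" "b \<notin> set l" for l
      using that by (intro map_idI) (auto simp: transpose_def)
    have "map (transpose a b) (xs @ [a] @ ys @ [b] @ zs) = xs @ [b] @ ys @ [a] @ zs"
      using that by (auto simp: id)
    then show ?thesis using word_sign_swap[OF that] by simp
  qed
  obtain xs zs where w: "w = xs @ a # zs" using assms(2) split_list by metis
  then consider "b \<in> set zs" | "b \<in> set xs" using assms by auto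
  then show ?thesis
  proof cases
    case 1
    then obtain ys zs' where "w = xs @ [a] @ ys @ [b] @ zs'" using w by (auto dest: split_list)
    then show ?thesis using * assms(1) by blast
  next
    case 2
    then obtain xs' ys where "w = xs' @ [b] @ ys @ [a] @ zs" using w by (auto dest: split_list)
    then show ?thesis using * assms(1) by (metis transpose_commute)
  qed
qed

lemma word_sign_permutes:
  assumes "\<sigma> permutes set w" "distinct w"
  shows "word_sign (map \<sigma> w) = sign \<sigma> * word_sign w"
  using assms(1) finite_set[of w]
proof (induction \<sigma> rule: permutes_induct)
  case (swap a b p)
  have inj: "inj_on p (set w)" and im: "p ` set w = set w"
    using swap.hyps by (simp_all add: permutes_inj_on permutes_image)
  have "word_sign (map (transpose a b) (map p w)) = - word_sign (map p w)"
    using swap.hyps assms(2) inj im by (intro word_sign_transpose) (simp_all add: distinct_map)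
  moreover have "sign (transpose a b \<circ> p) = - sign p"
    using swap.hyps permutes_imp_permutation[OF finite_set swap.hyps(4)]
    by (subst sign_compose) (simp_all add: sign_swap_id permutation_swap_id)
  ultimately show ?case using swap.IH by (simp add: comp_def)
qed simp

lemma word_sign_decreasing: "sorted_wrt (>) w \<Longrightarrow> word_sign w = 1"
proof (induction w)
  case (Cons k w)
  then have "{j \<in> set w. k < j} = {}" by auto
  then have "word_sign (k # w) = word_sign w" by (simp only: word_sign.simps) simp
  then show ?case using Cons by simp
qed simp

lemma sum_permutations_of_set_Cons:
  assumes "T \<noteq> {}"
  shows "(\<Sum>w\<in>permutations_of_set T. g w) = (\<Sum>k\<in>T. \<Sum>w\<in>permutations_of_set (T - {k}). g (k # w))"
proof (cases "finite T")
  case True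
  have "(\<Sum>k\<in>T. \<Sum>w\<in>permutations_of_set (T - {k}). g (k # w)) =
      (\<Sum>(k, w)\<in>(SIGMA k:T. permutations_of_set (T - {k})). g (k # w))"
    using True by (subst sum.Sigma) auto
  also have "\<dots> = (\<Sum>w\<in>permutations_of_set T. g w)"
    by (rule sum.reindex_bij_witness[where j = "\<lambda>(k, w). k # w" and i = "\<lambda>w. (hd w, tl w)"])
       (use assms in \<open>auto simp: permutations_of_set_nonempty[OF assms]\<close>)
  finally show ?thesis by simp
qed (simp add: permutations_of_set_infinite)

text \<open>
  The first factor of the product is the last to be applied and contributes the first letter of the
  word; in the resulting operator of \<open>diff_op\<close>, which acts on the right, it comes last.
\<close>

lemma oddop_word_expansion:
  assumes "finite T" "card T = length \<phi>s"
  shows "act (prod_list (map oddop \<phi>s)) (vacuum f) T =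
    (\<Sum>w\<in>permutations_of_set T. of_int (word_sign w) * apply_op (prod_list (rev (map2 (\<lambda>\<phi> k. \<phi> k) \<phi>s w))) f)"
  using assms
proof (induction \<phi>s arbitrary: T)
  case Nil
  then show ?case by (simp add: act_simps vacuum_def apply_op_simps)
next
  case (Cons \<phi> \<phi>s)
  from Cons.prems have "T \<noteq> {}" by auto
  have step: "act (prod_list (map oddop \<phi>s)) (vacuum f) (T - {k}) =
      (\<Sum>w\<in>permutations_of_set (T - {k}). of_int (word_sign w) * apply_op (prod_list (rev (map2 (\<lambda>\<phi> k. \<phi> k) \<phi>s w))) f)"
    if "k \<in> T" for k
    using Cons.prems that by (intro Cons.IH) auto
  have of_int: "apply_op A (of_int n * g) = of_int n * apply_op A g" for A n g
  proof -
    have nat: "apply_op A (of_nat k * g) = of_nat k * apply_op A g" for k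
      by (induction k) (simp_all add: distrib_right apply_op_add_right)
    show ?thesis by (cases n rule: int_cases2) (simp_all add: nat apply_op_minus)
  qed
  have sign: "of_int (word_sign (k # w)) = (- 1) ^ card {j \<in> T. k < j} * (of_int (word_sign w) :: U)"
    if "k \<in> T" "w \<in> permutations_of_set (T - {k})" for k w
  proof -
    have "{j \<in> set w. k < j} = {j \<in> T. k < j}" using permutations_of_setD[OF that(2)] by auto
    then show ?thesis by simp
  qed
  have "act (prod_list (map oddop (\<phi> # \<phi>s))) (vacuum f) T =
      (\<Sum>k\<in>T. (- 1) ^ card {j \<in> T. k < j} * apply_op (\<phi> k) (act (prod_list (map oddop \<phi>s)) (vacuum f) (T - {k})))"
    by (simp add: act_simps oddop.rep_eq)
  also have "\<dots> = (\<Sum>k\<in>T. \<Sum>w\<in>permutations_of_set (T - {k}). of_int (word_sign (k # w)) *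
      apply_op (prod_list (rev (map2 (\<lambda>\<phi> k. \<phi> k) (\<phi> # \<phi>s) (k # w)))) f)"
  proof (rule sum.cong[OF refl])
    fix k assume k: "k \<in> T"
    show "(- 1) ^ card {j \<in> T. k < j} * apply_op (\<phi> k) (act (prod_list (map oddop \<phi>s)) (vacuum f) (T - {k})) =
      (\<Sum>w\<in>permutations_of_set (T - {k}). of_int (word_sign (k # w)) *
        apply_op (prod_list (rev (map2 (\<lambda>\<phi> k. \<phi> k) (\<phi> # \<phi>s) (k # w)))) f)"
      unfolding step[OF k] apply_op_sum_right sum_distrib_left
      by (rule sum.cong[OF refl])
         (simp add: of_int sign[OF k] times_diff_op.rep_eq mult.assoc del: word_sign.simps)
  qed
  also have "\<dots> = (\<Sum>w\<in>permutations_of_set T. of_int (word_sign w) *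
      apply_op (prod_list (rev (map2 (\<lambda>\<phi> k. \<phi> k) (\<phi> # \<phi>s) w))) f)"
    by (rule sum_permutations_of_set_Cons[OF \<open>T \<noteq> {}\<close>, symmetric])
  finally show ?case .
qed

lemma bij_betw_map_permutes:
  assumes "distinct ts"
  shows "bij_betw (\<lambda>\<sigma>. map \<sigma> ts) {\<sigma>. \<sigma> permutes set ts} (permutations_of_set (set ts))"
proof -
  have inj: "inj_on (\<lambda>\<sigma>. map \<sigma> ts) {\<sigma>. \<sigma> permutes set ts}"
  proof (rule inj_onI, rule ext)
    fix \<sigma> \<tau> k assume *: "\<sigma> \<in> {\<sigma>. \<sigma> permutes set ts}" "\<tau> \<in> {\<sigma>. \<sigma> permutes set ts}" "map \<sigma> ts = map \<tau> ts"
    show "\<sigma> k = \<tau> k"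
      using * by (cases "k \<in> set ts") (auto simp: permutes_def)
  qed
  have sub: "(\<lambda>\<sigma>. map \<sigma> ts) ` {\<sigma>. \<sigma> permutes set ts} \<subseteq> permutations_of_set (set ts)"
    using assms by (auto simp: permutations_of_set_def distinct_map permutes_inj_on permutes_image
        permutes_in_image)
  have "card ((\<lambda>\<sigma>. map \<sigma> ts) ` {\<sigma>. \<sigma> permutes set ts}) = card (permutations_of_set (set ts))"
    by (simp add: card_image[OF inj] card_permutations)
  then show ?thesis
    using card_subset_eq[OF finite_permutations_of_set sub] inj by (auto simp: bij_betw_def)
qed

text \<open>
  The words on \<open>set ts\<close> are the images of \<open>ts\<close> under permutations, and passing to an image multiplies
  \<open>word_sign\<close> by the sign of the permutation.  The family may vary with the position in the word; this is
  what allows a fixed operator to be inserted between the skew-symmetrized ones.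
\<close>

theorem oddop_product_eq_skew_sum:
  assumes "distinct ts" "length ts = length \<phi>s"
  shows "act (prod_list (map oddop \<phi>s)) (vacuum f) (set ts) = of_int (word_sign ts) *
    apply_op (\<Sum>\<sigma> | \<sigma> permutes set ts. of_int (sign \<sigma>) * prod_list (rev (map2 (\<lambda>\<phi> k. \<phi> k) \<phi>s (map \<sigma> ts)))) f"
proof -
  have "act (prod_list (map oddop \<phi>s)) (vacuum f) (set ts) =
    (\<Sum>w\<in>permutations_of_set (set ts). of_int (word_sign w) * apply_op (prod_list (rev (map2 (\<lambda>\<phi> k. \<phi> k) \<phi>s w))) f)"
    using assms by (intro oddop_word_expansion) (simp_all add: distinct_card)
  also have "\<dots> = (\<Sum>\<sigma> | \<sigma> permutes set ts. of_int (word_sign (map \<sigma> ts)) *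
      apply_op (prod_list (rev (map2 (\<lambda>\<phi> k. \<phi> k) \<phi>s (map \<sigma> ts)))) f)"
    by (rule sum.reindex_bij_betw[OF bij_betw_map_permutes[OF assms(1)], symmetric])
  also have "\<dots> = of_int (word_sign ts) *
    apply_op (\<Sum>\<sigma> | \<sigma> permutes set ts. of_int (sign \<sigma>) * prod_list (rev (map2 (\<lambda>\<phi> k. \<phi> k) \<phi>s (map \<sigma> ts)))) f"
    by (simp add: word_sign_permutes assms(1) apply_op_sum_left apply_op_of_int sum_distrib_left mult_ac)
  finally show ?thesis .
qed

lemma oddop_power_eq_s_nth:
  assumes "length xs = n"
  shows "act (oddop (\<lambda>i. xs ! i) ^ n) (vacuum f) {..<n} = apply_op (s n xs) f"
proof -
  have "act (prod_list (map oddop (replicate n (\<lambda>i. xs ! i)))) (vacuum f) (set (rev [0..<n])) =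
    of_int (word_sign (rev [0..<n])) *
    apply_op (\<Sum>\<sigma> | \<sigma> permutes set (rev [0..<n]). of_int (sign \<sigma>) *
      prod_list (rev (map2 (\<lambda>\<phi> k. \<phi> k) (replicate n (\<lambda>i. xs ! i)) (map \<sigma> (rev [0..<n]))))) f"
    by (rule oddop_product_eq_skew_sum; simp)
  moreover have "word_sign (rev [0..<n]) = 1"
    by (rule word_sign_decreasing) (simp add: sorted_wrt_rev)
  moreover have "rev (map2 (\<lambda>\<phi> k. \<phi> k) (replicate n (\<lambda>i. xs ! i)) (map \<sigma> (rev [0..<n]))) = permute_list \<sigma> xs" for \<sigma>
  proof -
    have "map2 (\<lambda>\<phi> k. \<phi> k) (replicate n (\<lambda>i. xs ! i)) w = map (\<lambda>i. xs ! i) w" if "length w = n" for w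
      using that by (intro nth_equalityI) auto
    then show ?thesis using assms by (simp add: permute_list_def rev_map comp_def)
  qed
  moreover have "set (rev [0..<n]) = {..<n}" by auto
  moreover have "prod_list (map oddop (replicate n (\<lambda>i. xs ! i))) = oddop (\<lambda>i. xs ! i) ^ n"
    by (simp only: map_replicate prod_list_replicate)
  ultimately show ?thesis by (simp only: s_def skew_sum_def of_int_1 mult_1_left)
qed

text \<open>
  Only the order of the indices enters the signs, and only the family on the given set matters.
\<close>

lemma oddop_power_image:
  assumes "\<And>i j. i \<in> S \<Longrightarrow> j \<in> S \<Longrightarrow> i < j \<Longrightarrow> h i < h j" "\<And>i. i \<in> S \<Longrightarrow> \<phi> (h i) = \<psi> i"
  shows "act (oddop \<phi> ^ n) (vacuum f) (h ` S) = act (oddop \<psi> ^ n) (vacuum f) S"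
  using assms
proof (induction n arbitrary: S)
  case 0
  show ?case by (simp add: act_simps vacuum_def)
next
  case (Suc n)
  have lt: "h i < h j \<longleftrightarrow> i < j" if "i \<in> S" "j \<in> S" for i j
    using Suc.prems(1) that by (metis linorder_neqE_nat order.asym order.irrefl)
  have inj: "inj_on h S"
    using lt by (intro inj_onI) (metis linorder_neqE_nat order.irrefl)
  have card: "card {j \<in> h ` S. h i < j} = card {j \<in> S. i < j}" if "i \<in> S" for i
  proof -
    have "{j \<in> h ` S. h i < j} = h ` {j \<in> S. i < j}" using lt that by auto
    then show ?thesis using inj by (simp add: card_image inj_on_subset)
  qed
  have diff: "h ` S - {h i} = h ` (S - {i})" if "i \<in> S" for i
    using inj that by (auto simp: inj_on_def)
  have IH: "act (oddop \<phi> ^ n) (vacuum f) (h ` (S - {i})) = act (oddop \<psi> ^ n) (vacuum f) (S - {i})" for i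
    by (rule Suc.IH) (use Suc.prems in blast)+
  show ?case
    unfolding power_Suc times_gop.rep_eq oddop.rep_eq comp_def
    by (subst sum.reindex[OF inj], rule sum.cong[OF refl]) (simp add: card diff IH Suc.prems(2) comp_def)
qed

theorem oddop_power_eq_s:
  assumes "sorted_wrt (<) ts" "length ts = n"
  shows "act (oddop X ^ n) (vacuum f) (set ts) = apply_op (s n (map X ts)) f"
proof -
  have "set ts = (\<lambda>i. ts ! i) ` {..<n}" using assms(2) by (auto simp: set_conv_nth)
  then have "act (oddop X ^ n) (vacuum f) (set ts) = act (oddop (\<lambda>i. map X ts ! i) ^ n) (vacuum f) {..<n}"
    using assms by (simp only:) (rule oddop_power_image; simp add: sorted_wrt_iff_nth_less)
  also have "\<dots> = apply_op (s n (map X ts)) f"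
    using assms by (intro oddop_power_eq_s_nth) simp
  finally show ?thesis .
qed

section \<open>The 6-commutator\<close>

text \<open>
  The families \<open>p\<close> and \<open>q\<close> of coefficients of vector fields \<open>X\<^sub>k = p\<^sub>k \<partial>\<^sub>1 + q\<^sub>k \<partial>\<^sub>2\<close> give the odd
  coefficients \<open>\<Sum>\<^sub>k \<theta>\<^sub>k p\<^sub>k\<close> and \<open>\<Sum>\<^sub>k \<theta>\<^sub>k q\<^sub>k\<close>, whose derivatives are taken termwise.
\<close>

lemma odd_vector_field_odd_elt:
  "odd_vector_field (odd_elt p) (odd_elt q)
     (odd_elt (\<lambda>k. d1 (p k))) (odd_elt (\<lambda>k. d1 (q k))) (odd_elt (\<lambda>k. d2 (p k))) (odd_elt (\<lambda>k. d2 (q k)))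
     (evenop D1) (evenop D2) (range (\<lambda>w. evenop (w \<cdot> 1)))"
    (is "odd_vector_field ?x ?y ?a ?b ?e ?f _ _ _")
proof
  have odd: "\<exists>w. u = odd_elt w" if "u \<in> {?x, ?y, ?a, ?b, ?e, ?f}" for u
    using that by blast
  show "u * v = - (v * u)" if "u \<in> {?x, ?y, ?a, ?b, ?e, ?f}" "v \<in> {?x, ?y, ?a, ?b, ?e, ?f}" for u v
    using odd[OF that(1)] odd[OF that(2)] odd_elt_anticommute by blast
  show "u * u = 0" if "u \<in> {?x, ?y, ?a, ?b, ?e, ?f}" for u
    using odd[OF that] odd_elt_square by blast
  show "u * w = w * u" if "u \<in> {?x, ?y, ?a, ?b, ?e, ?f}" "w \<in> range (\<lambda>w. evenop (w \<cdot> 1))" for u w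
    using odd[OF that(1)] that(2) odd_elt_mult_op by blast
  show "evenop D1 * w - w * evenop D1 \<in> range (\<lambda>w. evenop (w \<cdot> 1))"
    if "w \<in> range (\<lambda>w. evenop (w \<cdot> 1))" for w
  proof -
    from that obtain g where w: "w = evenop (g \<cdot> 1)" by blast
    have "evenop D1 * w - w * evenop D1 = evenop (d1 g \<cdot> 1)"
      unfolding w evenop_times[symmetric] evenop_diff[symmetric]
      by (rule arg_cong[of _ _ evenop], rule diff_op_eqI) (simp add: apply_op_simps d1_mult)
    then show ?thesis by blast
  qed
  show "evenop D2 * w - w * evenop D2 \<in> range (\<lambda>w. evenop (w \<cdot> 1))"
    if "w \<in> range (\<lambda>w. evenop (w \<cdot> 1))" for w
  proof -
    from that obtain g where w: "w = evenop (g \<cdot> 1)" by blast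
    have "evenop D2 * w - w * evenop D2 = evenop (d2 g \<cdot> 1)"
      unfolding w evenop_times[symmetric] evenop_diff[symmetric]
      by (rule arg_cong[of _ _ evenop], rule diff_op_eqI) (simp add: apply_op_simps d2_mult)
    then show ?thesis by blast
  qed
qed (rule D1_odd_elt D2_odd_elt D1_D2_commute)+

abbreviation vector_field_family :: "(nat \<Rightarrow> U) \<Rightarrow> (nat \<Rightarrow> U) \<Rightarrow> nat \<Rightarrow> diff_op" where
  "vector_field_family p q k \<equiv> p k \<cdot> D1 + q k \<cdot> D2"

lemma oddop_power_6:
  "oddop (vector_field_family p q) ^ 6 =
     - (odd_elt (\<lambda>k. d1 (p k) + d2 (q k)) * oddop (vector_field_family p q) ^ 5)"
proof -
  interpret odd_vector_field "odd_elt p" "odd_elt q"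
     "odd_elt (\<lambda>k. d1 (p k))" "odd_elt (\<lambda>k. d1 (q k))" "odd_elt (\<lambda>k. d2 (p k))" "odd_elt (\<lambda>k. d2 (q k))"
     "evenop D1" "evenop D2" "range (\<lambda>w. evenop (w \<cdot> 1))"
    by (rule odd_vector_field_odd_elt)
  have "\<delta> = odd_elt (\<lambda>k. d1 (p k)) + odd_elt (\<lambda>k. d2 (q k))"
    by (rule \<delta>_def)
  also have "\<dots> = odd_elt (\<lambda>k. d1 (p k) + d2 (q k))"
    unfolding odd_elt_def oddop_add[symmetric]
    by (rule arg_cong[of _ _ oddop], rule ext, rule diff_op_eqI) (simp add: apply_op_simps distrib_right)
  finally have "\<delta> = odd_elt (\<lambda>k. d1 (p k) + d2 (q k))" .
  then show ?thesis using X_power_6 by (simp add: X_def oddop_Vect2)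
qed

lemma oddop_power_7: "oddop (vector_field_family p q) ^ 7 = 0"
proof -
  interpret odd_vector_field "odd_elt p" "odd_elt q"
     "odd_elt (\<lambda>k. d1 (p k))" "odd_elt (\<lambda>k. d1 (q k))" "odd_elt (\<lambda>k. d2 (p k))" "odd_elt (\<lambda>k. d2 (q k))"
     "evenop D1" "evenop D2" "range (\<lambda>w. evenop (w \<cdot> 1))"
    by (rule odd_vector_field_odd_elt)
  show ?thesis using X_power_7 by (simp add: X_def oddop_Vect2)
qed

text \<open>
  A coefficient commutes with multiplication by \<open>f\<close>, so its effect on the element \<open>f\<close> is \<open>f\<close> times its
  effect on \<open>1\<close>.
\<close>

lemma oddop_power_6_first_order:
  "\<exists>g h. \<forall>f. act (oddop (vector_field_family p q) ^ 6) (vacuum f) T = g * d1 f + h * d2 f"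
proof -
  interpret odd_vector_field "odd_elt p" "odd_elt q"
     "odd_elt (\<lambda>k. d1 (p k))" "odd_elt (\<lambda>k. d1 (q k))" "odd_elt (\<lambda>k. d2 (p k))" "odd_elt (\<lambda>k. d2 (q k))"
     "evenop D1" "evenop D2" "range (\<lambda>w. evenop (w \<cdot> 1))"
    by (rule odd_vector_field_odd_elt)
  obtain G H where GH: "X ^ 6 = G * evenop D1 + H * evenop D2" "coefficient G" "coefficient H"
    using X_power_6_first_order by blast
  have coeff: "act C (vacuum f) T = f * act C (vacuum 1) T" if "coefficient C" for C f
  proof -
    have "vacuum f = act (evenop (f \<cdot> 1)) (vacuum 1)"
      by (rule ext) (simp add: vacuum_def evenop.rep_eq apply_op_simps)
    then have "act C (vacuum f) = act (C * evenop (f \<cdot> 1)) (vacuum 1)"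
      by (simp add: times_gop.rep_eq)
    also have "C * evenop (f \<cdot> 1) = evenop (f \<cdot> 1) * C"
      using that by (simp add: coefficient_def)
    finally show ?thesis by (simp add: act_simps evenop.rep_eq apply_op_simps)
  qed
  have "act (evenop D1) (vacuum f) = vacuum (d1 f)" "act (evenop D2) (vacuum f) = vacuum (d2 f)" for f
    by (rule ext, simp add: vacuum_def evenop.rep_eq apply_op_simps)+
  then have "act (X ^ 6) (vacuum f) T = act G (vacuum 1) T * d1 f + act H (vacuum 1) T * d2 f" for f
    unfolding GH(1) by (simp add: act_simps coeff[OF GH(2), of "d1 f"] coeff[OF GH(3), of "d2 f"] mult.commute)
  then show ?thesis unfolding X_def oddop_Vect2 by blast
qed

lemma Vect2_choice:
  assumes "X ` T \<subseteq> Vect2"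
  obtains p q where "\<And>k. k \<in> T \<Longrightarrow> X k = vector_field_family p q k"
proof -
  have "\<forall>k\<in>T. \<exists>pq. X k = fst pq \<cdot> D1 + snd pq \<cdot> D2"
    using assms by (fastforce simp: Vect2_def image_subset_iff)
  then obtain pq where "\<forall>k\<in>T. X k = fst (pq k) \<cdot> D1 + snd (pq k) \<cdot> D2"
    unfolding bchoice_iff by blast
  then show ?thesis using that[of "\<lambda>k. fst (pq k)" "\<lambda>k. snd (pq k)"] by simp
qed

lemma Vect2_list:
  assumes "set xs \<subseteq> Vect2"
  obtains p q where "xs = map (vector_field_family p q) [0..<length xs]"
proof -
  have "(!) xs ` {..<length xs} \<subseteq> Vect2" using assms by auto
  then obtain p q where "\<And>k. k \<in> {..<length xs} \<Longrightarrow> xs ! k = vector_field_family p q k"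
    using Vect2_choice by blast
  then show ?thesis by (intro that[of p q] nth_equalityI) simp_all
qed

lemma Vect2_eqI:
  assumes "A \<in> Vect2" "B \<in> Vect2" "apply_op A x1 = apply_op B x1" "apply_op A x2 = apply_op B x2"
  shows "A = B"
  using assms by (auto simp: Vect2_def Vect2_coefficients)

lemma subspace_Vect2: "diff_op.subspace Vect2"
proof (rule diff_op.subspaceI)
  have "0 = 0 \<cdot> D1 + 0 \<cdot> D2" by (rule diff_op_eqI) (simp add: apply_op_simps)
  then show "0 \<in> Vect2" unfolding Vect2_def by blast
next
  fix A B assume "A \<in> Vect2" "B \<in> Vect2"
  then obtain u1 u2 v1 v2 where "A = u1 \<cdot> D1 + u2 \<cdot> D2" "B = v1 \<cdot> D1 + v2 \<cdot> D2"
    unfolding Vect2_def by blast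
  then have "A + B = (u1 + v1) \<cdot> D1 + (u2 + v2) \<cdot> D2"
    by (intro diff_op_eqI) (simp add: apply_op_simps algebra_simps)
  then show "A + B \<in> Vect2" unfolding Vect2_def by blast
next
  fix c A assume "A \<in> Vect2"
  then obtain u1 u2 where "A = u1 \<cdot> D1 + u2 \<cdot> D2" unfolding Vect2_def by blast
  then have "cscale c A = (const c * u1) \<cdot> D1 + (const c * u2) \<cdot> D2"
    by (intro diff_op_eqI) (simp add: cscale_def apply_op_simps algebra_simps)
  then show "cscale c A \<in> Vect2" unfolding Vect2_def by blast
qed

lemma const_of_int: "const (of_int n) = of_int n"
  by (simp add: const_def of_int_poly)

lemma of_int_mult_eq_cscale: "of_int n * A = cscale (of_int n) A"
  by (rule diff_op_eqI) (simp add: cscale_def apply_op_of_int apply_op_scale const_of_int)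

theorem s6_in_Vect2:
  assumes "set xs \<subseteq> Vect2" "length xs = 6"
  shows "s 6 xs \<in> Vect2"
proof -
  obtain p q where xs: "xs = map (vector_field_family p q) [0..<6]"
    using Vect2_list[OF assms(1)] assms(2) by metis
  obtain g h where "\<forall>f. act (oddop (vector_field_family p q) ^ 6) (vacuum f) (set [0..<6]) = g * d1 f + h * d2 f"
    using oddop_power_6_first_order by blast
  moreover have "apply_op (s 6 xs) f = act (oddop (vector_field_family p q) ^ 6) (vacuum f) (set [0..<6])" for f
    unfolding xs by (rule oddop_power_eq_s[symmetric]) simp_all
  ultimately have "s 6 xs = g \<cdot> D1 + h \<cdot> D2"
    by (intro diff_op_eqI) (simp add: apply_op_simps)
  then show ?thesis unfolding Vect2_def by blast
qed

theorem s7_eq_0: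
  assumes "set xs \<subseteq> Vect2" "length xs = 7"
  shows "s 7 xs = 0"
proof (rule diff_op_eqI)
  fix f
  obtain p q where xs: "xs = map (vector_field_family p q) [0..<7]"
    using Vect2_list[OF assms(1)] assms(2) by metis
  have "apply_op (s 7 xs) f = act (oddop (vector_field_family p q) ^ 7) (vacuum f) (set [0..<7])"
    unfolding xs by (rule oddop_power_eq_s[symmetric]) simp_all
  then show "apply_op (s 7 xs) f = apply_op 0 f"
    by (simp add: oddop_power_7 act_simps apply_op_simps)
qed

text \<open>
  This is \<open>X ^ 6 = - \<delta> X ^ 5\<close>: the coefficient \<open>\<theta>\<^sub>i Div X\<^sub>i\<close> of \<open>\<delta>\<close> has to pass the \<open>6 - i\<close> variables
  with larger index.
\<close>

theorem s6_eq_Div_s5: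
  assumes "X ` {1..6} \<subseteq> Vect2"
  shows "s 6 (map X [1..<7]) =
    (\<Sum>i = 1..6. (-1) ^ (i + 1) * (Div (X i) \<cdot> s 5 (map X (filter (\<lambda>l. l \<noteq> i) [1..<7]))))"
proof (rule diff_op_eqI)
  fix f
  obtain p q where X: "\<And>k. k \<in> {1..6} \<Longrightarrow> X k = vector_field_family p q k"
    using Vect2_choice[OF assms] by metis
  let ?\<Phi> = "vector_field_family p q"
  have X6: "map X [1..<7] = map ?\<Phi> [1..<7]" using X by (intro map_cong) auto
  have X5: "map X (filter (\<lambda>l. l \<noteq> i) [1..<7]) = map ?\<Phi> (filter (\<lambda>l. l \<noteq> i) [1..<7])" for i
    using X by (intro map_cong) auto
  have s5: "act (oddop ?\<Phi> ^ 5) (vacuum f) ({1..6} - {i}) = apply_op (s 5 (map X (filter (\<lambda>l. l \<noteq> i) [1..<7]))) f"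
    if "i \<in> {1..6}" for i
  proof -
    have "distinct (filter (\<lambda>l. l \<noteq> i) [1..<7])" by simp
    then have "length (filter (\<lambda>l. l \<noteq> i) [1..<7]) = card ({1..6} - {i})"
      by (subst distinct_card[symmetric]) (auto intro: arg_cong[of _ _ card])
    then have "act (oddop ?\<Phi> ^ 5) (vacuum f) (set (filter (\<lambda>l. l \<noteq> i) [1..<7])) =
        apply_op (s 5 (map X (filter (\<lambda>l. l \<noteq> i) [1..<7]))) f"
      unfolding X5 using that by (intro oddop_power_eq_s sorted_wrt_filter) auto
    moreover have "set (filter (\<lambda>l. l \<noteq> i) [1..<7]) = {1..6} - {i}" by auto
    ultimately show ?thesis by simp
  qed
  have sign: "- ((- 1) ^ card {j \<in> {1..6}. i < j}) = ((- 1) ^ (i + 1) :: U)" if "i \<in> {1..6}" for i :: nat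
  proof -
    have "{j \<in> {1..6}. i < j} = {Suc i..6}" by auto
    then have "card {j \<in> {1..6}. i < j} = 6 - i" by simp
    moreover have "even (6 - i) \<longleftrightarrow> even i" using that by simp
    ultimately show ?thesis by (cases "even i") (simp_all add: minus_one_power_iff)
  qed
  have "apply_op (s 6 (map X [1..<7])) f = act (oddop ?\<Phi> ^ 6) (vacuum f) (set [1..<7])"
    unfolding X6 by (rule oddop_power_eq_s[symmetric]) simp_all
  also have "set [1..<7] = {1..6}" by auto
  also have "act (oddop ?\<Phi> ^ 6) (vacuum f) {1..6} =
      (\<Sum>i = 1..6. - ((- 1) ^ card {j \<in> {1..6}. i < j}) * ((d1 (p i) + d2 (q i)) *
         act (oddop ?\<Phi> ^ 5) (vacuum f) ({1..6} - {i})))"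
    unfolding oddop_power_6
    by (simp add: act_simps odd_elt_def oddop.rep_eq apply_op_simps flip: sum_negf)
  also have "\<dots> = (\<Sum>i = 1..6. (- 1) ^ (i + 1) * (Div (X i) * apply_op (s 5 (map X (filter (\<lambda>l. l \<noteq> i) [1..<7]))) f))"
    by (intro sum.cong refl) (simp only: sign s5 X Div_Vect2)
  also have "\<dots> = apply_op (\<Sum>i = 1..6. (-1) ^ (i + 1) * (Div (X i) \<cdot> s 5 (map X (filter (\<lambda>l. l \<noteq> i) [1..<7])))) f"
    by (simp add: apply_op_sum_left apply_op_power_sign_left apply_op_scale del: power_Suc)
  finally show "apply_op (s 6 (map X [1..<7])) f =
    apply_op (\<Sum>i = 1..6. (-1) ^ (i + 1) * (Div (X i) \<cdot> s 5 (map X (filter (\<lambda>l. l \<noteq> i) [1..<7])))) f" .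
qed

text \<open>
  An iterated right-symmetric product acts on the coordinates in the same way as the composition, but
  it is always a vector field.  The sums therefore agree as soon as \<open>s 6 xs\<close> is a vector field, too.
\<close>

theorem s6_eq_s6_rsym_r:
  assumes "set xs \<subseteq> Vect2" "length xs = 6"
  shows "s 6 xs = s_rsym_r 6 xs"
proof -
  have foldl: "apply_op (foldl rsym z zs) x1 = apply_op (z * prod_list zs) x1 \<and>
      apply_op (foldl rsym z zs) x2 = apply_op (z * prod_list zs) x2" for z zs
  proof (induction zs arbitrary: z)
    case (Cons y zs)
    have "apply_op (rsym z y) x1 = apply_op (z * y) x1" "apply_op (rsym z y) x2 = apply_op (z * y) x2"
      by (simp_all add: rsym_def Vect2_coefficients apply_op_simps)
    then show ?case using Cons[of "rsym z y"] by (simp add: times_diff_op.rep_eq)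
  qed simp
  have apply_eq: "apply_op (left_normed rsym zs) x1 = apply_op (prod_list zs) x1"
    "apply_op (left_normed rsym zs) x2 = apply_op (prod_list zs) x2" if "zs \<noteq> []" for zs
    using that foldl by (cases zs; simp)+
  have closed: "left_normed rsym zs \<in> Vect2" if "set zs \<subseteq> Vect2" for zs
  proof -
    have "rsym z y \<in> Vect2" for z y by (auto simp: rsym_def Vect2_def)
    then have "foldl rsym z zs \<in> Vect2" if "z \<in> Vect2" for z zs
      using that by (induction zs arbitrary: z) simp_all
    then show ?thesis using that diff_op.subspace_0[OF subspace_Vect2] by (cases zs) auto
  qed
  have nonempty: "permute_list \<sigma> xs \<noteq> []" for \<sigma>
    using assms(2) by (metis length_0_conv length_permute_list zero_neq_numeral)
  show ?thesis
  proof (rule Vect2_eqI)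
    show "s 6 xs \<in> Vect2" using assms by (rule s6_in_Vect2)
    show "s_rsym_r 6 xs \<in> Vect2"
      unfolding s_rsym_r_def skew_sum_def of_int_mult_eq_cscale
      using assms
      by (intro diff_op.subspace_sum diff_op.subspace_scale subspace_Vect2 closed)
         (simp add: set_permute_list)
  qed (simp_all add: s_def s_rsym_r_def skew_sum_def apply_op_sum_left apply_op_of_int apply_eq nonempty)
qed

section \<open>A non-zero value of the 6-commutator\<close>

text \<open>
  Expansion along the factor that is applied last, as for a determinant.
\<close>

lemma s_Suc_expansion:
  assumes "length xs = Suc n"
  shows "apply_op (s (Suc n) xs) f =
    (\<Sum>i<Suc n. (- 1) ^ (n - i) * apply_op (xs ! i) (apply_op (s n (take i xs @ drop (Suc i) xs)) f))"
proof -
  have rest: "act (oddop ((!) xs) ^ n) (vacuum f) ({..<Suc n} - {i}) = apply_op (s n (take i xs @ drop (Suc i) xs)) f"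
    if "i < Suc n" for i
  proof -
    have "act (oddop ((!) xs) ^ n) (vacuum f) (set ([0..<i] @ [Suc i..<Suc n])) =
        apply_op (s n (map ((!) xs) ([0..<i] @ [Suc i..<Suc n]))) f"
      using that by (intro oddop_power_eq_s) (auto simp: sorted_wrt_append simp del: upt_Suc)
    moreover have "set ([0..<i] @ [Suc i..<Suc n]) = {..<Suc n} - {i}"
      using that by (auto simp del: upt_Suc)
    moreover have "map ((!) xs) ([0..<i] @ [Suc i..<Suc n]) = take i xs @ drop (Suc i) xs"
      using that assms by (intro nth_equalityI) (auto simp: nth_append simp del: upt_Suc)
    ultimately show ?thesis by simp
  qed
  have sign: "card {j \<in> {..<Suc n}. i < j} = n - i" for i
  proof -
    have "{j \<in> {..<Suc n}. i < j} = {i<..n}" by auto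
    then show ?thesis by simp
  qed
  have "apply_op (s (Suc n) xs) f = act (oddop ((!) xs) ^ Suc n) (vacuum f) {..<Suc n}"
    using assms by (rule oddop_power_eq_s_nth[symmetric])
  also have "\<dots> = (\<Sum>i<Suc n. (- 1) ^ card {j \<in> {..<Suc n}. i < j} *
      apply_op (xs ! i) (act (oddop ((!) xs) ^ n) (vacuum f) ({..<Suc n} - {i})))"
    by (simp only: power_Suc times_gop.rep_eq oddop.rep_eq)
  also have "\<dots> = (\<Sum>i<Suc n. (- 1) ^ (n - i) *
      apply_op (xs ! i) (apply_op (s n (take i xs @ drop (Suc i) xs)) f))"
    unfolding sign by (intro sum.cong refl) (simp only: rest lessThan_iff)
  finally show ?thesis .
qed

lemma s_0: "s 0 [] = 1"
proof -
  have "{\<sigma>. \<sigma> permutes {..<0 :: nat}} = {id}" by auto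
  then show ?thesis by (simp add: s_def skew_sum_def)
qed

lemma d_constants [simp]: "d1 1 = 0" "d2 1 = 0" "d1 (numeral k) = 0" "d2 (numeral k) = 0"
proof -
  have const: "d1 (const c) = 0" "d2 (const c) = 0" for c
    by (simp_all add: d1_def d2_def const_def map_poly_pCons pderiv_pCons)
  have "numeral k = const (numeral k)" by (simp add: const_def numeral_poly)
  then show "d1 (numeral k) = 0" "d2 (numeral k) = 0"
    by (simp_all only: const)
qed (simp_all add: d1_def d2_def one_pCons map_poly_pCons pderiv_pCons)

lemma d_minus: "d1 (- u) = - d1 u" "d2 (- u) = - d2 u"
  using d1_add[of u "- u"] d2_add[of u "- u"] by (simp_all add: eq_neg_iff_add_eq_0 add.commute)

lemma s5_value:
  "apply_op (s 5 [D1, D2, x2 \<cdot> D1, x1 \<cdot> D2, (x1 * x1) \<cdot> D1 - (2 * x1 * x2) \<cdot> D2]) x2 = - 6"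
  by (simp add: numeral_eq_Suc s_Suc_expansion s_0 lessThan_Suc apply_op_simps d1_mult d2_mult d1_add d2_add d_minus
      algebra_simps)

text \<open>
  Among these fields only \<open>x\<^sub>1 \<partial>\<^sub>1\<close> has non-zero divergence, so the divergence formula leaves a single
  \<open>s\<^sub>5\<close>.  The constant fields lower degrees by 2 in total and the quadratic one raises them by 1, so the
  value is a constant field; it is detected on \<open>x\<^sub>2\<close>.
\<close>

theorem s6_nonzero:
  defines "X \<equiv> (\<lambda>k. [x1 \<cdot> D1, D1, D2, x2 \<cdot> D1, x1 \<cdot> D2, (x1 * x1) \<cdot> D1 - (2 * x1 * x2) \<cdot> D2] ! (k - 1))"
  shows "X ` {1..6} \<subseteq> Vect2" "s 6 (map X [1..<7]) \<noteq> 0"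
proof -
  have V: "u1 \<cdot> D1 + u2 \<cdot> D2 \<in> Vect2" for u1 u2 by (auto simp: Vect2_def)
  have "D1 = 1 \<cdot> D1 + 0 \<cdot> D2" "D2 = 0 \<cdot> D1 + 1 \<cdot> D2" "x1 \<cdot> D1 = x1 \<cdot> D1 + 0 \<cdot> D2" "x2 \<cdot> D1 = x2 \<cdot> D1 + 0 \<cdot> D2"
    "x1 \<cdot> D2 = 0 \<cdot> D1 + x1 \<cdot> D2"
    "(x1 * x1) \<cdot> D1 - (2 * x1 * x2) \<cdot> D2 = (x1 * x1) \<cdot> D1 + (- (2 * x1 * x2)) \<cdot> D2"
    by (rule diff_op_eqI; simp add: apply_op_simps)+
  then have mem: "D1 \<in> Vect2" "D2 \<in> Vect2" "x1 \<cdot> D1 \<in> Vect2" "x2 \<cdot> D1 \<in> Vect2" "x1 \<cdot> D2 \<in> Vect2"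
    "(x1 * x1) \<cdot> D1 - (2 * x1 * x2) \<cdot> D2 \<in> Vect2"
    using V by metis+
  have set: "{1..6} = {1, 2, 3, 4, 5, 6 :: nat}" by auto
  show *: "X ` {1..6} \<subseteq> Vect2"
    unfolding set X_def using mem by (simp add: numeral_eq_Suc)
  have Div: "Div (X 1) = 1" "i \<in> {1..6} - {1} \<Longrightarrow> Div (X i) = 0" for i
    unfolding set X_def Div_def by (auto simp: apply_op_simps d1_mult d2_mult d_minus numeral_eq_Suc)
  have "s 6 (map X [1..<7]) =
     (\<Sum>i = 1..6. (-1) ^ (i + 1) * (Div (X i) \<cdot> s 5 (map X (filter (\<lambda>l. l \<noteq> i) [1..<7]))))"
    using * by (rule s6_eq_Div_s5)
  also have "\<dots> = (\<Sum>i\<in>{1}. (-1) ^ (i + 1) * (Div (X i) \<cdot> s 5 (map X (filter (\<lambda>l. l \<noteq> i) [1..<7]))))"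
    by (rule sum.mono_neutral_right) (auto simp: Div scale_simps(2))
  also have "\<dots> = 1 \<cdot> s 5 (map X (filter (\<lambda>l. l \<noteq> 1) [1..<7]))"
    using Div(1) by simp
  also have "map X (filter (\<lambda>l. l \<noteq> 1) [1..<7]) =
      [D1, D2, x2 \<cdot> D1, x1 \<cdot> D2, (x1 * x1) \<cdot> D1 - (2 * x1 * x2) \<cdot> D2]"
    by (simp add: X_def upt_rec)
  finally have "apply_op (s 6 (map X [1..<7])) x2 = - 6"
    by (simp add: apply_op_scale s5_value)
  then show "s 6 (map X [1..<7]) \<noteq> 0" by (auto simp: zero_diff_op.rep_eq)
qed

section \<open>Multilinearity and skew symmetry\<close>

lemma cscale_mult: "cscale c A * B = cscale c (A * B)" "A * cscale c B = cscale c (A * B)"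
  by (rule diff_op_eqI; simp add: cscale_def apply_op_simps apply_op_const)+

lemma permute_list_update:
  assumes "\<sigma> permutes {..<length l}" "i < length l"
  shows "permute_list \<sigma> (l[i := x]) = (permute_list \<sigma> l)[inv \<sigma> i := x]"
proof (rule nth_equalityI)
  fix j assume "j < length (permute_list \<sigma> (l[i := x]))"
  then have j: "j < length l" by simp
  then have "\<sigma> j < length l" using permutes_in_image[OF assms(1)] by blast
  moreover have "inv \<sigma> i = j \<longleftrightarrow> \<sigma> j = i"
    by (rule permutes_inv_eq[OF assms(1)])
  moreover have "inv \<sigma> i < length l" using assms(2) permutes_in_image[OF permutes_inv[OF assms(1)]] by blast
  ultimately show "permute_list \<sigma> (l[i := x]) ! j = (permute_list \<sigma> l)[inv \<sigma> i := x] ! j"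
    using j assms by (auto simp: permute_list_nth nth_list_update)
qed simp

text \<open>
  Each of the products has the distinguished argument in exactly one place, namely at the inverse image
  of its position.
\<close>

lemma s_argument:
  assumes "length xs + 1 + length ys = m"
  obtains B C where "\<And>x. s m (xs @ [x] @ ys) = (\<Sum>\<sigma> | \<sigma> permutes {..<m}. B \<sigma> * x * C \<sigma>)"
proof -
  define l where "l = xs @ [0] @ ys"
  define P where "P \<sigma> = permute_list \<sigma> l" for \<sigma> :: "nat \<Rightarrow> nat"
  define j where "j \<sigma> = inv \<sigma> (length xs)" for \<sigma> :: "nat \<Rightarrow> nat"
  have len: "length l = m" using assms by (simp add: l_def)
  have "s m (xs @ [x] @ ys) =
    (\<Sum>\<sigma> | \<sigma> permutes {..<m}. (of_int (sign \<sigma>) * prod_list (take (j \<sigma>) (P \<sigma>))) * x * prod_list (drop (Suc (j \<sigma>)) (P \<sigma>)))" for x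
    unfolding s_def skew_sum_def
  proof (rule sum.cong[OF refl])
    fix \<sigma> assume "\<sigma> \<in> {\<sigma>. \<sigma> permutes {..<m}}"
    then have \<sigma>: "\<sigma> permutes {..<length l}" by (simp add: len)
    have lx: "length xs < length l" using assms len by simp
    have "xs @ [x] @ ys = l[length xs := x]" by (simp add: l_def)
    then have "permute_list \<sigma> (xs @ [x] @ ys) = (P \<sigma>)[j \<sigma> := x]"
      unfolding P_def j_def by (simp only: permute_list_update[OF \<sigma> lx])
    moreover have "j \<sigma> < length (P \<sigma>)"
      using lx permutes_in_image[OF permutes_inv[OF \<sigma>]] by (simp add: P_def j_def)
    ultimately have "prod_list (permute_list \<sigma> (xs @ [x] @ ys)) =
        prod_list (take (j \<sigma>) (P \<sigma>)) * x * prod_list (drop (Suc (j \<sigma>)) (P \<sigma>))"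
      by (simp add: upd_conv_take_nth_drop mult.assoc)
    then show "of_int (sign \<sigma>) * prod_list (permute_list \<sigma> (xs @ [x] @ ys)) =
      (of_int (sign \<sigma>) * prod_list (take (j \<sigma>) (P \<sigma>))) * x * prod_list (drop (Suc (j \<sigma>)) (P \<sigma>))"
      by (simp only: mult.assoc)
  qed
  then show ?thesis by (rule that)
qed

lemma s_add:
  assumes "length xs + 1 + length ys = m"
  shows "s m (xs @ [x + y] @ ys) = s m (xs @ [x] @ ys) + s m (xs @ [y] @ ys)"
proof -
  obtain B C where *: "\<And>x. s m (xs @ [x] @ ys) = (\<Sum>\<sigma> | \<sigma> permutes {..<m}. B \<sigma> * x * C \<sigma>)"
    using s_argument[OF assms] by blast
  show ?thesis unfolding * by (simp add: distrib_left distrib_right sum.distrib)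
qed

lemma s_cscale:
  assumes "length xs + 1 + length ys = m"
  shows "s m (xs @ [cscale c x] @ ys) = cscale c (s m (xs @ [x] @ ys))"
proof -
  obtain B C where *: "\<And>x. s m (xs @ [x] @ ys) = (\<Sum>\<sigma> | \<sigma> permutes {..<m}. B \<sigma> * x * C \<sigma>)"
    using s_argument[OF assms] by blast
  show ?thesis unfolding * by (simp add: cscale_mult diff_op.scale_sum_right)
qed

lemma s_permute_list:
  assumes "length xs = m" "\<tau> permutes {..<m}"
  shows "s m (permute_list \<tau> xs) = of_int (sign \<tau>) * s m xs"
proof -
  have "of_int (sign \<tau>) * s m xs =
    (\<Sum>\<sigma> | \<sigma> permutes {..<m}. of_int (sign \<tau>) * (of_int (sign \<sigma>) * prod_list (permute_list \<sigma> xs)))"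
    by (simp add: s_def skew_sum_def sum_distrib_left)
  also have "\<dots> = (\<Sum>\<sigma> | \<sigma> permutes {..<m}. of_int (sign \<tau>) * (of_int (sign (\<tau> \<circ> \<sigma>)) * prod_list (permute_list (\<tau> \<circ> \<sigma>) xs)))"
    by (rule setum_permutations_compose_left[OF assms(2)])
  also have "\<dots> = (\<Sum>\<sigma> | \<sigma> permutes {..<m}. of_int (sign \<sigma>) * prod_list (permute_list \<sigma> (permute_list \<tau> xs)))"
  proof (rule sum.cong[OF refl])
    fix \<sigma> assume "\<sigma> \<in> {\<sigma>. \<sigma> permutes {..<m}}"
    then have \<sigma>: "\<sigma> permutes {..<m}" by simp
    have "sign (\<tau> \<circ> \<sigma>) = sign \<tau> * sign \<sigma>"
      using \<sigma> assms(2) permutes_imp_permutation by (intro sign_compose) blast+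
    moreover have "permute_list (\<tau> \<circ> \<sigma>) xs = permute_list \<sigma> (permute_list \<tau> xs)"
      using \<sigma> assms(1) by (intro permute_list_compose) simp
    moreover have "of_int (sign \<tau>) * (of_int (sign \<tau> * sign \<sigma>) * z) = of_int (sign \<sigma>) * z" for z :: diff_op
      by (simp flip: mult.assoc of_int_mult)
    ultimately show "of_int (sign \<tau>) * (of_int (sign (\<tau> \<circ> \<sigma>)) * prod_list (permute_list (\<tau> \<circ> \<sigma>) xs)) =
        of_int (sign \<sigma>) * prod_list (permute_list \<sigma> (permute_list \<tau> xs))" by simp
  qed
  finally show ?thesis by (simp add: s_def skew_sum_def)
qed

lemma skew_operation_s:
  assumes "\<And>xs. length xs = m \<Longrightarrow> set xs \<subseteq> Vect2 \<Longrightarrow> s m xs \<in> Vect2"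
  shows "skew_operation m Vect2 (s m)"
  unfolding skew_operation_def multilinear_operation_def
  by (intro conjI allI impI ballI; (rule subspace_Vect2 | rule assms s_permute_list s_add s_cscale; simp))

lemma s2_eq: "s 2 [A, B] = A * B - B * A"
  by (rule diff_op_eqI)
     (simp add: numeral_eq_Suc s_Suc_expansion s_0 lessThan_Suc apply_op_simps apply_op_minus)

lemma s2_in_Vect2:
  assumes "set xs \<subseteq> Vect2" "length xs = 2"
  shows "s 2 xs \<in> Vect2"
proof -
  obtain A B where xs: "xs = [A, B]" using assms(2) by (auto simp: numeral_eq_Suc length_Suc_conv)
  then obtain u1 u2 v1 v2 where AB: "A = u1 \<cdot> D1 + u2 \<cdot> D2" "B = v1 \<cdot> D1 + v2 \<cdot> D2"
    using assms(1) by (auto simp: Vect2_def)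
  have "s 2 xs = (v1 * d1 u1 + v2 * d2 u1 - (u1 * d1 v1 + u2 * d2 v1)) \<cdot> D1 +
      (v1 * d1 u2 + v2 * d2 u2 - (u1 * d1 v2 + u2 * d2 v2)) \<cdot> D2"
    unfolding xs s2_eq AB
    by (rule diff_op_eqI) (simp add: apply_op_simps d1_add d2_add d1_mult d2_mult d2_d1 algebra_simps)
  then show ?thesis unfolding Vect2_def by blast
qed

lemma Lie_algebra_s2: "Lie_algebra Vect2 (s 2)"
  unfolding Lie_algebra_def
  using skew_operation_s[of 2] s2_in_Vect2 by (auto simp: s2_eq algebra_simps)

section \<open>The cocycle condition\<close>

lemma \<theta>_commutes: "\<theta> i * evenop A = evenop A * \<theta> i"
proof -
  have "A * ((if k = i then 1 else 0) \<cdot> 1) = ((if k = i then 1 else 0) \<cdot> 1) * A" for k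
    by (rule diff_op_eqI) (simp add: apply_op_simps)
  then show ?thesis by (simp add: \<theta>_def odd_elt_def evenop_oddop oddop_evenop)
qed

lemma \<theta>_anticommutes: "\<theta> i * oddop \<phi> = - (oddop \<phi> * \<theta> i)"
  unfolding \<theta>_def odd_elt_def
  by (rule oddop_anticommute, rule diff_op_eqI) (simp add: apply_op_simps)

lemma \<theta>_square: "\<theta> i * \<theta> i = 0"
  unfolding \<theta>_def by (rule odd_elt_square)

lemma \<theta>_power_commutes: "\<theta> i * oddop \<phi> ^ n = (- 1) ^ n * (oddop \<phi> ^ n * \<theta> i)"
proof (induction n)
  case (Suc n)
  have "\<theta> i * oddop \<phi> ^ Suc n = - (oddop \<phi> * (\<theta> i * oddop \<phi> ^ n))"
    by (simp add: \<theta>_anticommutes flip: mult.assoc)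
  also have "\<dots> = (- 1) ^ Suc n * (oddop \<phi> ^ Suc n * \<theta> i)"
    unfolding Suc by (cases "even n") (simp_all add: mult.assoc)
  finally show ?case .
qed simp

text \<open>
  For families of finite support, the formal sum behind \<open>oddop\<close> is an actual one.
\<close>

lemma oddop_eq_sum:
  assumes "finite T" "\<And>k. k \<notin> T \<Longrightarrow> \<phi> k = 0"
  shows "oddop \<phi> = (\<Sum>k\<in>T. \<theta> k * evenop (\<phi> k))"
proof -
  have single: "\<theta> k * evenop (\<phi> k) = oddop (\<lambda>j. if j = k then \<phi> j else 0)" for k
  proof -
    have "\<phi> k * ((if j = k then 1 else 0) \<cdot> 1) = (if j = k then \<phi> j else 0)" for j
      by (rule diff_op_eqI) (simp add: apply_op_simps)
    then show ?thesis by (simp add: \<theta>_def odd_elt_def oddop_evenop)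
  qed
  have "(\<Sum>k\<in>T. oddop (\<lambda>j. if j = k then \<phi> j else 0)) = oddop (\<lambda>j. \<Sum>k\<in>T. if j = k then \<phi> j else 0)"
    using assms(1)
  proof (induction T rule: finite_induct)
    case empty
    show ?case by (rule gop_eqI) (simp add: oddop.rep_eq act_simps apply_op_simps)
  next
    case (insert x F)
    show ?case by (simp only: sum.insert[OF insert.hyps] oddop_add insert.IH)
  qed
  also have "(\<lambda>j. \<Sum>k\<in>T. if j = k then \<phi> j else 0) = \<phi>"
    using assms by (auto simp: sum.delta)
  finally show ?thesis by (simp add: single)
qed

text \<open>
  The sum of \<open>(- 1)\<^sup>i X\<^sup>i B X\<^sup>j\<close> over \<open>i + j = n - 1\<close>: the even operator \<open>B\<close> is inserted into all
  places of \<open>X ^ (n - 1)\<close>.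
\<close>

fun insertion :: "diff_op \<Rightarrow> gop \<Rightarrow> nat \<Rightarrow> gop" where
  "insertion B X 0 = 0"
| "insertion B X (Suc n) = evenop B * X ^ n - X * insertion B X n"

lemma power_add_\<theta>:
  "(oddop \<phi> + \<theta> i * evenop B) ^ n = oddop \<phi> ^ n + \<theta> i * insertion B (oddop \<phi>) n"
proof (induction n)
  case (Suc n)
  have "(oddop \<phi> + \<theta> i * evenop B) ^ Suc n =
      (oddop \<phi> + \<theta> i * evenop B) * (oddop \<phi> ^ n + \<theta> i * insertion B (oddop \<phi>) n)"
    by (simp add: Suc)
  also have "\<dots> = oddop \<phi> ^ Suc n + \<theta> i * (evenop B * oddop \<phi> ^ n) +
      (oddop \<phi> * \<theta> i) * insertion B (oddop \<phi>) n + \<theta> i * (evenop B * \<theta> i) * insertion B (oddop \<phi>) n"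
    by (simp add: distrib_left distrib_right mult.assoc)
  also have "oddop \<phi> * \<theta> i = - (\<theta> i * oddop \<phi>)" by (simp add: \<theta>_anticommutes)
  also have "\<theta> i * (evenop B * \<theta> i) = 0"
    by (simp add: \<theta>_square flip: \<theta>_commutes mult.assoc)
  finally show ?case by (simp add: right_diff_distrib mult.assoc)
qed simp

text \<open>
  Index \<open>0\<close>, smaller than all the others, is reserved for the argument \<open>B\<close>: the power of
  \<open>X + \<theta>\<^sub>0 B\<close> is computed by \<open>power_add_\<theta>\<close>, and \<open>\<theta>\<^sub>0\<close> has to pass the other \<open>n\<close> variables.
\<close>

theorem s_insert_first:
  assumes "sorted_wrt (<) ts" "0 \<notin> set ts" "length ts = n"
  shows "apply_op (s (Suc n) (B # map X ts)) f =
    (- 1) ^ n * act (insertion B (oddop (X(0 := 0))) (Suc n)) (vacuum f) (set ts)"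
proof -
  have sorted: "sorted_wrt (<) (0 # ts)" using assms by (auto intro!: gr0I)
  have ts: "map (X(0 := C)) (0 # ts) = C # map X ts" for C using assms(2) by auto
  have "oddop (X(0 := B)) = oddop (X(0 := 0)) + \<theta> 0 * evenop B"
  proof -
    have "B * ((if k = 0 then 1 else 0) \<cdot> 1) = (if k = 0 then B else 0)" for k :: nat
      by (rule diff_op_eqI) (simp add: apply_op_simps)
    then show ?thesis
      unfolding \<theta>_def odd_elt_def oddop_evenop oddop_add[symmetric]
      by (intro arg_cong[of _ _ oddop]) auto
  qed
  then have power: "oddop (X(0 := B)) ^ Suc n =
      oddop (X(0 := 0)) ^ Suc n + \<theta> 0 * insertion B (oddop (X(0 := 0))) (Suc n)"
    by (simp only: power_add_\<theta>)
  have "s (Suc n) (0 # map X ts) = 0"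
    using s_cscale[of "[]" "map X ts" "Suc n" 0 0] assms(3) by simp
  then have zero: "act (oddop (X(0 := 0)) ^ Suc n) (vacuum f) (set (0 # ts)) = 0"
    using oddop_power_eq_s[OF sorted, of "Suc n" "X(0 := 0)" f] assms(3)
    by (simp only: ts) (simp add: zero_diff_op.rep_eq)
  have card: "card {j \<in> set (0 # ts). 0 < j} = n"
  proof -
    have "{j \<in> set (0 # ts). 0 < j} = set ts" using assms(2) by (auto intro: gr0I)
    then show ?thesis using assms by (simp add: distinct_card strict_sorted_iff)
  qed
  have "apply_op (s (Suc n) (B # map X ts)) f = act (oddop (X(0 := B)) ^ Suc n) (vacuum f) (set (0 # ts))"
    using oddop_power_eq_s[OF sorted, of "Suc n" "X(0 := B)" f] assms(3) by (simp only: ts) simp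
  also have "\<dots> = act (\<theta> 0 * insertion B (oddop (X(0 := 0))) (Suc n)) (vacuum f) (set (0 # ts))"
    unfolding power plus_gop.rep_eq zero by simp
  also have "\<dots> = (- 1) ^ n * act (insertion B (oddop (X(0 := 0))) (Suc n)) (vacuum f) (set (0 # ts) - {0})"
    unfolding times_gop.rep_eq by (subst act_\<theta>) (simp_all only: card finite_set list.set_intros if_True)
  also have "set (0 # ts) - {0} = set ts" using assms(2) by auto
  finally show ?thesis .
qed

lemma vacuum_apply_op: "vacuum (apply_op A f) = act (evenop A) (vacuum f)"
  by (rule ext) (simp add: vacuum_def evenop.rep_eq)

lemma \<theta>_\<theta>_commutes:
  "\<theta> i * (\<theta> j * (oddop \<phi> * g)) = oddop \<phi> * (\<theta> i * (\<theta> j * g))"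
proof -
  have "\<theta> i * (\<theta> j * (oddop \<phi> * g)) = - (\<theta> i * oddop \<phi> * (\<theta> j * g))"
    by (simp add: \<theta>_anticommutes[of j] mult.assoc flip: mult.assoc[of "\<theta> j" "oddop \<phi>" g])
  also have "\<dots> = oddop \<phi> * (\<theta> i * (\<theta> j * g))"
    by (simp add: \<theta>_anticommutes[of i] mult.assoc)
  finally show ?thesis .
qed

lemma \<theta>_swap: "\<theta> i * \<theta> j = - (\<theta> j * \<theta> i)"
  unfolding \<theta>_def by (rule odd_elt_anticommute)

text \<open>
  Exchanging \<open>i\<close> and \<open>j\<close> changes the sign of \<open>\<theta>\<^sub>i \<theta>\<^sub>j\<close>, which turns products into commutators.
\<close>

lemma oddop_square:
  assumes "finite T" "\<And>k. k \<notin> T \<Longrightarrow> \<phi> k = 0"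
  shows "(\<Sum>(i, j) | i \<in> T \<and> j \<in> T \<and> i < j. \<theta> i * (\<theta> j * evenop (s 2 [\<phi> i, \<phi> j]))) =
    - (oddop \<phi> * oddop \<phi>)"
proof -
  define t where "t i j = \<theta> i * (\<theta> j * (evenop (\<phi> i) * evenop (\<phi> j)))" for i j
  define P where "P = {(i, j). i \<in> T \<and> j \<in> T \<and> i < j}"
  have fin: "finite P" unfolding P_def
    by (rule finite_subset[of _ "T \<times> T"]) (use assms(1) in auto)
  have "oddop \<phi> * oddop \<phi> = (\<Sum>i\<in>T. \<Sum>j\<in>T. t i j)"
  proof -
    have "\<theta> i * evenop (\<phi> i) * (\<theta> j * evenop (\<phi> j)) = t i j" for i j
      unfolding t_def mult.assoc by (simp flip: mult.assoc[of "evenop (\<phi> i)" "\<theta> j"] add: \<theta>_commutes[symmetric] mult.assoc)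
    then show ?thesis using oddop_eq_sum[OF assms] by (simp add: sum_product)
  qed
  also have "\<dots> = (\<Sum>(i, j)\<in>T \<times> T. t i j)" by (simp add: sum.cartesian_product)
  also have "\<dots> = (\<Sum>(i, j)\<in>P \<union> prod.swap ` P. t i j)"
  proof (rule sum.mono_neutral_right)
    show "\<forall>z\<in>T \<times> T - (P \<union> prod.swap ` P). (case z of (i, j) \<Rightarrow> t i j) = 0"
    proof
      fix z assume z: "z \<in> T \<times> T - (P \<union> prod.swap ` P)"
      obtain i j where ij: "z = (i, j)" by fastforce
      have "\<not> i < j" "\<not> j < i" using z unfolding ij P_def by (auto simp: image_iff)
      then show "(case z of (i, j) \<Rightarrow> t i j) = 0" unfolding ij by (simp add: t_def \<theta>_square flip: mult.assoc)
    qed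
  qed (use assms(1) in \<open>auto simp: P_def\<close>)
  also have "\<dots> = (\<Sum>(i, j)\<in>P. t i j) + (\<Sum>(i, j)\<in>prod.swap ` P. t i j)"
    using fin by (intro sum.union_disjoint) (auto simp: P_def)
  also have "(\<Sum>(i, j)\<in>prod.swap ` P. t i j) = (\<Sum>(i, j)\<in>P. t j i)"
    by (subst sum.reindex) (auto simp: case_prod_beta)
  also have "(\<Sum>(i, j)\<in>P. t i j) + (\<Sum>(i, j)\<in>P. t j i) =
      - (\<Sum>(i, j)\<in>P. \<theta> i * (\<theta> j * evenop (s 2 [\<phi> i, \<phi> j])))"
  proof -
    have "t i j + t j i = - (\<theta> i * (\<theta> j * evenop (s 2 [\<phi> i, \<phi> j])))" for i j
    proof -
      have "t j i = - (\<theta> i * (\<theta> j * (evenop (\<phi> j) * evenop (\<phi> i))))"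
        unfolding t_def mult.assoc[symmetric] \<theta>_swap[of j i] by simp
      then show ?thesis
        by (simp add: t_def s2_eq evenop_diff evenop_times algebra_simps)
    qed
    then have "(\<lambda>(i, j). t i j + t j i) = (\<lambda>(i, j). - (\<theta> i * (\<theta> j * evenop (s 2 [\<phi> i, \<phi> j]))))" by auto
    then show ?thesis by (simp add: case_prod_beta fun_eq_iff flip: sum.distrib sum_negf)
  qed
  finally show ?thesis unfolding P_def by simp
qed

text \<open>
  The products \<open>\<theta>\<^sub>i \<theta>\<^sub>j\<close> are even, so by \<open>oddop_square\<close> the sum is, up to sign, \<open>X ^ 2\<close> inserted into the
  \<open>n\<close> places of \<open>X ^ (n - 1)\<close>.  All these insertions are equal and their signs alternate.
\<close>

lemma sum_insertion_eq_0:
  assumes "finite T" "\<And>k. k \<notin> T \<Longrightarrow> \<phi> k = 0" "even n"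
  shows "(\<Sum>(i, j) | i \<in> T \<and> j \<in> T \<and> i < j. \<theta> i * (\<theta> j * insertion (s 2 [\<phi> i, \<phi> j]) (oddop \<phi>) n)) = 0"
proof -
  define P where "P = {(i, j). i \<in> T \<and> j \<in> T \<and> i < j}"
  define Z where "Z n = (\<Sum>(i, j)\<in>P. \<theta> i * (\<theta> j * insertion (s 2 [\<phi> i, \<phi> j]) (oddop \<phi>) n))" for n
  have Z_Suc: "Z (Suc n) = - (oddop \<phi> * oddop \<phi> * oddop \<phi> ^ n) - oddop \<phi> * Z n" for n
  proof -
    have "Z (Suc n) = (\<Sum>(i, j)\<in>P. \<theta> i * (\<theta> j * evenop (s 2 [\<phi> i, \<phi> j])) * oddop \<phi> ^ n -
        oddop \<phi> * (\<theta> i * (\<theta> j * insertion (s 2 [\<phi> i, \<phi> j]) (oddop \<phi>) n)))"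
      unfolding Z_def insertion.simps right_diff_distrib \<theta>_\<theta>_commutes mult.assoc ..
    also have "\<dots> = (\<Sum>(i, j)\<in>P. \<theta> i * (\<theta> j * evenop (s 2 [\<phi> i, \<phi> j]))) * oddop \<phi> ^ n - oddop \<phi> * Z n"
      unfolding Z_def by (simp add: case_prod_beta sum_subtractf sum_distrib_left sum_distrib_right)
    also have "(\<Sum>(i, j)\<in>P. \<theta> i * (\<theta> j * evenop (s 2 [\<phi> i, \<phi> j]))) = - (oddop \<phi> * oddop \<phi>)"
      unfolding P_def using assms(1,2) by (rule oddop_square)
    finally show ?thesis by simp
  qed
  have "Z (2 * k) = 0" for k
  proof (induction k)
    case 0
    show ?case by (simp add: Z_def)
  next
    case (Suc k)
    have "Z (Suc (Suc (2 * k))) = oddop \<phi> * (oddop \<phi> * Z (2 * k))"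
      unfolding Z_Suc[of "Suc (2 * k)"] Z_Suc[of "2 * k"]
      by (simp add: right_diff_distrib mult.assoc)
    then show ?case by (simp add: Suc.IH)
  qed
  then show ?thesis using assms(3) unfolding Z_def P_def by (elim evenE) simp
qed

text \<open>
  Both sums vanish separately.  Extracting \<open>\<theta>\<^sub>i\<close> and \<open>\<theta>\<^sub>j\<close> produces precisely the signs of the cocycle
  condition; what remains is \<open>sum_insertion_eq_0\<close> for the first sum, and for the second
  \<open>X ^ m X - X X ^ m = 0\<close>, where evenness of \<open>m\<close> lets \<open>\<theta>\<^sub>i\<close> commute with \<open>X ^ m\<close>.
\<close>

theorem adjoint_cocycle_s:
  assumes "even m" "m > 0"
  shows "adjoint_cocycle m A (s 2) (s m)"
  unfolding adjoint_cocycle_def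
proof (intro allI impI)
  fix a :: "nat \<Rightarrow> diff_op"
  define T where "T = {1..m+1}"
  define \<phi> where "\<phi> k = (if k \<in> T then a k else 0)" for k
  define P where "P = {(i, j). 1 \<le> i \<and> i < j \<and> j \<le> m+1}"
  have P: "P = {(i, j). i \<in> T \<and> j \<in> T \<and> i < j}" by (auto simp: P_def T_def)
  have fin: "finite T" by (simp add: T_def)
  have supp: "\<phi> k = 0" if "k \<notin> T" for k using that by (simp add: \<phi>_def)
  have \<phi>0: "\<phi>(0 := 0) = \<phi>" by (rule ext) (simp add: \<phi>_def T_def)
  have above: "card {l \<in> T. i < l} = m + 1 - i" for i
  proof -
    have "{l \<in> T. i < l} = {Suc i..m+1}" by (auto simp: T_def)
    then show ?thesis by simp
  qed
  have map_\<phi>: "map \<phi> (filter Q [1..<m+2]) = map a (filter Q [1..<m+2])" for Q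
    by (auto simp: \<phi>_def T_def)
  have first: "(\<Sum>(i, j)\<in>P. (-1) ^ (i + j) * s m (s 2 [a i, a j] # map a (filter (\<lambda>l. l \<noteq> i \<and> l \<noteq> j) [1..<m+2]))) = 0"
  proof (rule diff_op_eqI)
    fix f
    have summand: "apply_op ((-1) ^ (i + j) * s m (s 2 [a i, a j] # map a (filter (\<lambda>l. l \<noteq> i \<and> l \<noteq> j) [1..<m+2]))) f =
        (- 1) ^ (m - 1) * act (\<theta> i * (\<theta> j * insertion (s 2 [\<phi> i, \<phi> j]) (oddop \<phi>) m)) (vacuum f) T"
      if ij: "(i, j) \<in> P" for i j
    proof -
      define ts where "ts = filter (\<lambda>l. l \<noteq> i \<and> l \<noteq> j) [1..<m+2]"
      have set: "set ts = T - {i} - {j}" by (auto simp: ts_def T_def)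
      have sorted: "sorted_wrt (<) ts" unfolding ts_def by (intro sorted_wrt_filter sorted_wrt_upt)
      have "distinct ts" by (simp add: ts_def)
      then have "length ts = card (T - {i} - {j})" using set distinct_card by metis
      also have "\<dots> = m - 1" using ij fin by (simp add: P T_def)
      finally have len: "length ts = m - 1" .
      have "apply_op (s m (s 2 [a i, a j] # map a ts)) f = apply_op (s (Suc (m - 1)) (s 2 [\<phi> i, \<phi> j] # map \<phi> ts)) f"
      proof -
        have "map \<phi> ts = map a ts" unfolding ts_def by (rule map_\<phi>)
        moreover have "\<phi> i = a i" "\<phi> j = a j" using ij by (simp_all add: \<phi>_def P)
        moreover have "Suc (m - 1) = m" using assms(2) by simp
        ultimately show ?thesis by (simp only:)
      qed
      also have "\<dots> = (- 1) ^ (m - 1) * act (insertion (s 2 [\<phi> i, \<phi> j]) (oddop (\<phi>(0 := 0))) (Suc (m - 1))) (vacuum f) (set ts)"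
        by (rule s_insert_first[OF sorted _ len]) (simp add: set T_def)
      finally have eq: "apply_op (s m (s 2 [a i, a j] # map a ts)) f =
          (- 1) ^ (m - 1) * act (insertion (s 2 [\<phi> i, \<phi> j]) (oddop \<phi>) m) (vacuum f) (T - {i} - {j})"
        using assms(2) by (simp add: \<phi>0 set)
      have above': "{l \<in> T - {i}. j < l} = {l \<in> T. j < l}" using ij by (auto simp: P)
      have \<theta>\<theta>: "act (\<theta> i * (\<theta> j * G)) (vacuum f) T = (- 1) ^ card {l \<in> T. i < l} *
          ((- 1) ^ card {l \<in> T - {i}. j < l} * act G (vacuum f) (T - {i} - {j}))" for G
        using ij fin by (simp add: times_gop.rep_eq act_\<theta> P)
      have sign: "(- 1) ^ (m + 1 - i) * ((- 1) ^ (m + 1 - j) * z) = (- 1) ^ (i + j) * z" for z :: U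
        using ij by (auto simp: minus_one_power_iff P_def)
      show ?thesis
        unfolding ts_def[symmetric] \<theta>\<theta> above' above sign by (simp add: apply_op_power_sign_left eq)
    qed
    have "apply_op (\<Sum>(i, j)\<in>P. (-1) ^ (i + j) * s m (s 2 [a i, a j] # map a (filter (\<lambda>l. l \<noteq> i \<and> l \<noteq> j) [1..<m+2]))) f =
       (\<Sum>(i, j)\<in>P. (- 1) ^ (m - 1) * act (\<theta> i * (\<theta> j * insertion (s 2 [\<phi> i, \<phi> j]) (oddop \<phi>) m)) (vacuum f) T)"
      unfolding apply_op_sum_left by (rule sum.cong[OF refl]) (use summand in auto)
    also have "\<dots> = (- 1) ^ (m - 1) * act (\<Sum>(i, j)\<in>P. \<theta> i * (\<theta> j * insertion (s 2 [\<phi> i, \<phi> j]) (oddop \<phi>) m)) (vacuum f) T"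
      by (simp add: act_sum case_prod_beta sum_distrib_left)
    also have "\<dots> = 0"
      unfolding P using sum_insertion_eq_0[OF fin supp assms(1)] by (simp add: act_simps)
    finally show "apply_op (\<Sum>(i, j)\<in>P. (-1) ^ (i + j) * s m (s 2 [a i, a j] # map a (filter (\<lambda>l. l \<noteq> i \<and> l \<noteq> j) [1..<m+2]))) f = apply_op 0 f"
      by (simp add: zero_diff_op.rep_eq)
  qed
  have second: "(\<Sum>i = 1..m+1. (-1) ^ (i + 1) * s 2 [a i, s m (map a (filter (\<lambda>l. l \<noteq> i) [1..<m+2]))]) = 0"
  proof (rule diff_op_eqI)
    fix f
    have summand: "apply_op ((-1) ^ (i + 1) * s 2 [a i, s m (map a (filter (\<lambda>l. l \<noteq> i) [1..<m+2]))]) f =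
        act (\<theta> i * (oddop \<phi> ^ m * evenop (\<phi> i))) (vacuum f) T - act (\<theta> i * (evenop (\<phi> i) * oddop \<phi> ^ m)) (vacuum f) T"
      if i: "i \<in> T" for i
    proof -
      define ts where "ts = filter (\<lambda>l. l \<noteq> i) [1..<m+2]"
      have set: "set ts = T - {i}" by (auto simp: ts_def T_def)
      have sorted: "sorted_wrt (<) ts" unfolding ts_def by (intro sorted_wrt_filter sorted_wrt_upt)
      have "distinct ts" by (simp add: ts_def)
      then have "length ts = card (T - {i})" using set distinct_card by metis
      also have "\<dots> = m" using i fin by (simp add: T_def)
      finally have len: "length ts = m" .
      have sm: "act (oddop \<phi> ^ m) (vacuum g) (T - {i}) = apply_op (s m (map a ts)) g" for g
        unfolding set[symmetric] map_\<phi>[of "\<lambda>l. l \<noteq> i", folded ts_def, symmetric]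
        by (rule oddop_power_eq_s[OF sorted len])
      have sign: "(- 1) ^ (m + 1 - i) = ((- 1) ^ (i + 1) :: U)"
        using i assms(1) by (auto simp: minus_one_power_iff T_def)
      have \<theta>: "act (\<theta> i * G) (vacuum f) T = (- 1) ^ (i + 1) * act G (vacuum f) (T - {i})" for G
        unfolding sign[symmetric] above[symmetric] using i fin by (simp add: times_gop.rep_eq act_\<theta>)
      have "act (\<theta> i * (oddop \<phi> ^ m * evenop (\<phi> i))) (vacuum f) T =
          (- 1) ^ (i + 1) * apply_op (s m (map a ts)) (apply_op (a i) f)"
        using i unfolding \<theta> by (simp add: times_gop.rep_eq \<phi>_def sm flip: vacuum_apply_op)
      moreover have "act (\<theta> i * (evenop (\<phi> i) * oddop \<phi> ^ m)) (vacuum f) T =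
          (- 1) ^ (i + 1) * apply_op (a i) (apply_op (s m (map a ts)) f)"
        using i unfolding \<theta> by (simp add: times_gop.rep_eq \<phi>_def sm evenop.rep_eq)
      ultimately show ?thesis
        unfolding ts_def[symmetric] apply_op_power_sign_left s2_eq
        by (simp only: minus_diff_op.rep_eq times_diff_op.rep_eq right_diff_distrib)
    qed
    have X: "(\<Sum>i\<in>T. \<theta> i * evenop (\<phi> i)) = oddop \<phi>"
      using oddop_eq_sum[OF fin supp] by simp
    have "apply_op (\<Sum>i = 1..m+1. (-1) ^ (i + 1) * s 2 [a i, s m (map a (filter (\<lambda>l. l \<noteq> i) [1..<m+2]))]) f =
        act ((\<Sum>i\<in>T. \<theta> i * (oddop \<phi> ^ m * evenop (\<phi> i))) - (\<Sum>i\<in>T. \<theta> i * (evenop (\<phi> i) * oddop \<phi> ^ m))) (vacuum f) T"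
      unfolding apply_op_sum_left T_def[symmetric]
      by (simp only: minus_gop.rep_eq act_sum sum_subtractf[symmetric]) (rule sum.cong[OF refl summand])
    also have "(\<Sum>i\<in>T. \<theta> i * (oddop \<phi> ^ m * evenop (\<phi> i))) = oddop \<phi> ^ m * (\<Sum>i\<in>T. \<theta> i * evenop (\<phi> i))"
    proof -
      have "\<theta> i * oddop \<phi> ^ m = oddop \<phi> ^ m * \<theta> i" for i
        using assms(1) by (simp add: \<theta>_power_commutes)
      then have "\<theta> i * (oddop \<phi> ^ m * evenop (\<phi> i)) = oddop \<phi> ^ m * (\<theta> i * evenop (\<phi> i))" for i
        by (metis mult.assoc)
      then show ?thesis by (simp add: sum_distrib_left)
    qed
    also have "(\<Sum>i\<in>T. \<theta> i * (evenop (\<phi> i) * oddop \<phi> ^ m)) = (\<Sum>i\<in>T. \<theta> i * evenop (\<phi> i)) * oddop \<phi> ^ m"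
      by (simp add: sum_distrib_right mult.assoc)
    finally show "apply_op (\<Sum>i = 1..m+1. (-1) ^ (i + 1) * s 2 [a i, s m (map a (filter (\<lambda>l. l \<noteq> i) [1..<m+2]))]) f = apply_op 0 f"
      unfolding X by (simp add: power_commutes act_simps zero_diff_op.rep_eq)
  qed
  show "(\<Sum>(i, j) \<in> {(i, j). 1 \<le> i \<and> i < j \<and> j \<le> m+1}.
           (-1) ^ (i + j) * s m (s 2 [a i, a j] # map a (filter (\<lambda>l. l \<noteq> i \<and> l \<noteq> j) [1..<m+2]))) +
        (\<Sum>i = 1..m+1. (-1) ^ (i + 1) * s 2 [a i, s m (map a (filter (\<lambda>l. l \<noteq> i) [1..<m+2]))]) = 0"
    using first second unfolding P_def by simp
qed

section \<open>Left commutativity and the homotopical Lie identity\<close>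

text \<open>
  The partial derivatives of order \<open>r\<close> of the two odd coefficients.
\<close>

definition jets :: "(nat \<Rightarrow> U) \<Rightarrow> (nat \<Rightarrow> U) \<Rightarrow> nat \<Rightarrow> (nat \<Rightarrow> U) set" where
  "jets p q r = (\<lambda>(w, i). \<lambda>k. (d1 ^^ i) ((d2 ^^ (r - i)) (w k))) ` ({p, q} \<times> {..r})"

lemma finite_jets: "finite (jets p q r)"
  by (simp add: jets_def)

lemma card_jets: "card (jets p q r) \<le> 2 * (r + 1)"
proof -
  have "card (jets p q r) \<le> card ({p, q} \<times> {..r})"
    unfolding jets_def by (rule card_image_le) simp
  also have "\<dots> \<le> 2 * (r + 1)"
    unfolding card_cartesian_product by (intro mult_le_mono) (auto simp: card_insert_if)
  finally show ?thesis .
qed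

lemma jets_0: "p \<in> jets p q 0" "q \<in> jets p q 0"
  by (auto simp: jets_def image_iff)

lemma d1_jets:
  assumes "u \<in> jets p q r"
  shows "(\<lambda>k. d1 (u k)) \<in> jets p q (Suc r)"
proof -
  obtain w i where wi: "w \<in> {p, q}" "i \<le> r" "u = (\<lambda>k. (d1 ^^ i) ((d2 ^^ (r - i)) (w k)))"
    using assms unfolding jets_def by auto
  then have "(\<lambda>k. d1 (u k)) = (\<lambda>(w, i). \<lambda>k. (d1 ^^ i) ((d2 ^^ (Suc r - i)) (w k))) (w, Suc i)" by simp
  then show ?thesis unfolding jets_def by (rule image_eqI) (use wi in auto)
qed

lemma d2_jets:
  assumes "u \<in> jets p q r"
  shows "(\<lambda>k. d2 (u k)) \<in> jets p q (Suc r)"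
proof -
  obtain w i where wi: "w \<in> {p, q}" "i \<le> r" "u = (\<lambda>k. (d1 ^^ i) ((d2 ^^ (r - i)) (w k)))"
    using assms unfolding jets_def by auto
  then have "(\<lambda>k. d2 (u k)) = (\<lambda>(w, i). \<lambda>k. (d1 ^^ i) ((d2 ^^ (Suc r - i)) (w k))) (w, i)"
    by (simp add: d2_d1_funpow Suc_diff_le)
  then show ?thesis unfolding jets_def by (rule image_eqI) (use wi in auto)
qed

text \<open>
  A derivative of order \<open>r\<close> gets weight \<open>r - 2\<close>.  Only orders 0 and 1 are negative, so the sum is
  smallest when both derivatives of order 0 and all four of order 1 occur, where it is
  \<open>2 * (- 2) + 4 * (- 1) = - 8\<close>.
\<close>

lemma sum_jet_weights:
  assumes "distinct js" "\<And>z. z \<in> set js \<Longrightarrow> snd z \<in> jets p q (fst z)"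
  shows "(\<Sum>z\<leftarrow>js. int (fst z) - 2) \<ge> - 8"
proof -
  have bound: "card {z \<in> set js. fst z = r} \<le> 2 * (r + 1)" for r
  proof -
    have "card {z \<in> set js. fst z = r} \<le> card ({r} \<times> jets p q r)"
    proof (rule card_mono)
      show "{z \<in> set js. fst z = r} \<subseteq> {r} \<times> jets p q r"
        using assms(2) by (force simp: mem_Times_iff)
    qed (simp add: finite_jets)
    also have "\<dots> \<le> 2 * (r + 1)" using card_jets by (simp add: card_cartesian_product)
    finally show ?thesis .
  qed
  have "(\<Sum>z\<in>set js. (if fst z = 0 then - 2 else 0) + (if fst z = 1 then - 1 else 0)) \<le> (\<Sum>z\<in>set js. int (fst z) - 2)"
    by (rule sum_mono) auto
  moreover have "(\<Sum>z\<in>set js. (if fst z = 0 then - 2 else 0) + (if fst z = 1 then - 1 else (0 :: int))) =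
      - 2 * int (card {z \<in> set js. fst z = 0}) - int (card {z \<in> set js. fst z = 1})"
    by (simp add: sum.distrib flip: sum.inter_filter)
  moreover have "(\<Sum>z\<leftarrow>js. int (fst z) - 2) = (\<Sum>z\<in>set js. int (fst z) - 2)"
    using assms(1) by (rule sum_list_distinct_conv_sum_set)
  ultimately show ?thesis using bound[of 0] bound[of 1] by simp
qed

text \<open>
  The additive span of products that begin with odd jets of total weight at most \<open>m\<close>, the remaining
  factors being arbitrary.  The empty product of jets has weight \<open>0\<close>, hence the first rule.
\<close>

inductive weight_at_most :: "(nat \<Rightarrow> U) \<Rightarrow> (nat \<Rightarrow> U) \<Rightarrow> int \<Rightarrow> gop \<Rightarrow> bool" for p q where
  nonneg: "m \<ge> 0 \<Longrightarrow> weight_at_most p q m g"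
| jet: "u \<in> jets p q r \<Longrightarrow> weight_at_most p q m g \<Longrightarrow> m' = m + int r - 2 \<Longrightarrow> weight_at_most p q m' (odd_elt u * g)"
| add: "weight_at_most p q m g \<Longrightarrow> weight_at_most p q m h \<Longrightarrow> weight_at_most p q m (g + h)"

text \<open>
  By \<open>sum_jet_weights\<close>, a product of odd jets of total weight below \<open>- 8\<close> contains some jet twice, and an
  odd element squares to \<open>0\<close>.
\<close>

lemma weight_below_eq_0:
  assumes "weight_at_most p q m g" "m < - 8"
  shows "g = 0"
proof -
  \<comment> \<open>The jets collected so far are kept in a separate list of pairs (order, jet), on the left.\<close>
  have "prod_list (map (odd_elt \<circ> snd) js) * g = 0"
    if "weight_at_most p q m g" "\<And>z. z \<in> set js \<Longrightarrow> snd z \<in> jets p q (fst z)"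
      "(\<Sum>z\<leftarrow>js. int (fst z) - 2) + m < - 8" for js
    using that
  proof (induction arbitrary: js rule: weight_at_most.induct)
    case (nonneg m g)
    then have "(\<Sum>z\<leftarrow>js. int (fst z) - 2) < - 8" by linarith
    then have "\<not> distinct js" using sum_jet_weights[of js p q] nonneg.prems(1) by force
    then have "\<not> distinct (map snd js)" by (auto simp: distinct_map)
    then have "prod_list (map odd_elt (map snd js)) = 0" by (rule odd_elt_prod_not_distinct)
    then show ?case by (simp add: comp_def)
  next
    case (jet u r m g m')
    have "prod_list (map (odd_elt \<circ> snd) (js @ [(r, u)])) * g = 0"
      using jet.prems jet.hyps by (intro jet.IH) auto
    then show ?case by (simp add: mult.assoc comp_def)
  next
    case (add m g h)
    then show ?case by (simp add: distrib_left)
  qed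
  from this[of "[]"] show ?thesis using assms by simp
qed

text \<open>
  A derivation either passes a jet or raises its order by one.
\<close>

lemma weight_D1: "weight_at_most p q m g \<Longrightarrow> weight_at_most p q (m + 1) (evenop D1 * g)"
proof (induction rule: weight_at_most.induct)
  case (jet u r m g m')
  have "weight_at_most p q (m' + 1) (odd_elt u * (evenop D1 * g) + odd_elt (\<lambda>k. d1 (u k)) * g)"
    using jet
    by (intro weight_at_most.add weight_at_most.jet[of u p q r "m + 1"] weight_at_most.jet[of _ p q "Suc r" m] d1_jets) auto
  then show ?case by (simp add: D1_odd_elt distrib_right flip: mult.assoc)
qed (auto intro: weight_at_most.intros simp: distrib_left)

lemma weight_D2: "weight_at_most p q m g \<Longrightarrow> weight_at_most p q (m + 1) (evenop D2 * g)"
proof (induction rule: weight_at_most.induct)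
  case (jet u r m g m')
  have "weight_at_most p q (m' + 1) (odd_elt u * (evenop D2 * g) + odd_elt (\<lambda>k. d2 (u k)) * g)"
    using jet
    by (intro weight_at_most.add weight_at_most.jet[of u p q r "m + 1"] weight_at_most.jet[of _ p q "Suc r" m] d2_jets) auto
  then show ?case by (simp add: D2_odd_elt distrib_right flip: mult.assoc)
qed (auto intro: weight_at_most.intros simp: distrib_left)

lemma weight_function: "weight_at_most p q m g \<Longrightarrow> weight_at_most p q m (evenop (w \<cdot> 1) * g)"
proof (induction rule: weight_at_most.induct)
  case (jet u r m g m')
  then have "weight_at_most p q m' (odd_elt u * (evenop (w \<cdot> 1) * g))"
    by (intro weight_at_most.jet)
  then show ?case by (simp add: odd_elt_mult_op flip: mult.assoc)
qed (auto intro: weight_at_most.intros simp: distrib_left)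

text \<open>
  Each factor \<open>X\<close> adds a jet of order 0, of weight \<open>- 2\<close>, and a derivation, of weight at most 1.
\<close>

lemma weight_X_power:
  assumes "weight_at_most p q m g"
  shows "weight_at_most p q (m - int n) (oddop (vector_field_family p q) ^ n * g)"
proof (induction n)
  case (Suc n)
  let ?g = "oddop (vector_field_family p q) ^ n * g"
  have "weight_at_most p q (m - int (Suc n)) (odd_elt p * (evenop D1 * ?g) + odd_elt q * (evenop D2 * ?g))"
    by (intro weight_at_most.add; rule weight_at_most.jet[of _ p q 0 "m - int n + 1"])
       (auto intro: jets_0 weight_D1 weight_D2 Suc)
  then show ?case by (simp add: oddop_Vect2 distrib_right mult.assoc)
qed (simp add: assms)

lemma weight_Vect2:
  assumes "weight_at_most p q m g" "Z \<in> Vect2"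
  shows "weight_at_most p q (m + 1) (evenop Z * g)"
proof -
  obtain u v where Z: "Z = u \<cdot> D1 + v \<cdot> D2" using assms(2) unfolding Vect2_def by blast
  have "weight_at_most p q (m + 1) (evenop (u \<cdot> 1) * (evenop D1 * g) + evenop (v \<cdot> 1) * (evenop D2 * g))"
    by (intro weight_at_most.add weight_function weight_D1 weight_D2 assms)
  also have "evenop (u \<cdot> 1) * (evenop D1 * g) + evenop (v \<cdot> 1) * (evenop D2 * g) = evenop Z * g"
    unfolding Z evenop_add scale_simps(1)[of u D1] scale_simps(1)[of v D2] evenop_times
    by (simp add: distrib_right mult.assoc)
  finally show ?thesis .
qed

text \<open>
  Ten factors \<open>X\<close> and one ordinary vector field give weight at most \<open>- 10 + 1 < - 8\<close>.
\<close>

lemma oddop_power_Vect2_power_eq_0: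
  assumes "Z \<in> Vect2" "a + b = 10"
  shows "oddop (vector_field_family p q) ^ b * (evenop Z * oddop (vector_field_family p q) ^ a) = 0"
proof -
  have "weight_at_most p q 0 1" by (rule weight_at_most.nonneg) simp
  then have "weight_at_most p q (0 - int a + 1 - int b)
      (oddop (vector_field_family p q) ^ b * (evenop Z * (oddop (vector_field_family p q) ^ a * 1)))"
    using assms(1) by (intro weight_X_power weight_Vect2)
  then show ?thesis using assms(2) by (intro weight_below_eq_0) auto
qed

lemma word_sign_nonzero: "word_sign w \<noteq> 0"
  by (induction w) auto

text \<open>
  The operator \<open>Z\<close> is absorbed into the family at the preceding position of the word, or into \<open>f\<close> if
  there is none.
\<close>

lemma skew_product:
  assumes "distinct (v @ w)"
  shows "act (oddop \<phi> ^ length w * (evenop Z * oddop \<phi> ^ length v)) (vacuum f) (set (v @ w)) =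
    of_int (word_sign (rev (v @ w))) * apply_op (\<Sum>\<sigma> | \<sigma> permutes set (v @ w). of_int (sign \<sigma>) *
      (prod_list (map (\<phi> \<circ> \<sigma>) v) * Z * prod_list (map (\<phi> \<circ> \<sigma>) w))) f"
proof -
  have map2_replicate: "map2 (\<lambda>\<phi> k. \<phi> k) (replicate n \<phi>) l = map \<phi> l"
    if "length l = n" for n and l :: "nat list"
    using that by (intro nth_equalityI) auto
  have power: "prod_list (map oddop (replicate n \<phi>)) = oddop \<phi> ^ n" for n
    by (simp only: map_replicate prod_list_replicate)
  show ?thesis
  proof (cases v rule: rev_cases)
    case Nil
    have "act (prod_list (map oddop (replicate (length w) \<phi>))) (vacuum (apply_op Z f)) (set (rev w)) =
        of_int (word_sign (rev w)) * apply_op (\<Sum>\<sigma> | \<sigma> permutes set (rev w). of_int (sign \<sigma>) *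
          prod_list (rev (map2 (\<lambda>\<phi> k. \<phi> k) (replicate (length w) \<phi>) (map \<sigma> (rev w))))) (apply_op Z f)"
      using assms by (intro oddop_product_eq_skew_sum) simp_all
    moreover have "rev (map2 (\<lambda>\<phi> k. \<phi> k) (replicate (length w) \<phi>) (map \<sigma> (rev w))) = map (\<phi> \<circ> \<sigma>) w" for \<sigma>
      by (simp add: map2_replicate rev_map)
    moreover have "apply_op (\<Sum>\<sigma> | \<sigma> permutes set w. of_int (sign \<sigma>) * prod_list (map (\<phi> \<circ> \<sigma>) w)) (apply_op Z f) =
        apply_op (\<Sum>\<sigma> | \<sigma> permutes set w. of_int (sign \<sigma>) * (Z * prod_list (map (\<phi> \<circ> \<sigma>) w))) f"
      by (simp add: apply_op_sum_left apply_op_of_int times_diff_op.rep_eq[of Z])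
    ultimately show ?thesis
      by (simp only: Nil power vacuum_apply_op times_gop.rep_eq set_rev append_Nil list.size power_0 one_gop.rep_eq
          list.map prod_list.Nil mult_1_left)
  next
    case (snoc v' k)
    let ?\<phi>s = "replicate (length w) \<phi> @ [\<lambda>k. \<phi> k * Z] @ replicate (length v') \<phi>"
    have prod: "prod_list (map oddop ?\<phi>s) = oddop \<phi> ^ length w * (evenop Z * oddop \<phi> ^ length v)"
      by (simp add: power snoc mult.assoc flip: evenop_oddop)
    have word: "rev (map2 (\<lambda>\<phi> k. \<phi> k) ?\<phi>s (map \<sigma> (rev (v @ w)))) =
        map (\<phi> \<circ> \<sigma>) v' @ [\<phi> (\<sigma> k) * Z] @ map (\<phi> \<circ> \<sigma>) w" for \<sigma>
    proof -
      have "map2 (\<lambda>\<phi> k. \<phi> k) ?\<phi>s (map \<sigma> (rev (v @ w))) =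
         map2 (\<lambda>\<phi> k. \<phi> k) (replicate (length w) \<phi>) (map \<sigma> (rev w)) @ [\<phi> (\<sigma> k) * Z] @
         map2 (\<lambda>\<phi> k. \<phi> k) (replicate (length v') \<phi>) (map \<sigma> (rev v'))"
        unfolding snoc by (simp add: zip_append)
      then show ?thesis by (simp add: map2_replicate rev_map)
    qed
    have "act (prod_list (map oddop ?\<phi>s)) (vacuum f) (set (rev (v @ w))) =
        of_int (word_sign (rev (v @ w))) * apply_op (\<Sum>\<sigma> | \<sigma> permutes set (rev (v @ w)). of_int (sign \<sigma>) *
          prod_list (rev (map2 (\<lambda>\<phi> k. \<phi> k) ?\<phi>s (map \<sigma> (rev (v @ w)))))) f"
      by (rule oddop_product_eq_skew_sum) (use assms in \<open>auto simp: snoc\<close>)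
    moreover have "prod_list (map (\<phi> \<circ> \<sigma>) v' @ [\<phi> (\<sigma> k) * Z] @ map (\<phi> \<circ> \<sigma>) w) =
        prod_list (map (\<phi> \<circ> \<sigma>) v) * Z * prod_list (map (\<phi> \<circ> \<sigma>) w)" for \<sigma>
      by (simp add: snoc mult.assoc)
    ultimately show ?thesis by (simp only: prod word set_rev)
  qed
qed

lemma skew_word_eq_0:
  fixes v w :: "nat list"
  assumes "distinct (v @ w)" "a ` set (v @ w) \<subseteq> Vect2"
    and zero: "\<And>p q. oddop (vector_field_family p q) ^ length w * (evenop Z * oddop (vector_field_family p q) ^ length v) = 0"
  shows "(\<Sum>\<sigma> | \<sigma> permutes set (v @ w). of_int (sign \<sigma>) *
      (prod_list (map (a \<circ> \<sigma>) v) * Z * prod_list (map (a \<circ> \<sigma>) w))) = 0"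
proof -
  obtain p q where pq: "\<And>k. k \<in> set (v @ w) \<Longrightarrow> a k = vector_field_family p q k"
    using Vect2_choice[OF assms(2)] by metis
  let ?\<Phi> = "vector_field_family p q"
  have "(\<Sum>\<sigma> | \<sigma> permutes set (v @ w). of_int (sign \<sigma>) *
      (prod_list (map (a \<circ> \<sigma>) v) * Z * prod_list (map (a \<circ> \<sigma>) w))) =
    (\<Sum>\<sigma> | \<sigma> permutes set (v @ w). of_int (sign \<sigma>) *
      (prod_list (map (?\<Phi> \<circ> \<sigma>) v) * Z * prod_list (map (?\<Phi> \<circ> \<sigma>) w)))"
  proof (rule sum.cong[OF refl])
    fix \<sigma> assume "\<sigma> \<in> {\<sigma>. \<sigma> permutes set (v @ w)}"
    then have \<sigma>: "\<sigma> permutes set (v @ w)" by simp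
    have "a (\<sigma> k) = ?\<Phi> (\<sigma> k)" if "k \<in> set (v @ w)" for k
      using that by (intro pq) (simp only: permutes_in_image[OF \<sigma>])
    then have "map (a \<circ> \<sigma>) v = map (?\<Phi> \<circ> \<sigma>) v" "map (a \<circ> \<sigma>) w = map (?\<Phi> \<circ> \<sigma>) w"
      by simp_all
    then show "of_int (sign \<sigma>) * (prod_list (map (a \<circ> \<sigma>) v) * Z * prod_list (map (a \<circ> \<sigma>) w)) =
      of_int (sign \<sigma>) * (prod_list (map (?\<Phi> \<circ> \<sigma>) v) * Z * prod_list (map (?\<Phi> \<circ> \<sigma>) w))" by (simp only:)
  qed
  also have "\<dots> = 0"
  proof (rule diff_op_eqI)
    fix f
    show "apply_op (\<Sum>\<sigma> | \<sigma> permutes set (v @ w). of_int (sign \<sigma>) *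
      (prod_list (map (?\<Phi> \<circ> \<sigma>) v) * Z * prod_list (map (?\<Phi> \<circ> \<sigma>) w))) f = apply_op 0 f"
      using skew_product[OF assms(1), of ?\<Phi> Z f] word_sign_nonzero[of "rev (v @ w)"]
      by (simp add: zero zero_gop.rep_eq zero_diff_op.rep_eq del: set_append)
  qed
  finally show ?thesis .
qed

text \<open>
  Expanding both operations gives one word for each pair of permutations: the inner word is substituted
  for the last argument, which has number 6, of the outer one.
\<close>

lemma s6_nested_words:
  "\<exists>I c W. finite (I :: ((nat \<Rightarrow> nat) \<times> (nat \<Rightarrow> nat)) set) \<and> (\<forall>i\<in>I. distinct (W i) \<and> set (W i) = {1..11}) \<and>
     (\<forall>g. s 6 (map g [1..<6] @ [s 6 (map g [6..<12])]) = (\<Sum>i\<in>I. of_int (c i) * prod_list (map g (W i))))"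
proof -
  define I where "I = {\<tau> :: nat \<Rightarrow> nat. \<tau> permutes {..<6}} \<times> {\<tau> :: nat \<Rightarrow> nat. \<tau> permutes {..<6}}"
  define outer where "outer \<tau> = permute_list \<tau> [1..<7]" for \<tau> :: "nat \<Rightarrow> nat"
  define inner where "inner \<tau> = permute_list \<tau> [6..<12]" for \<tau> :: "nat \<Rightarrow> nat"
  define W where "W = (\<lambda>(\<tau>, \<tau>'). concat (map (\<lambda>k. if k = 6 then inner \<tau>' else [k]) (outer \<tau>)))"
  define c :: "(nat \<Rightarrow> nat) \<times> (nat \<Rightarrow> nat) \<Rightarrow> int" where "c = (\<lambda>(\<tau>, \<tau>'). sign \<tau> * sign \<tau>')"
  have outer: "\<exists>l1 l2. outer \<tau> = l1 @ 6 # l2 \<and> distinct (l1 @ l2) \<and> set (l1 @ l2) = {1..5}"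
    if "\<tau> permutes {..<6}" for \<tau>
  proof -
    have "set (outer \<tau>) = set [1..<7]" "distinct (outer \<tau>)"
      unfolding outer_def using that by (simp_all add: set_permute_list distinct_permute_list del: upt_rec_numeral)
    moreover have "set [1..<7] = {1..6 :: nat}" by auto
    ultimately have *: "set (outer \<tau>) = {1..6}" "distinct (outer \<tau>)" by simp_all
    then have "6 \<in> set (outer \<tau>)" by simp
    then obtain l1 l2 where l: "outer \<tau> = l1 @ 6 # l2" by (meson split_list)
    then have "distinct (l1 @ l2)" using *(2) by simp
    moreover have "set (l1 @ l2) = {1..6} - {6}" using * unfolding l by auto
    moreover have "{1..6} - {6 :: nat} = {1..5}" by auto
    ultimately show ?thesis using l by (intro exI[of _ l1] exI[of _ l2]) (simp only: simp_thms)
  qed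
  have inner: "set (inner \<tau>) = {6..11}" "distinct (inner \<tau>)" if "\<tau> permutes {..<6}" for \<tau>
  proof -
    have "set (inner \<tau>) = set [6..<12]" "distinct (inner \<tau>)"
      unfolding inner_def using that by (simp_all add: set_permute_list distinct_permute_list del: upt_rec_numeral)
    moreover have "set [6..<12] = {6..11 :: nat}" by auto
    ultimately show "set (inner \<tau>) = {6..11}" "distinct (inner \<tau>)" by simp_all
  qed
  have W: "W (\<tau>, \<tau>') = l1 @ inner \<tau>' @ l2"
    if "outer \<tau> = l1 @ 6 # l2" "set (l1 @ l2) = {1..5}" for \<tau> \<tau>' l1 l2
  proof -
    have single: "concat (map (\<lambda>k. if k = 6 then inner \<tau>' else [k]) l) = l" if "6 \<notin> set l" for l
      using that by (induction l) auto
    have "6 \<notin> set (l1 @ l2)" unfolding that(2) by simp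
    then have "6 \<notin> set l1" "6 \<notin> set l2" by simp_all
    then show ?thesis by (simp add: W_def that(1) single)
  qed
  have "distinct (W i) \<and> set (W i) = {1..11}" if i: "i \<in> I" for i
  proof -
    obtain \<tau> \<tau>' where \<tau>: "i = (\<tau>, \<tau>')" "\<tau> permutes {..<6}" "\<tau>' permutes {..<6}" using i by (auto simp: I_def)
    obtain l1 l2 where l: "outer \<tau> = l1 @ 6 # l2" "distinct (l1 @ l2)" "set (l1 @ l2) = {1..5}"
      using outer[OF \<tau>(2)] by blast
    have u: "set l1 \<union> set l2 = {1..5}" using l(3) by simp
    have "(set l1 \<union> set l2) \<inter> set (inner \<tau>') = {}" unfolding u inner(1)[OF \<tau>(3)] by auto
    then have "distinct (l1 @ inner \<tau>' @ l2)" using l(2) inner(2)[OF \<tau>(3)] by auto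
    moreover have "set (l1 @ inner \<tau>' @ l2) = (set l1 \<union> set l2) \<union> set (inner \<tau>')" by auto
    moreover have "(set l1 \<union> set l2) \<union> set (inner \<tau>') = {1..11}" unfolding u inner(1)[OF \<tau>(3)] by auto
    ultimately show ?thesis unfolding \<tau>(1) W[OF l(1,3)] by (simp only: simp_thms)
  qed
  moreover have "s 6 (map g [1..<6] @ [s 6 (map g [6..<12])]) = (\<Sum>i\<in>I. of_int (c i) * prod_list (map g (W i)))" for g
  proof -
    define P where "P = s 6 (map g [6..<12])"
    have P: "P = (\<Sum>\<tau>' | \<tau>' permutes {..<6}. of_int (sign \<tau>') * prod_list (map g (inner \<tau>')))"
      unfolding P_def s_def skew_sum_def inner_def
      by (rule sum.cong) (simp_all add: permute_list_map del: upt_rec_numeral)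
    have "map g [1..<6] @ [P] = map (g(6 := P)) [1..<7]"
      by (simp add: upt_rec)
    then have "s 6 (map g [1..<6] @ [P]) = (\<Sum>\<tau> | \<tau> permutes {..<6}. of_int (sign \<tau>) * prod_list (map (g(6 := P)) (outer \<tau>)))"
      unfolding s_def skew_sum_def outer_def
      by (simp only:) (rule sum.cong; simp add: permute_list_map del: upt_rec_numeral)
    also have "\<dots> = (\<Sum>\<tau> | \<tau> permutes {..<6}. \<Sum>\<tau>' | \<tau>' permutes {..<6}.
        of_int (c (\<tau>, \<tau>')) * prod_list (map g (W (\<tau>, \<tau>'))))"
    proof (rule sum.cong[OF refl])
      fix \<tau> :: "nat \<Rightarrow> nat" assume "\<tau> \<in> {\<tau>. \<tau> permutes {..<6}}"
      then obtain l1 l2 where l: "outer \<tau> = l1 @ 6 # l2" "set (l1 @ l2) = {1..5}"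
        using outer by blast
      have "6 \<notin> set (l1 @ l2)" unfolding l(2) by simp
      then have "6 \<notin> set l1" "6 \<notin> set l2" by simp_all
      then have "prod_list (map (g(6 := P)) (outer \<tau>)) = prod_list (map g l1) * (P * prod_list (map g l2))"
        unfolding l(1) by (simp add: map_fun_upd)
      then have "of_int (sign \<tau>) * prod_list (map (g(6 := P)) (outer \<tau>)) =
          (\<Sum>\<tau>' | \<tau>' permutes {..<6}. of_int (sign \<tau>) * (prod_list (map g l1) *
            (of_int (sign \<tau>') * prod_list (map g (inner \<tau>')) * prod_list (map g l2))))"
        unfolding P by (simp add: sum_distrib_left sum_distrib_right)
      also have "\<dots> = (\<Sum>\<tau>' | \<tau>' permutes {..<6}. of_int (c (\<tau>, \<tau>')) * prod_list (map g (W (\<tau>, \<tau>'))))"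
      proof (rule sum.cong[OF refl])
        fix \<tau>' :: "nat \<Rightarrow> nat"
        show "of_int (sign \<tau>) * (prod_list (map g l1) *
            (of_int (sign \<tau>') * prod_list (map g (inner \<tau>')) * prod_list (map g l2))) =
          of_int (c (\<tau>, \<tau>')) * prod_list (map g (W (\<tau>, \<tau>')))"
          unfolding W[OF l] c_def
          by (cases \<tau>' rule: sign_cases) (simp_all add: mult.assoc)
      qed
      finally show "of_int (sign \<tau>) * prod_list (map (g(6 := P)) (outer \<tau>)) =
          (\<Sum>\<tau>' | \<tau>' permutes {..<6}. of_int (c (\<tau>, \<tau>')) * prod_list (map g (W (\<tau>, \<tau>'))))" .
    qed
    also have "\<dots> = (\<Sum>i\<in>I. of_int (c i) * prod_list (map g (W i)))"
      unfolding I_def by (simp add: sum.cartesian_product)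
    finally show ?thesis unfolding P_def .
  qed
  moreover have "finite I" unfolding I_def by (simp add: finite_permutations)
  ultimately show ?thesis by blast
qed

lemma skew_s6_nested_eq_0:
  assumes "\<And>w. distinct w \<Longrightarrow> set w = {1..11} \<Longrightarrow>
    (\<Sum>\<sigma> | \<sigma> permutes T. of_int (sign \<sigma>) * prod_list (map (a \<circ> \<sigma>) w)) = 0"
  shows "(\<Sum>\<sigma> | \<sigma> permutes T. of_int (sign \<sigma>) *
    s 6 (map (a \<circ> \<sigma>) [1..<6] @ [s 6 (map (a \<circ> \<sigma>) [6..<12])])) = 0"
proof -
  obtain I :: "((nat \<Rightarrow> nat) \<times> (nat \<Rightarrow> nat)) set" and c :: "(nat \<Rightarrow> nat) \<times> (nat \<Rightarrow> nat) \<Rightarrow> int" and W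
    where I: "finite I" "\<And>i. i \<in> I \<Longrightarrow> distinct (W i)" "\<And>i. i \<in> I \<Longrightarrow> set (W i) = {1..11}"
      "\<And>g. s 6 (map g [1..<6] @ [s 6 (map g [6..<12])]) = (\<Sum>i\<in>I. of_int (c i) * prod_list (map g (W i)))"
    using s6_nested_words by blast
  have "(\<Sum>\<sigma> | \<sigma> permutes T. of_int (sign \<sigma>) * s 6 (map (a \<circ> \<sigma>) [1..<6] @ [s 6 (map (a \<circ> \<sigma>) [6..<12])])) =
      (\<Sum>i\<in>I. \<Sum>\<sigma> | \<sigma> permutes T. of_int (sign \<sigma>) * (of_int (c i) * prod_list (map (a \<circ> \<sigma>) (W i))))"
    unfolding I(4) sum_distrib_left by (rule sum.swap)
  also have "\<dots> = (\<Sum>i\<in>I. of_int (c i) * (\<Sum>\<sigma> | \<sigma> permutes T. of_int (sign \<sigma>) * prod_list (map (a \<circ> \<sigma>) (W i))))"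
    by (simp add: sum_distrib_left) (simp flip: mult.assoc of_int_mult add: mult.commute)
  also have "\<dots> = 0" using assms I(2,3) by simp
  finally show ?thesis .
qed

theorem left_commutative_s6: "left_commutative 5 Vect2 (s 6)"
  unfolding left_commutative_def
proof (intro conjI allI impI)
  show "skew_operation (5 + 1) Vect2 (s 6)"
    using skew_operation_s[of 6] s6_in_Vect2 by simp
  fix a :: "nat \<Rightarrow> diff_op" assume a: "a ` {1..2*5+1} \<subseteq> Vect2"
  have "(\<Sum>\<sigma> | \<sigma> permutes {1..10}. of_int (sign \<sigma>) * s 6 (map (a \<circ> \<sigma>) [1..<6] @ [s 6 (map (a \<circ> \<sigma>) [6..<12])])) = 0"
  proof (rule skew_s6_nested_eq_0)
    fix w :: "nat list" assume w: "distinct w" "set w = {1..11}"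
    then have "11 \<in> set w" by simp
    then obtain u v where uv: "w = u @ 11 # v" by (meson split_list)
    have dist: "distinct (u @ v)" using w(1) uv by simp
    have "set (u @ v) = {1..11} - {11}" using w unfolding uv by auto
    moreover have "{1..11} - {11} = {1..10 :: nat}" by auto
    ultimately have set: "set (u @ v) = {1..10}" by simp
    have len: "length u + length v = 10" using distinct_card[OF dist] set by simp
    have Z: "a 11 \<in> Vect2" using a by auto
    have "(\<Sum>\<sigma> | \<sigma> permutes set (u @ v). of_int (sign \<sigma>) *
      (prod_list (map (a \<circ> \<sigma>) u) * a 11 * prod_list (map (a \<circ> \<sigma>) v))) = 0"
      using a by (intro skew_word_eq_0 dist oddop_power_Vect2_power_eq_0 Z len) (auto simp: set simp del: set_append)
    moreover have "prod_list (map (a \<circ> \<sigma>) w) = prod_list (map (a \<circ> \<sigma>) u) * a 11 * prod_list (map (a \<circ> \<sigma>) v)"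
      if "\<sigma> permutes {1..10}" for \<sigma>
      using permutes_not_in[OF that, of 11] by (simp add: uv mult.assoc)
    ultimately show "(\<Sum>\<sigma> | \<sigma> permutes {1..10}. of_int (sign \<sigma>) * prod_list (map (a \<circ> \<sigma>) w)) = 0"
      unfolding set by simp
  qed
  moreover have "map (a \<circ> \<sigma>) [6..<12] = map (a \<circ> \<sigma>) [6..<11] @ [a 11]" if "\<sigma> permutes {1..10}" for \<sigma>
    using permutes_not_in[OF that, of 11] by (simp add: upt_rec)
  ultimately show "(\<Sum>\<sigma> | \<sigma> permutes {1..2*5}. of_int (sign \<sigma>) *
      s 6 (map (a \<circ> \<sigma>) [1..<5+1] @ [s 6 (map (a \<circ> \<sigma>) [5+1..<2*5+1] @ [a (2*5+1)])])) = 0"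
    by (simp del: upt_rec_numeral)
qed

theorem homotopical_Lie_s6: "homotopical_Lie 6 Vect2 (s 6)"
  unfolding homotopical_Lie_def
proof (intro conjI allI impI)
  show "skew_operation 6 Vect2 (s 6)"
    using skew_operation_s[of 6] s6_in_Vect2 by simp
  fix a :: "nat \<Rightarrow> diff_op" assume a: "a ` {1..2*6-1} \<subseteq> Vect2"
  have "(\<Sum>\<sigma> | \<sigma> permutes {1..11}. of_int (sign \<sigma>) * s 6 (map (a \<circ> \<sigma>) [1..<6] @ [s 6 (map (a \<circ> \<sigma>) [6..<12])])) = 0"
  proof (rule skew_s6_nested_eq_0)
    fix w :: "nat list" assume w: "distinct w" "set w = {1..11}"
    have len: "length w = 7 + 4" using distinct_card[OF w(1)] w(2) by simp
    have "(\<Sum>\<sigma> | \<sigma> permutes set ([] @ w). of_int (sign \<sigma>) *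
      (prod_list (map (a \<circ> \<sigma>) []) * 1 * prod_list (map (a \<circ> \<sigma>) w))) = 0"
    proof (rule skew_word_eq_0)
      show "oddop (vector_field_family p q) ^ length w * (evenop 1 * oddop (vector_field_family p q) ^ length []) = 0" for p q
        unfolding len power_add oddop_power_7 by simp
    qed (use a w in auto)
    then show "(\<Sum>\<sigma> | \<sigma> permutes {1..11}. of_int (sign \<sigma>) * prod_list (map (a \<circ> \<sigma>) w)) = 0"
      using w(2) by simp
  qed
  then show "(\<Sum>\<sigma> | \<sigma> permutes {1..2*6-1}. of_int (sign \<sigma>) *
      s 6 (map (a \<circ> \<sigma>) [1..<6] @ [s 6 (map (a \<circ> \<sigma>) [6..<2*6])])) = 0"
    by (simp del: upt_rec_numeral)
qed

section \<open>Primitivity\<close>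

text \<open>
  In \<open>s\<close> the positions are permuted; here the indices of the family are.
\<close>

lemma s_eq_sum_over_permuted_indices:
  fixes ts :: "nat list"
  assumes "sorted_wrt (<) ts" "length ts = n"
  shows "s n (map X ts) = (\<Sum>\<pi> | \<pi> permutes set ts. of_int (sign \<pi>) * prod_list (map (X \<circ> \<pi>) ts))"
proof (rule diff_op_eqI)
  fix f
  have "evenop 1 = 1" by (rule gop_eqI) (simp add: evenop.rep_eq act_simps apply_op_simps)
  moreover have "word_sign (rev ts) = 1"
    using assms(1) by (intro word_sign_decreasing) (simp add: sorted_wrt_rev)
  moreover have "distinct ([] @ ts)" using assms(1) by (simp add: strict_sorted_iff)
  ultimately show "apply_op (s n (map X ts)) f =
      apply_op (\<Sum>\<pi> | \<pi> permutes set ts. of_int (sign \<pi>) * prod_list (map (X \<circ> \<pi>) ts)) f"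
    using skew_product[of "[]" ts X 1 f] oddop_power_eq_s[OF assms, of X f] assms(2) by simp
qed

lemma s_permuted_family:
  fixes ts :: "nat list"
  assumes "sorted_wrt (<) ts" "length ts = n" "\<sigma> permutes set ts"
  shows "s n (map (X \<circ> \<sigma>) ts) = of_int (sign \<sigma>) * s n (map X ts)"
proof -
  have "of_int (sign \<sigma>) * s n (map X ts) =
      (\<Sum>\<pi> | \<pi> permutes set ts. of_int (sign \<sigma>) * (of_int (sign \<pi>) * prod_list (map (X \<circ> \<pi>) ts)))"
    unfolding s_eq_sum_over_permuted_indices[OF assms(1,2)] by (simp add: sum_distrib_left)
  also have "\<dots> = (\<Sum>\<pi> | \<pi> permutes set ts. of_int (sign \<sigma>) * (of_int (sign (\<sigma> \<circ> \<pi>)) * prod_list (map (X \<circ> (\<sigma> \<circ> \<pi>)) ts)))"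
    by (rule setum_permutations_compose_left[OF assms(3)])
  also have "\<dots> = (\<Sum>\<pi> | \<pi> permutes set ts. of_int (sign \<pi>) * prod_list (map (X \<circ> \<sigma> \<circ> \<pi>) ts))"
  proof (rule sum.cong[OF refl])
    fix \<pi> assume "\<pi> \<in> {\<pi>. \<pi> permutes set ts}"
    then have "sign (\<sigma> \<circ> \<pi>) = sign \<sigma> * sign \<pi>"
      using assms(3) permutes_imp_permutation[OF finite_set] by (intro sign_compose) blast+
    moreover have "of_int (sign \<sigma>) * (of_int (sign \<sigma> * sign \<pi>) * z) = of_int (sign \<pi>) * z" for z :: diff_op
      by (simp flip: mult.assoc of_int_mult)
    ultimately show "of_int (sign \<sigma>) * (of_int (sign (\<sigma> \<circ> \<pi>)) * prod_list (map (X \<circ> (\<sigma> \<circ> \<pi>)) ts)) =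
        of_int (sign \<pi>) * prod_list (map (X \<circ> \<sigma> \<circ> \<pi>) ts)"
      by (simp add: comp_assoc)
  qed
  finally show ?thesis unfolding s_eq_sum_over_permuted_indices[OF assms(1,2)] by simp
qed

lemma comm_cscale: "comm (cscale a A) (cscale b B) = cscale (a * b) (comm A B)"
  by (simp add: comm_def cscale_mult diff_op.scale_right_diff_distrib mult.commute)

lemma left_normed_comm_cscale:
  assumes "w \<noteq> []"
  shows "left_normed comm (map (X(i := cscale t (X i))) w) =
    cscale (t ^ count_list w i) (left_normed comm (map X w))"
proof -
  let ?X = "X(i := cscale t (X i))"
  have X: "?X k = cscale (t ^ count_list [k] i) (X k)" for k by simp
  have "foldl comm (cscale a A) (map ?X v) = cscale (a * t ^ count_list v i) (foldl comm A (map X v))" for a A v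
  proof (induction v arbitrary: a A)
    case (Cons k v)
    have "foldl comm (cscale a A) (map ?X (k # v)) =
        foldl comm (cscale (a * t ^ count_list [k] i) (comm A (X k))) (map ?X v)"
      by (simp only: list.map foldl_Cons X comm_cscale)
    also have "\<dots> = cscale (a * t ^ count_list (k # v) i) (foldl comm A (map X (k # v)))"
      unfolding Cons.IH by (simp add: mult.assoc)
    finally show ?case .
  qed simp
  note foldl = this
  obtain k v where w: "w = k # v" using assms by (cases w) auto
  have "left_normed comm (map ?X w) = foldl comm (cscale (t ^ count_list [k] i) (X k)) (map ?X v)"
    unfolding w by (simp only: list.map left_normed.simps X)
  then show ?thesis unfolding foldl w by (simp flip: power_Suc power_add)
qed

text \<open>
  Comparison of the coefficients of \<open>t\<close>, which is possible for polynomials over \<open>\<complex>\<close>: every coefficient of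
  the values on a function \<open>f\<close> is a linear functional, and together these separate operators.
\<close>

lemma linear_part_of_identity:
  assumes "finite K" "\<And>t. cscale t v = (\<Sum>w\<in>K. cscale (t ^ n w) (u w))"
  shows "v = (\<Sum>w | w \<in> K \<and> n w = 1. u w)"
proof (rule diff_op_eqI, rule poly_eqI, rule poly_eqI)
  fix f j i
  define \<kappa> where "\<kappa> A = coeff (coeff (apply_op A f) j) i" for A
  have \<kappa>_sum: "\<kappa> (\<Sum>w\<in>I. A w) = (\<Sum>w\<in>I. \<kappa> (A w))" for I :: "'a set" and A
    by (simp add: \<kappa>_def apply_op_sum_left coeff_sum)
  have \<kappa>_scale: "\<kappa> (cscale c A) = c * \<kappa> A" for c A
    by (simp add: \<kappa>_def cscale_def apply_op_scale const_def)
  define P where "P = (\<Sum>w\<in>K. monom (\<kappa> (u w)) (n w)) - monom (\<kappa> v) 1"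
  have "poly P t = 0" for t
  proof -
    have "t * \<kappa> v = (\<Sum>w\<in>K. t ^ n w * \<kappa> (u w))"
      using arg_cong[OF assms(2)[of t], of \<kappa>] by (simp add: \<kappa>_sum \<kappa>_scale)
    then show ?thesis by (simp add: P_def poly_sum poly_monom mult.commute)
  qed
  then have "P = 0" using poly_all_0_iff_0 by blast
  then have "\<kappa> v = coeff (\<Sum>w\<in>K. monom (\<kappa> (u w)) (n w)) 1" by (simp add: P_def)
  also have "\<dots> = (\<Sum>w\<in>K. if n w = 1 then \<kappa> (u w) else 0)" by (simp add: coeff_sum coeff_monom)
  also have "\<dots> = \<kappa> (\<Sum>w | w \<in> K \<and> n w = 1. u w)"
    unfolding \<kappa>_sum by (rule sum.inter_filter[OF assms(1), symmetric])
  finally show "coeff (coeff (apply_op v f) j) i = coeff (coeff (apply_op (\<Sum>w | w \<in> K \<and> n w = 1. u w) f) j) i"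
    by (simp add: \<kappa>_def)
qed

text \<open>
  Averaging over the cyclic rotations of the first three letters, which are even permutations, makes
  the Jacobi identity appear in the innermost commutators.
\<close>

lemma left_normed_comm_skew_eq_0:
  fixes w :: "nat list"
  assumes "distinct w" "3 \<le> length w"
  shows "(\<Sum>\<sigma> | \<sigma> permutes set w. of_int (sign \<sigma>) * left_normed comm (map (X \<circ> \<sigma>) w)) = 0"
proof -
  obtain i j k v where w: "w = i # j # k # v"
    using assms(2) by (auto simp: numeral_eq_Suc Suc_le_length_iff)
  have neq: "i \<noteq> j" "i \<noteq> k" "j \<noteq> k" "i \<notin> set v" "j \<notin> set v" "k \<notin> set v"
    using assms(1) by (auto simp: w)
  define F where "F \<sigma> = of_int (sign \<sigma>) * left_normed comm (map (X \<circ> \<sigma>) w)" for \<sigma>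
  define c where "c = transpose i j \<circ> transpose j k"
  have c: "c i = j" "c j = k" "c k = i" "\<And>l. l \<in> set v \<Longrightarrow> c l = l"
    using neq by (auto simp: c_def transpose_def)
  have perm: "c permutes set w"
    unfolding c_def by (intro permutes_compose permutes_swap_id) (simp_all add: w)
  have sign_c: "sign c = 1"
    unfolding c_def using neq by (subst sign_compose) (simp_all add: permutation_swap_id sign_swap_id)
  have rotate: "(\<Sum>\<sigma> | \<sigma> permutes set w. F \<sigma>) = (\<Sum>\<sigma> | \<sigma> permutes set w. F (\<sigma> \<circ> c))" for F :: "(nat \<Rightarrow> nat) \<Rightarrow> diff_op"
    by (rule sum_permutations_compose_right[OF perm])
  have "comm (A + B) C = comm A C + comm B C" for A B C
    by (simp add: comm_def algebra_simps)
  then have foldl_add: "foldl comm (A + B) l = foldl comm A l + foldl comm B l" for A B l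
    by (induction l arbitrary: A B) simp_all
  have foldl_0: "foldl comm 0 l = 0" for l
    by (induction l) (simp_all add: comm_def)
  have "F \<sigma> + F (\<sigma> \<circ> c) + F (\<sigma> \<circ> c \<circ> c) = 0" if "\<sigma> permutes set w" for \<sigma>
  proof -
    have p: "permutation \<sigma>" "permutation c"
      using that perm permutes_imp_permutation[OF finite_set] by blast+
    have sign: "sign (\<sigma> \<circ> c) = sign \<sigma>" "sign (\<sigma> \<circ> c \<circ> c) = sign \<sigma>"
      using p by (simp_all add: sign_compose permutation_compose sign_c)
    have v: "map (X \<circ> (\<sigma> \<circ> c)) v = map (X \<circ> \<sigma>) v" "map (X \<circ> (\<sigma> \<circ> c \<circ> c)) v = map (X \<circ> \<sigma>) v"
      using c(4) by simp_all
    let ?A = "X (\<sigma> i)" and ?B = "X (\<sigma> j)" and ?C = "X (\<sigma> k)"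
    have "F \<sigma> + F (\<sigma> \<circ> c) + F (\<sigma> \<circ> c \<circ> c) = of_int (sign \<sigma>) *
        (foldl comm (comm (comm ?A ?B) ?C) (map (X \<circ> \<sigma>) v) + foldl comm (comm (comm ?B ?C) ?A) (map (X \<circ> \<sigma>) v) +
         foldl comm (comm (comm ?C ?A) ?B) (map (X \<circ> \<sigma>) v))"
      unfolding F_def sign distrib_left w list.map left_normed.simps foldl_Cons v by (simp add: c)
    also have "\<dots> = of_int (sign \<sigma>) *
        foldl comm (comm (comm ?A ?B) ?C + comm (comm ?B ?C) ?A + comm (comm ?C ?A) ?B) (map (X \<circ> \<sigma>) v)"
      by (simp only: foldl_add)
    also have "comm (comm ?A ?B) ?C + comm (comm ?B ?C) ?A + comm (comm ?C ?A) ?B = 0"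
      by (simp add: comm_def algebra_simps)
    finally show ?thesis by (simp only: foldl_0 mult_zero_right)
  qed
  then have "(\<Sum>\<sigma> | \<sigma> permutes set w. F \<sigma> + F (\<sigma> \<circ> c) + F (\<sigma> \<circ> c \<circ> c)) = 0"
    by (intro sum.neutral) blast
  moreover have "(\<Sum>\<sigma> | \<sigma> permutes set w. F (\<sigma> \<circ> c)) = (\<Sum>\<sigma> | \<sigma> permutes set w. F \<sigma>)"
    by (rule rotate[symmetric])
  moreover have "(\<Sum>\<sigma> | \<sigma> permutes set w. F (\<sigma> \<circ> c \<circ> c)) = (\<Sum>\<sigma> | \<sigma> permutes set w. F \<sigma>)"
    using rotate[of F] rotate[of "\<lambda>\<sigma>. F (\<sigma> \<circ> c)"] by (simp only:)
  ultimately have "cscale (1 + 1 + 1) (\<Sum>\<sigma> | \<sigma> permutes set w. F \<sigma>) = 0"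
    by (simp only: diff_op.scale_left_distrib diff_op.scale_one sum.distrib)
  then show ?thesis by (simp add: F_def)
qed

text \<open>
  Scaling one argument at a time and keeping the linear part leaves only the words in which every
  letter occurs exactly once.  After skew-symmetrization the left-hand side is \<open>6!\<close> times \<open>s\<^sub>6\<close>, while
  the right-hand side vanishes.
\<close>

theorem s6_primitive: "primitive 6 Vect2 (s 6)"
  unfolding primitive_def
proof
  assume "\<exists>f. Poly_Mapping.keys f \<subseteq> {w. w \<noteq> [] \<and> set w \<subseteq> {1..6}} \<and>
    (\<forall>X. X ` {1..6} \<subseteq> Vect2 \<longrightarrow> s 6 (map X [1..<6+1]) = commutator_value f X)"
  then obtain f where keys: "Poly_Mapping.keys f \<subseteq> {w. w \<noteq> [] \<and> set w \<subseteq> {1..6}}"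
    and f: "\<And>X. X ` {1..6} \<subseteq> Vect2 \<Longrightarrow> s 6 (map X [1..<7]) = commutator_value f X"
    by auto
  define K where "K = Poly_Mapping.keys f"
  define val where "val X w = cscale (Poly_Mapping.lookup f w) (left_normed comm (map X w))" for X w
  have multilinear_part: "s 6 (map X [1..<7]) = (\<Sum>w | w \<in> K \<and> (\<forall>i\<in>I. count_list w i = 1). val X w)"
    if "finite I" "I \<subseteq> {1..6}" "X ` {1..6} \<subseteq> Vect2" for I X
    using that
  proof (induction I arbitrary: X rule: finite_induct)
    case empty
    then show ?case using f[of X] by (simp add: commutator_value_def K_def val_def del: upt_rec_numeral)
  next
    case (insert i I)
    define K' where "K' = {w \<in> K. \<forall>i\<in>I. count_list w i = 1}"
    have K': "finite K'" "\<And>w. w \<in> K' \<Longrightarrow> w \<noteq> []" using keys by (auto simp: K'_def K_def)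
    have i: "1 \<le> i" "i \<le> 6" using insert.prems by auto
    have "cscale t (s 6 (map X [1..<7])) = (\<Sum>w\<in>K'. cscale (t ^ count_list w i) (val X w))" for t
    proof -
      let ?X = "X(i := cscale t (X i))"
      have split: "[1..<7] = [1..<i] @ [i] @ [Suc i..<7]"
      proof -
        have "[1..<7] = [1..<i] @ [i..<7]" using i upt_add_eq_append[of 1 i "7 - i"] by simp
        also have "[i..<7] = i # [Suc i..<7]" using i by (intro upt_conv_Cons) simp
        finally show ?thesis by simp
      qed
      have "s 6 (map X [1..<i] @ [cscale t (X i)] @ map X [Suc i..<7]) =
          cscale t (s 6 (map X [1..<i] @ [X i] @ map X [Suc i..<7]))"
        using i by (intro s_cscale) simp
      moreover have "map ?X [1..<i] = map X [1..<i]" "map ?X [Suc i..<7] = map X [Suc i..<7]"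
        by (auto intro!: map_cong)
      ultimately have "cscale t (s 6 (map X [1..<7])) = s 6 (map ?X [1..<7])"
        unfolding split by simp
      also have "\<dots> = (\<Sum>w\<in>K'. val ?X w)"
      proof -
        have "i \<in> {1..6}" using i by simp
        then have "X i \<in> Vect2" using insert.prems(2) by blast
        then have "?X ` {1..6} \<subseteq> Vect2"
          using insert.prems(2) diff_op.subspace_scale[OF subspace_Vect2] by auto
        moreover have "I \<subseteq> {1..6}" using insert.prems(1) by simp
        ultimately show ?thesis unfolding K'_def by (intro insert.IH)
      qed
      also have "\<dots> = (\<Sum>w\<in>K'. cscale (t ^ count_list w i) (val X w))"
        by (intro sum.cong refl) (simp add: val_def left_normed_comm_cscale K'(2) mult.commute)
      finally show ?thesis .
    qed
    then have "s 6 (map X [1..<7]) = (\<Sum>w | w \<in> K' \<and> count_list w i = 1. val X w)"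
      by (rule linear_part_of_identity[OF K'(1)])
    also have "{w. w \<in> K' \<and> count_list w i = 1} = {w. w \<in> K \<and> (\<forall>i\<in>insert i I. count_list w i = 1)}"
      by (auto simp: K'_def)
    finally show ?case .
  qed
  obtain X where X: "X ` {1..6} \<subseteq> Vect2" "s 6 (map X [1..<7]) \<noteq> 0"
    using s6_nonzero by blast
  define L where "L = {w. w \<in> K \<and> (\<forall>i\<in>{1..6}. count_list w i = 1)}"
  have L: "distinct w" "set w = {1..6}" "3 \<le> length w" if "w \<in> L" for w
  proof -
    have w: "set w \<subseteq> {1..6}" "\<And>i. i \<in> {1..6} \<Longrightarrow> count_list w i = 1"
      using that keys by (auto simp: L_def K_def)
    show set: "set w = {1..6}"
    proof
      show "{1..6} \<subseteq> set w"
      proof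
        fix i :: nat assume "i \<in> {1..6}"
        then have "count_list w i \<noteq> 0" using w(2) by simp
        then show "i \<in> set w" using count_notin by fastforce
      qed
    qed (rule w(1))
    have "length w = (\<Sum>i\<in>{1..6}. count_list w i)" using sum_count_set[OF w(1)] by simp
    also have "\<dots> = card (set w)" using w(2) by (simp add: set)
    finally show dist: "distinct w" by (intro card_distinct) simp
    show "3 \<le> length w" using distinct_card[OF dist] set by simp
  qed
  have sorted: "sorted_wrt (<) [1..<7]" "length [1..<7] = 6" "set [1..<7] = {1..6 :: nat}"
    by (auto simp del: upt_rec_numeral)
  have "(\<Sum>\<sigma> | \<sigma> permutes {1..6 :: nat}. s 6 (map X [1..<7])) =
      (\<Sum>\<sigma> | \<sigma> permutes {1..6}. of_int (sign \<sigma>) * s 6 (map (X \<circ> \<sigma>) [1..<7]))"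
  proof (rule sum.cong[OF refl])
    fix \<sigma> :: "nat \<Rightarrow> nat" assume "\<sigma> \<in> {\<sigma>. \<sigma> permutes {1..6}}"
    then have "s 6 (map (X \<circ> \<sigma>) [1..<7]) = of_int (sign \<sigma>) * s 6 (map X [1..<7])"
      by (intro s_permuted_family sorted) (simp only: sorted mem_Collect_eq)
    then show "s 6 (map X [1..<7]) = of_int (sign \<sigma>) * s 6 (map (X \<circ> \<sigma>) [1..<7])"
      by (cases \<sigma> rule: sign_cases) (simp_all del: upt_rec_numeral)
  qed
  also have "\<dots> = (\<Sum>\<sigma> | \<sigma> permutes {1..6}. of_int (sign \<sigma>) * (\<Sum>w\<in>L. val (X \<circ> \<sigma>) w))"
  proof (rule sum.cong[OF refl])
    fix \<sigma> :: "nat \<Rightarrow> nat" assume "\<sigma> \<in> {\<sigma>. \<sigma> permutes {1..6}}"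
    then have "\<sigma> ` {1..6} = {1..6}" by (simp add: permutes_image)
    then have "(X \<circ> \<sigma>) ` {1..6} \<subseteq> Vect2" using X(1) by (simp only: image_comp[symmetric])
    then have "s 6 (map (X \<circ> \<sigma>) [1..<7]) = (\<Sum>w\<in>L. val (X \<circ> \<sigma>) w)"
      unfolding L_def by (intro multilinear_part) simp_all
    then show "of_int (sign \<sigma>) * s 6 (map (X \<circ> \<sigma>) [1..<7]) = of_int (sign \<sigma>) * (\<Sum>w\<in>L. val (X \<circ> \<sigma>) w)"
      by simp
  qed
  also have "\<dots> = (\<Sum>w\<in>L. \<Sum>\<sigma> | \<sigma> permutes {1..6}. of_int (sign \<sigma>) * val (X \<circ> \<sigma>) w)"
    unfolding sum_distrib_left by (rule sum.swap)
  also have "\<dots> = 0"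
  proof (rule sum.neutral, rule ballI)
    fix w assume w: "w \<in> L"
    have "(\<Sum>\<sigma> | \<sigma> permutes set w. of_int (sign \<sigma>) * val (X \<circ> \<sigma>) w) =
        cscale (Poly_Mapping.lookup f w) (\<Sum>\<sigma> | \<sigma> permutes set w. of_int (sign \<sigma>) * left_normed comm (map (X \<circ> \<sigma>) w))"
      unfolding val_def diff_op.scale_sum_right cscale_mult ..
    also have "\<dots> = 0"
      unfolding left_normed_comm_skew_eq_0[OF L(1,3)[OF w]] by simp
    finally show "(\<Sum>\<sigma> | \<sigma> permutes {1..6}. of_int (sign \<sigma>) * val (X \<circ> \<sigma>) w) = 0"
      unfolding L(2)[OF w] .
  qed
  finally have "cscale (of_nat (card {\<sigma>. \<sigma> permutes {1..6 :: nat}})) (s 6 (map X [1..<7])) = 0"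
    by (simp only: diff_op.sum_constant_scale)
  then show False using X(2) by (simp add: card_permutations del: upt_rec_numeral)
qed

theorem theorem3p3:
  shows
    "(\<exists>X :: nat \<Rightarrow> diff_op. X ` {1..6} \<subseteq> Vect2 \<and> s 6 (map X [1..<7]) \<noteq> 0) \<and>
     (\<forall>X. X ` {1..6} \<subseteq> Vect2 \<longrightarrow> s 6 (map X [1..<7]) \<in> Vect2) \<and>
     (\<forall>X. X ` {1..7} \<subseteq> Vect2 \<longrightarrow> s 7 (map X [1..<8]) = 0) \<and>
     primitive 6 Vect2 (s 6) \<and>
     (\<forall>X. X ` {1..6} \<subseteq> Vect2 \<longrightarrow> s 6 (map X [1..<7]) = s_rsym_r 6 (map X [1..<7])) \<and>
     (\<forall>X. X ` {1..6} \<subseteq> Vect2 \<longrightarrow>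
        s 6 (map X [1..<7]) =
        (\<Sum>i = 1..6. (-1) ^ (i + 1) * (Div (X i) \<cdot> s 5 (map X (filter (\<lambda>l. l \<noteq> i) [1..<7]))))) \<and>
     left_commutative 5 Vect2 (s 6) \<and>
     sh_Lie 6 Vect2 (s 2) (s 6)"
proof (intro conjI allI impI)
  show "\<exists>X :: nat \<Rightarrow> diff_op. X ` {1..6} \<subseteq> Vect2 \<and> s 6 (map X [1..<7]) \<noteq> 0"
    using s6_nonzero by blast
next
  fix X :: "nat \<Rightarrow> diff_op"
  have list: "set (map X [1..<Suc n]) \<subseteq> Vect2" if "X ` {1..n} \<subseteq> Vect2" for n
    using that by auto
  show "s 7 (map X [1..<8]) = 0" if "X ` {1..7} \<subseteq> Vect2"
    using list[OF that] by (intro s7_eq_0) simp_all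
  show "s 6 (map X [1..<7]) = (\<Sum>i = 1..6. (-1) ^ (i + 1) * (Div (X i) \<cdot> s 5 (map X (filter (\<lambda>l. l \<noteq> i) [1..<7]))))"
    if "X ` {1..6} \<subseteq> Vect2"
    using that by (rule s6_eq_Div_s5)
  assume "X ` {1..6} \<subseteq> Vect2"
  then have X: "set (map X [1..<7]) \<subseteq> Vect2" using list[of 6] by simp
  show "s 6 (map X [1..<7]) \<in> Vect2"
    using X by (rule s6_in_Vect2) simp
  show "s 6 (map X [1..<7]) = s_rsym_r 6 (map X [1..<7])"
    using X by (rule s6_eq_s6_rsym_r) simp
next
  show "primitive 6 Vect2 (s 6)" by (rule s6_primitive)
  show "left_commutative 5 Vect2 (s 6)" by (rule left_commutative_s6)
  show "sh_Lie 6 Vect2 (s 2) (s 6)"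
    unfolding sh_Lie_def
    by (intro conjI Lie_algebra_s2 homotopical_Lie_s6 adjoint_cocycle_s) simp_all
qed

end
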